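(* Let $U$ be a universal prefix-free machine and let $X\subseteq 2^{<\omega}$ be a nonempty $\Pi^0_1$ set. Then the number $\Omega_U(X)=\sum_{U(\sigma)\downarrow\in X}2^{-|\sigma|}$ is a Martin-Löf random left-c.e. real.
   Context: A prefix-free machine is a partial computable function $M:2^{<\omega}\to 2^{<\omega}$ whose domain is prefix-free. Fix an effective list $(M_e)$ of all prefix-free machines. A prefix-free machine $U$ is universal if there is a computable function $e\mapsto\sigma_e$ such that for all $e$ and all $\tau\in 2^{<\omega}$, $U(\sigma_e\tau)\simeq M_e(\tau)$ (both sides undefined, or both defined and equal). For a set $X$ of strings, $\Omega_U(X)=\sum_{\sigma:\,U(\sigma)\downarrow\in X}2^{-|\sigma|}$ is the probability that $U$ halts with output in $X$. A $\Pi^0_1$ set is one whose complement is computably enumerable. A real is left-c.e. if it is the limit of a computable increasing sequence of rationals. A real is Martin-Löf random if (the binary expansion of its fractional part) is Martin-Löf random. *)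

theory Defs
  imports "HOL-Analysis.Analysis" "HOL-Library.Sublist" "HOL-Library.Nat_Bijection"
begin

datatype recf = Z | Sc | Proj nat | Cn recf "recf list" | Pr recf recf | Mn recf

inductive eval :: "recf \<Rightarrow> nat list \<Rightarrow> nat \<Rightarrow> bool" where
  zero: "eval Z xs 0"
| suc: "eval Sc (x # xs) (Suc x)"
| proj: "i < length xs \<Longrightarrow> eval (Proj i) xs (xs ! i)"
| cn: "list_all2 (\<lambda>g y. eval g xs y) gs ys \<Longrightarrow> eval f ys z \<Longrightarrow> eval (Cn f gs) xs z"
| pr0: "eval g xs y \<Longrightarrow> eval (Pr g h) (0 # xs) y"
| prS: "eval (Pr g h) (n # xs) y \<Longrightarrow> eval h (n # y # xs) z \<Longrightarrow> eval (Pr g h) (Suc n # xs) z"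
| mn: "eval f (n # xs) 0 \<Longrightarrow> (\<forall>m<n. \<exists>y. eval f (m # xs) (Suc y)) \<Longrightarrow> eval (Mn f) xs n"

text \<open>Bijective coding of binary strings (elements of 2^{<omega}) by natural numbers.\<close>
fun str_code :: "bool list \<Rightarrow> nat" where
  "str_code [] = 0"
| "str_code (b # xs) = 2 * str_code xs + (if b then 2 else 1)"

text \<open>A (surjective) coding of the rationals by natural numbers.\<close>
definition rat_of_code :: "nat \<Rightarrow> real" where
  "rat_of_code n = (case prod_decode n of (a, b) \<Rightarrow> real_of_int (int_decode a) / real (Suc b))"

type_synonym machine = "bool list \<Rightarrow> bool list option"

definition partial_computable_str :: "machine \<Rightarrow> bool" where
  "partial_computable_str M \<longleftrightarrow>
     (\<exists>f. \<forall>\<sigma> \<tau>. M \<sigma> = Some \<tau> \<longleftrightarrow> eval f [str_code \<sigma>] (str_code \<tau>))"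

definition prefix_free_machine :: "machine \<Rightarrow> bool" where
  "prefix_free_machine M \<longleftrightarrow> partial_computable_str M \<and>
     (\<forall>\<sigma> \<tau>. \<sigma> \<in> dom M \<longrightarrow> \<tau> \<in> dom M \<longrightarrow> prefix \<sigma> \<tau> \<longrightarrow> \<sigma> = \<tau>)"

definition effective_list :: "(nat \<Rightarrow> machine) \<Rightarrow> bool" where
  "effective_list V \<longleftrightarrow>
     (\<exists>f. \<forall>e \<tau> \<rho>. V e \<tau> = Some \<rho> \<longleftrightarrow> eval f [e, str_code \<tau>] (str_code \<rho>)) \<and>
     (\<forall>e. prefix_free_machine (V e)) \<and>
     (\<forall>M. prefix_free_machine M \<longrightarrow> (\<exists>e. V e = M))"

definition computable_str_seq :: "(nat \<Rightarrow> bool list) \<Rightarrow> bool" where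
  "computable_str_seq s \<longleftrightarrow> (\<exists>f. \<forall>e. eval f [e] (str_code (s e)))"

definition universal_wrt :: "(nat \<Rightarrow> machine) \<Rightarrow> machine \<Rightarrow> bool" where
  "universal_wrt V U \<longleftrightarrow> prefix_free_machine U \<and>
     (\<exists>s. computable_str_seq s \<and> (\<forall>e \<tau>. U (s e @ \<tau>) = V e \<tau>))"

definition ce_str_set :: "bool list set \<Rightarrow> bool" where
  "ce_str_set A \<longleftrightarrow> (\<exists>f. \<forall>\<sigma>. \<sigma> \<in> A \<longleftrightarrow> (\<exists>y. eval f [str_code \<sigma>] y))"

definition Pi01_str_set :: "bool list set \<Rightarrow> bool" where
  "Pi01_str_set X \<longleftrightarrow> ce_str_set (- X)"

definition ce_seq_set :: "(nat \<times> bool list) set \<Rightarrow> bool" where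
  "ce_seq_set W \<longleftrightarrow> (\<exists>f. \<forall>n \<sigma>. (n, \<sigma>) \<in> W \<longleftrightarrow> (\<exists>y. eval f [n, str_code \<sigma>] y))"

definition Omega :: "machine \<Rightarrow> bool list set \<Rightarrow> real" where
  "Omega U X = (\<Sum>\<^sub>\<infinity>\<sigma>\<in>{\<sigma>. \<exists>\<tau>\<in>X. U \<sigma> = Some \<tau>}. (1/2) ^ length \<sigma>)"

definition left_ce :: "real \<Rightarrow> bool" where
  "left_ce x \<longleftrightarrow> (\<exists>f. (\<forall>n. \<exists>m. eval f [n] m) \<and>
      (\<exists>q. (\<forall>n. eval f [n] (q n)) \<and> incseq (\<lambda>n. rat_of_code (q n)) \<and>
           (\<lambda>n. rat_of_code (q n)) \<longlonglongrightarrow> x))"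

text \<open>The set of reals in [0,1) whose binary expansion (the one not ending in 1s) extends sigma.\<close>
definition dyadic_lo :: "bool list \<Rightarrow> real" where
  "dyadic_lo \<sigma> = (\<Sum>i<length \<sigma>. if \<sigma> ! i then (1/2) ^ (Suc i) else 0)"

definition cyl :: "bool list \<Rightarrow> real set" where
  "cyl \<sigma> = {r. dyadic_lo \<sigma> \<le> r \<and> r < dyadic_lo \<sigma> + (1/2) ^ length \<sigma>}"

definition level :: "(nat \<times> bool list) set \<Rightarrow> nat \<Rightarrow> real set" where
  "level W n = (\<Union>\<sigma>\<in>{\<sigma>. (n, \<sigma>) \<in> W}. cyl \<sigma>)"

definition mltest :: "(nat \<times> bool list) set \<Rightarrow> bool" where
  "mltest W \<longleftrightarrow> ce_seq_set W \<and> (\<forall>n. emeasure lborel (level W n) \<le> ennreal ((1/2) ^ n))"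

definition martin_loef_random :: "real \<Rightarrow> bool" where
  "martin_loef_random x \<longleftrightarrow> (\<forall>W. mltest W \<longrightarrow> frac x \<notin> (\<Inter>n. level W n))"

end

theory Submission
  imports Defs
begin

text \<open>
  Fix a string in X and let \<alpha> be the probability that U outputs it, approximated from below by \<alpha>(s).
  Simulating, inside U, a machine that adds fresh weight to \<alpha> on demand shows that \<alpha> is Solovay complete:
  every computable bounded nondecreasing \<theta> satisfies \<alpha> - \<alpha>(s) \<ge> c (\<theta> - \<theta>(s)) for some c > 0.
  The rest of the probability of X is a difference a - b, where a collects the other halting programs and b
  those whose output is found to leave X. For nondecreasing computable a, the ratio
  (a - a(s)) / (\<alpha> - \<alpha>(s)) is bounded by completeness, and it converges: if it were
  below c and above d > c infinitely often, then the intervals of \<alpha> covered during nested windows (alternately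
  records of c \<alpha> - a and of a - d \<alpha>) would have total length (c/d)^n at depth n while \<alpha> stays inside,
  and a weighted sum of these lengths would contradict completeness.

  The limit of the ratio for b is at most that for a. Otherwise a - b steadily drops while \<alpha> rises. Whole programs are removed, and a program
  known at stage N has weight at least 2^-N. Forcing drops that are tiny compared with 2^-N for N the start of the
  enclosing run, nested d deep, makes each level pay for its drops with removals of its own, so that the total
  length of the runs at depth d is O(1/d), again contradicting completeness.

  Hence the approximation to Omega eventually stays below its limit, at a distance of at least half of
  \<alpha> - \<alpha>(s). This gives a monotone approximation, and completeness transfers: a Martin-Loef test
  covering Omega would yield a \<theta> that \<alpha> fails to dominate.
\<close>

subsection \<open>Computable functions on lists of fixed length\<close>

text \<open>A string of \<open>X\<close> is split off because the remaining difference a - b may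
  well have ratio limit 0, while \<alpha> contributes exactly 1: the total ratio tends to at least
  1, so any factor below 1, such as 1/2, works from some stage on. That stage is found
  non-constructively, but it enters the computations only as a fixed number. It is essential that b
  removes whole items of a: for unrelated nondecreasing a and b, say a = 0 and b = \<alpha>, the
  ratio for a - b can be -1, and the difference need not be left-c.e. The three contradictions with
  completeness have one shape. A family of computable nondecreasing quantities with index i is
  bounded by a multiple of 4^-i; with weights 2^i its sum stays bounded, so completeness supplies a
  single constant for all i, and 2^i beats that constant for large i. Thresholds such as c and d are
  taken dyadic, so that all comparisons between approximations are decided exactly.\<close>

definition fcomp :: "nat \<Rightarrow> (nat list \<Rightarrow> nat) \<Rightarrow> bool" where
  "fcomp n F \<longleftrightarrow> (\<exists>f. \<forall>xs. length xs = n \<longrightarrow> eval f xs (F xs))"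

lemma fcompI: "(\<And>xs. length xs = n \<Longrightarrow> eval f xs (F xs)) \<Longrightarrow> fcomp n F"
  unfolding fcomp_def by blast

lemma fcomp_cong: "fcomp n F \<Longrightarrow> (\<And>xs. length xs = n \<Longrightarrow> F xs = G xs) \<Longrightarrow> fcomp n G"
  unfolding fcomp_def by (metis)

lemma fcomp_nth: "i < n \<Longrightarrow> fcomp n (\<lambda>xs. xs ! i)"
  by (rule fcompI[where f = "Proj i"]) (auto intro: eval.proj)

lemma fcomp_compose:
  assumes "fcomp m G" "length Fs = m" "\<And>F. F \<in> set Fs \<Longrightarrow> fcomp n F"
  shows "fcomp n (\<lambda>xs. G (map (\<lambda>F. F xs) Fs))"
proof -
  obtain g where g: "\<And>xs. length xs = m \<Longrightarrow> eval g xs (G xs)"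
    using assms(1) unfolding fcomp_def by blast
  have "\<forall>F. \<exists>f. F \<in> set Fs \<longrightarrow> (\<forall>xs. length xs = n \<longrightarrow> eval f xs (F xs))"
    using assms(3) unfolding fcomp_def by blast
  then obtain h where h: "\<And>F xs. F \<in> set Fs \<Longrightarrow> length xs = n \<Longrightarrow> eval (h F) xs (F xs)"
    by metis
  show ?thesis
  proof (rule fcompI[where f = "Cn g (map h Fs)"])
    fix xs :: "nat list" assume "length xs = n"
    then have "list_all2 (\<lambda>g y. eval g xs y) (map h Fs) (map (\<lambda>F. F xs) Fs)"
      using h by (auto simp: list_all2_conv_all_nth)
    then show "eval (Cn g (map h Fs)) xs (G (map (\<lambda>F. F xs) Fs))"
      using g assms(2) by (auto intro: eval.cn)
  qed
qed

lemma fcomp_compose1: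
  assumes "fcomp 1 (\<lambda>xs. op (xs ! 0))" "fcomp n F"
  shows "fcomp n (\<lambda>xs. op (F xs))"
  using fcomp_compose[OF assms(1), of "[F]"] assms(2) by simp

lemma fcomp_Suc: "fcomp n F \<Longrightarrow> fcomp n (\<lambda>xs. Suc (F xs))"
proof -
  have "fcomp 1 (\<lambda>xs. Suc (xs ! 0))"
    by (rule fcompI[where f = Sc]) (auto simp: length_Suc_conv intro: eval.suc)
  then show "fcomp n F \<Longrightarrow> ?thesis" by (rule fcomp_compose1)
qed

lemma fcomp_const: "fcomp n (\<lambda>xs. c)"
proof (induction c)
  case 0
  show ?case by (rule fcompI[where f = Z]) (rule eval.zero)
next
  case (Suc c)
  then show ?case by (rule fcomp_Suc)
qed

text \<open>\<open>Pr\<close> passes the counter and the previous value before the parameters, hence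
  \<open>drop 2 ys\<close>. Its recursion argument is the head of the list, so the result is
  composed with \<open>g\<close> followed by all projections, which rebuild
  \<open>xs\<close>.\<close>

lemma fcomp_rec:
  assumes G: "fcomp n G" and H: "fcomp (Suc (Suc n)) (\<lambda>ys. h (ys ! 0) (ys ! 1) (drop 2 ys))" and g: "fcomp n g"
  shows "fcomp n (\<lambda>xs. rec_nat (G xs) (\<lambda>k y. h k y xs) (g xs))"
proof -
  obtain fG where fG: "\<And>xs. length xs = n \<Longrightarrow> eval fG xs (G xs)"
    using G unfolding fcomp_def by blast
  obtain fH where fH: "\<And>k y xs. length xs = n \<Longrightarrow> eval fH (k # y # xs) (h k y xs)"
  proof -
    obtain f where f: "\<And>ys. length ys = Suc (Suc n) \<Longrightarrow> eval f ys (h (ys ! 0) (ys ! 1) (drop 2 ys))"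
      using H unfolding fcomp_def by blast
    show thesis
      by (rule that[of f]) (use f[of "_ # _ # _"] in simp)
  qed
  have *: "eval (Pr fG fH) (k # xs) (rec_nat (G xs) (\<lambda>k y. h k y xs) k)" if "length xs = n" for k xs
    using that by (induction k) (auto intro!: eval.pr0 eval.prS fG fH)
  have "fcomp (Suc n) (\<lambda>ys. rec_nat (G (tl ys)) (\<lambda>k y. h k y (tl ys)) (hd ys))"
    by (rule fcompI[where f = "Pr fG fH"]) (auto simp: length_Suc_conv intro!: *)
  from fcomp_compose[OF this, of "g # map (\<lambda>i xs. xs ! i) [0..<n]" n]
  have "fcomp n (\<lambda>xs. rec_nat (G (map (\<lambda>i. xs ! i) [0..<n])) (\<lambda>k y. h k y (map (\<lambda>i. xs ! i) [0..<n])) (g xs))"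
    using g fcomp_nth by (force simp: o_def)
  then show ?thesis
    by (rule fcomp_cong) (metis map_nth)
qed

lemma fcomp_drop:
  assumes "fcomp n F"
  shows "fcomp (m + n) (\<lambda>ys. F (drop m ys))"
proof -
  have "fcomp (m + n) (\<lambda>ys. F (map (\<lambda>i. ys ! (m + i)) [0..<n]))"
    using fcomp_compose[OF assms, of "map (\<lambda>i ys. ys ! (m + i)) [0..<n]" "m + n"] fcomp_nth
    by (force simp: o_def)
  then show ?thesis
    by (rule fcomp_cong) (auto intro!: arg_cong[where f = F] nth_equalityI)
qed

lemma fcomp_drop2: "fcomp n F \<Longrightarrow> fcomp (Suc (Suc n)) (\<lambda>ys. F (drop 2 ys))"
  using fcomp_drop[of n F 2] by (simp add: numeral_2_eq_2)

lemma fcomp_add: "fcomp n F \<Longrightarrow> fcomp n G \<Longrightarrow> fcomp n (\<lambda>xs. F xs + G xs)"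
proof -
  assume *: "fcomp n F" "fcomp n G"
  have "fcomp n (\<lambda>xs. rec_nat (F xs) (\<lambda>k y. Suc y) (G xs))"
    by (intro fcomp_rec * fcomp_Suc fcomp_nth) auto
  moreover have "rec_nat a (\<lambda>k y. Suc y) b = a + b" for a b by (induction b) auto
  ultimately show ?thesis by simp
qed

lemma fcomp_mult: "fcomp n F \<Longrightarrow> fcomp n G \<Longrightarrow> fcomp n (\<lambda>xs. F xs * G xs)"
proof -
  assume *: "fcomp n F" "fcomp n G"
  have "fcomp n (\<lambda>xs. rec_nat 0 (\<lambda>k y. y + F xs) (G xs))"
    by (intro fcomp_rec * fcomp_const fcomp_add fcomp_nth fcomp_drop2) auto
  moreover have "rec_nat 0 (\<lambda>k y. y + a) b = a * b" for a b :: nat by (induction b) auto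
  ultimately show ?thesis by simp
qed

lemma fcomp_power: "fcomp n F \<Longrightarrow> fcomp n G \<Longrightarrow> fcomp n (\<lambda>xs. F xs ^ G xs)"
proof -
  assume *: "fcomp n F" "fcomp n G"
  have "fcomp n (\<lambda>xs. rec_nat 1 (\<lambda>k y. y * F xs) (G xs))"
    by (intro fcomp_rec * fcomp_const fcomp_mult fcomp_nth fcomp_drop2) auto
  moreover have "rec_nat 1 (\<lambda>k y. y * a) b = a ^ b" for a b :: nat by (induction b) auto
  ultimately show ?thesis by simp
qed

lemma fcomp_diff: "fcomp n F \<Longrightarrow> fcomp n G \<Longrightarrow> fcomp n (\<lambda>xs. F xs - G xs)"
proof -
  have pred: "fcomp n (\<lambda>xs. F xs - 1)" if "fcomp n F" for n F
  proof -
    have "fcomp n (\<lambda>xs. rec_nat 0 (\<lambda>k y. k) (F xs))"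
      by (intro fcomp_rec that fcomp_const fcomp_nth) auto
    moreover have "rec_nat 0 (\<lambda>k y. k) b = b - 1" for b :: nat by (induction b) auto
    ultimately show ?thesis by simp
  qed
  assume *: "fcomp n F" "fcomp n G"
  have "fcomp n (\<lambda>xs. rec_nat (F xs) (\<lambda>k y. y - 1) (G xs))"
    by (intro fcomp_rec * fcomp_const pred fcomp_nth fcomp_drop2) auto
  moreover have "rec_nat a (\<lambda>k y. y - 1) b = a - b" for a b :: nat by (induction b) auto
  ultimately show ?thesis by simp
qed

lemma fcomp_sum:
  assumes F: "fcomp (Suc n) (\<lambda>ys. F (hd ys) (tl ys))" and g: "fcomp n g"
  shows "fcomp n (\<lambda>xs. \<Sum>i<g xs. F i xs)"
proof -
  have "fcomp (Suc (Suc n)) (\<lambda>ys. F (ys ! 0) (drop 2 ys))"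
    using fcomp_compose[OF F, of "(\<lambda>ys. ys ! 0) # map (\<lambda>i ys. ys ! (i + 2)) [0..<n]" "Suc (Suc n)"]
  proof (rule fcomp_cong, goal_cases)
    case (3 xs)
    have "map (\<lambda>i. xs ! (i + 2)) [0..<n] = drop 2 xs"
      using 3 by (intro nth_equalityI) (auto simp: add.commute)
    then show ?case by (simp add: o_def)
  qed (auto intro!: fcomp_nth)
  then have "fcomp n (\<lambda>xs. rec_nat 0 (\<lambda>k y. y + F k xs) (g xs))"
    by (intro fcomp_rec g fcomp_const fcomp_add fcomp_nth) auto
  moreover have "rec_nat 0 (\<lambda>k y. y + F k xs) b = (\<Sum>i<b. F i xs)" for b xs by (induction b) auto
  ultimately show ?thesis by simp
qed

text \<open>If \<open>y = k div 2\<close>, then \<open>k - 2 * y\<close> is the parity of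
  \<open>k\<close>, which is the increment from \<open>k div 2\<close> to
  \<open>Suc k div 2\<close>. The pairing function uses this for triangular numbers.\<close>

lemma fcomp_div2: "fcomp n F \<Longrightarrow> fcomp n (\<lambda>xs. F xs div 2)"
proof -
  assume *: "fcomp n F"
  have "fcomp n (\<lambda>xs. rec_nat 0 (\<lambda>k y. y + (k - 2 * y)) (F xs))"
    by (intro fcomp_rec * fcomp_const fcomp_add fcomp_diff fcomp_mult fcomp_nth) auto
  moreover have "rec_nat 0 (\<lambda>k y. y + (k - 2 * y)) b = b div 2" for b :: nat
  proof (induction b)
    case (Suc b)
    have "b div 2 + (b - 2 * (b div 2)) = Suc b div 2" by presburger
    then show ?case using Suc by simp
  qed simp
  ultimately show ?thesis by simp
qed

lemma fcomp_prod_encode: "fcomp n F \<Longrightarrow> fcomp n G \<Longrightarrow> fcomp n (\<lambda>xs. prod_encode (F xs, G xs))"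
  unfolding prod_encode_def triangle_def
  by (auto intro!: fcomp_add fcomp_div2 fcomp_mult fcomp_Suc)

subsection \<open>Total computable functions of one argument\<close>

definition computable :: "(nat \<Rightarrow> nat) \<Rightarrow> bool" where
  "computable F \<longleftrightarrow> (\<exists>f. \<forall>x. eval f [x] (F x))"

definition pfst :: "nat \<Rightarrow> nat" where "pfst p = fst (prod_decode p)"
definition psnd :: "nat \<Rightarrow> nat" where "psnd p = snd (prod_decode p)"

lemma pfst_encode [simp]: "pfst (prod_encode (a, b)) = a"
  and psnd_encode [simp]: "psnd (prod_encode (a, b)) = b"
  by (simp_all add: pfst_def psnd_def)

lemma prod_encode_pfst_psnd [simp]: "prod_encode (pfst p, psnd p) = p"
  by (simp add: pfst_def psnd_def)

lemma computable_iff_fcomp: "computable F \<longleftrightarrow> fcomp 1 (\<lambda>xs. F (xs ! 0))"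
proof
  assume "computable F"
  then show "fcomp 1 (\<lambda>xs. F (xs ! 0))"
    unfolding computable_def fcomp_def by (metis One_nat_def length_0_conv length_Suc_conv nth_Cons_0)
next
  assume "fcomp 1 (\<lambda>xs. F (xs ! 0))"
  then obtain f where f: "\<And>xs. length xs = 1 \<Longrightarrow> eval f xs (F (xs ! 0))"
    unfolding fcomp_def by blast
  show "computable F"
    unfolding computable_def using f[of "[_]"] by auto
qed

lemma computable_compose: "computable F \<Longrightarrow> computable G \<Longrightarrow> computable (\<lambda>x. F (G x))"
  unfolding computable_iff_fcomp by (rule fcomp_compose1)

lemma computable_id: "computable (\<lambda>x. x)"
  unfolding computable_iff_fcomp by (rule fcomp_nth) auto

lemma computable_const: "computable (\<lambda>x. c)"
  unfolding computable_iff_fcomp by (rule fcomp_const)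

lemma computable_Suc: "computable F \<Longrightarrow> computable (\<lambda>x. Suc (F x))"
  unfolding computable_iff_fcomp by (rule fcomp_Suc)

lemma computable_add: "computable F \<Longrightarrow> computable G \<Longrightarrow> computable (\<lambda>x. F x + G x)"
  unfolding computable_iff_fcomp by (rule fcomp_add)

lemma computable_mult: "computable F \<Longrightarrow> computable G \<Longrightarrow> computable (\<lambda>x. F x * G x)"
  unfolding computable_iff_fcomp by (rule fcomp_mult)

lemma computable_diff: "computable F \<Longrightarrow> computable G \<Longrightarrow> computable (\<lambda>x. F x - G x)"
  unfolding computable_iff_fcomp by (rule fcomp_diff)

lemma computable_power: "computable F \<Longrightarrow> computable G \<Longrightarrow> computable (\<lambda>x. F x ^ G x)"
  unfolding computable_iff_fcomp by (rule fcomp_power)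

lemma computable_prod_encode:
  "computable F \<Longrightarrow> computable G \<Longrightarrow> computable (\<lambda>x. prod_encode (F x, G x))"
  unfolding computable_iff_fcomp by (rule fcomp_prod_encode)

definition decidable :: "(nat \<Rightarrow> bool) \<Rightarrow> bool" where
  "decidable P \<longleftrightarrow> computable (\<lambda>x. if P x then 1 else 0)"

lemma computable_if:
  assumes "decidable P" "computable F" "computable G"
  shows "computable (\<lambda>x. if P x then F x else G x)"
proof -
  let ?p = "\<lambda>x. if P x then 1 else (0::nat)"
  have "computable (\<lambda>x. ?p x * F x + (1 - ?p x) * G x)"
    using assms unfolding decidable_def
    by (intro computable_add computable_mult computable_diff computable_const)
  moreover have "?p x * F x + (1 - ?p x) * G x = (if P x then F x else G x)" for x by simp
  ultimately show ?thesis by simp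
qed

lemma decidable_le: "computable F \<Longrightarrow> computable G \<Longrightarrow> decidable (\<lambda>x. F x \<le> G x)"
proof -
  assume *: "computable F" "computable G"
  have "computable (\<lambda>x. 1 - (F x - G x))" by (intro computable_diff computable_const *)
  moreover have "(1 - (F x - G x)) = (if F x \<le> G x then 1 else 0)" for x by simp
  ultimately show ?thesis unfolding decidable_def by simp
qed

lemma decidable_not: "decidable P \<Longrightarrow> decidable (\<lambda>x. \<not> P x)"
proof -
  assume "decidable P"
  then have "computable (\<lambda>x. if P x then 0 else 1)"
    by (intro computable_if computable_const)
  moreover have "(if P x then 0 else 1) = (if \<not> P x then 1 else (0::nat))" for x by simp
  ultimately show ?thesis unfolding decidable_def by simp
qed

lemma decidable_const: "decidable (\<lambda>x. P)"
  unfolding decidable_def by (rule computable_const)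

lemma decidable_conj: "decidable P \<Longrightarrow> decidable Q \<Longrightarrow> decidable (\<lambda>x. P x \<and> Q x)"
proof -
  assume "decidable P" "decidable Q"
  then have "computable (\<lambda>x. if P x then (if Q x then 1 else 0) else 0)"
    using computable_if[of P "\<lambda>x. if Q x then 1 else 0" "\<lambda>x. 0"] computable_const
    unfolding decidable_def by auto
  moreover have "(if P x then (if Q x then 1 else 0) else 0) = (if P x \<and> Q x then 1 else (0::nat))" for x by simp
  ultimately show ?thesis unfolding decidable_def by simp
qed

lemma decidable_disj: "decidable P \<Longrightarrow> decidable Q \<Longrightarrow> decidable (\<lambda>x. P x \<or> Q x)"
  using decidable_not[OF decidable_conj[OF decidable_not decidable_not], of P Q] by simp

lemma decidable_imp: "decidable P \<Longrightarrow> decidable Q \<Longrightarrow> decidable (\<lambda>x. P x \<longrightarrow> Q x)"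
  unfolding imp_conv_disj by (intro decidable_disj decidable_not)

lemma decidable_less: "computable F \<Longrightarrow> computable G \<Longrightarrow> decidable (\<lambda>x. F x < G x)"
  using decidable_not[OF decidable_le, of G F] by (simp add: not_le)

lemma decidable_eq: "computable F \<Longrightarrow> computable G \<Longrightarrow> decidable (\<lambda>x. F x = G x)"
  using decidable_conj[OF decidable_le decidable_le, of F G G F] by (simp add: eq_iff)

lemma decidable_compose: "decidable P \<Longrightarrow> computable G \<Longrightarrow> decidable (\<lambda>x. P (G x))"
  unfolding decidable_def by (rule computable_compose)

text \<open>Both components of a pair are at most its code \<open>p\<close>, so they are extracted
  by a double sum over \<open>a, b \<le> p\<close>, in which the truncated expression
  \<open>1 - ((e - p) + (p - e))\<close> is the indicator of \<open>e = p\<close>.\<close>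

lemma computable_pfst: "computable F \<Longrightarrow> computable (\<lambda>x. pfst (F x))"
  and computable_psnd: "computable F \<Longrightarrow> computable (\<lambda>x. psnd (F x))"
proof -
  have fin: "(\<Sum>a<Suc p. \<Sum>b<Suc p. H a b * (1 - ((prod_encode (a, b) - p) + (p - prod_encode (a, b))))) = H (pfst p) (psnd p)"
    (is "?L = _") for p and H :: "nat \<Rightarrow> nat \<Rightarrow> nat"
  proof -
    have "H a b * (1 - ((prod_encode (a, b) - p) + (p - prod_encode (a, b)))) = (if a = pfst p then if b = psnd p then H a b else 0 else 0)" for a b
      by (cases "prod_encode (a, b) = p") (auto simp: pfst_def psnd_def)
    then have "?L = (\<Sum>a<Suc p. \<Sum>b<Suc p. if a = pfst p then if b = psnd p then H a b else 0 else 0)"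
      by simp
    also have "\<dots> = (\<Sum>a<Suc p. if a = pfst p then H a (psnd p) else 0)"
      using le_prod_encode_2[of "psnd p" "pfst p"] by (intro sum.cong) (auto simp: sum.delta less_Suc_eq_le simp del: sum.lessThan_Suc)
    also have "\<dots> = H (pfst p) (psnd p)"
      using le_prod_encode_1[of "pfst p" "psnd p"] by (auto simp: sum.delta less_Suc_eq_le simp del: sum.lessThan_Suc)
    finally show ?thesis .
  qed
  have hd: "fcomp (Suc n) hd" for n
    by (rule fcomp_cong[OF fcomp_nth[of 0 "Suc n"]]) (auto simp: length_Suc_conv)
  have tl: "fcomp (Suc n) (\<lambda>ys. F (tl ys))" if "fcomp n F" for n F
    using fcomp_drop[OF that, of 1] by (simp add: drop_Suc)
  have hd1: "fcomp 1 hd" using hd[of 0] by simp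
  have x: "fcomp 1 (\<lambda>xs. xs ! 0)" by (rule fcomp_nth) simp
  have *: "fcomp 1 (\<lambda>xs. H (pfst (xs ! 0)) (psnd (xs ! 0)))"
    if H: "fcomp (Suc (Suc 1)) (\<lambda>ys. H (hd (tl ys)) (hd ys))" for H :: "nat \<Rightarrow> nat \<Rightarrow> nat"
  proof -
    have e: "fcomp (Suc (Suc 1)) (\<lambda>ys. prod_encode (hd (tl ys), hd ys))"
      by (intro fcomp_prod_encode tl[OF hd] hd)
    have y: "fcomp (Suc (Suc 1)) (\<lambda>ys. tl (tl ys) ! 0)"
      by (intro tl x)
    have "fcomp (Suc (Suc 1)) (\<lambda>ys. H (hd (tl ys)) (hd ys) *
      (1 - ((prod_encode (hd (tl ys), hd ys) - tl (tl ys) ! 0) + (tl (tl ys) ! 0 - prod_encode (hd (tl ys), hd ys)))))"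
      by (intro fcomp_mult fcomp_diff fcomp_add fcomp_const e y H)
    from fcomp_sum[OF this tl[OF fcomp_Suc[OF x]]]
    have "fcomp (Suc 1) (\<lambda>ys. \<Sum>b<Suc (tl ys ! 0). H (hd ys) b *
      (1 - ((prod_encode (hd ys, b) - tl ys ! 0) + (tl ys ! 0 - prod_encode (hd ys, b)))))" .
    from fcomp_sum[OF this fcomp_Suc[OF x]] show ?thesis
      unfolding fin .
  qed
  have "computable pfst"
    unfolding computable_iff_fcomp by (rule *[of "\<lambda>a b. a"]) (rule tl[OF hd])
  moreover have "computable psnd"
    unfolding computable_iff_fcomp by (rule *[of "\<lambda>a b. b"]) (rule hd)
  ultimately show "computable F \<Longrightarrow> computable (\<lambda>x. pfst (F x))" "computable F \<Longrightarrow> computable (\<lambda>x. psnd (F x))"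
    by (auto intro: computable_compose)
qed

lemma computable_rec:
  assumes "computable G" "computable (\<lambda>p. h (pfst p) (pfst (psnd p)) (psnd (psnd p)))" "computable g"
  shows "computable (\<lambda>x. rec_nat (G x) (h x) (g x))"
proof -
  let ?H = "\<lambda>p. h (pfst p) (pfst (psnd p)) (psnd (psnd p))"
  have "fcomp 3 (\<lambda>ys. ?H (prod_encode (ys ! 2, prod_encode (ys ! 0, ys ! 1))))"
    using assms(2)[unfolded computable_iff_fcomp]
    by (rule fcomp_compose1) (auto intro!: fcomp_prod_encode fcomp_nth)
  then have "fcomp (Suc (Suc 1)) (\<lambda>ys. h (drop 2 ys ! 0) (ys ! 0) (ys ! 1))"
    unfolding numeral_3_eq_3 One_nat_def by (rule fcomp_cong) simp
  then have "fcomp 1 (\<lambda>xs. rec_nat (G (xs ! 0)) (\<lambda>k y. h (xs ! 0) k y) (g (xs ! 0)))"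
    using assms(1,3) unfolding computable_iff_fcomp by (intro fcomp_rec) auto
  then show ?thesis
    unfolding computable_iff_fcomp by simp
qed

lemma computable_sum:
  assumes "computable (\<lambda>p. F (pfst p) (psnd p))" "computable g"
  shows "computable (\<lambda>x. \<Sum>i<g x. F x i)"
proof -
  have "computable (\<lambda>p. (\<lambda>q. F (pfst q) (psnd q)) (prod_encode (pfst p, pfst (psnd p))) + psnd (psnd p))"
    by (intro computable_add computable_compose[OF assms(1)] computable_prod_encode computable_pfst computable_psnd computable_id)
  then have "computable (\<lambda>x. rec_nat 0 (\<lambda>k y. F x k + y) (g x))"
    by (intro computable_rec computable_const assms(2)) simp
  moreover have "rec_nat 0 (\<lambda>k y. F x k + y) b = (\<Sum>i<b. F x i)" for b x by (induction b) auto
  ultimately show ?thesis by simp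
qed

lemma decidable_Ex_less:
  assumes "decidable (\<lambda>p. P (pfst p) (psnd p))" "computable g"
  shows "decidable (\<lambda>x. \<exists>i<g x. P x i)"
proof -
  have "decidable (\<lambda>x. 0 < (\<Sum>i<g x. if P x i then 1 else (0::nat)))"
    by (intro decidable_less computable_const computable_sum assms(2) computable_if[OF assms(1)])
  moreover have "0 < (\<Sum>i<n. if P x i then 1 else (0::nat)) \<longleftrightarrow> (\<exists>i<n. P x i)" for x n
    by (simp only: neq0_conv[symmetric]) auto
  ultimately show ?thesis by simp
qed

lemma decidable_All_less:
  assumes "decidable (\<lambda>p. P (pfst p) (psnd p))" "computable g"
  shows "decidable (\<lambda>x. \<forall>i<g x. P x i)"
  using decidable_not[OF decidable_Ex_less[OF decidable_not[OF assms(1)] assms(2)]] by simp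

lemma computable_div:
  assumes "computable F" "computable G"
  shows "computable (\<lambda>x. F x div G x)"
proof -
  have *: "a div b = (if b = 0 then 0 else \<Sum>i<a. if Suc i * b \<le> a then 1 else 0)" for a b :: nat
  proof (cases "b = 0")
    case False
    have "(\<Sum>i<a. if Suc i * b \<le> a then 1 else 0) = card {i \<in> {..<a}. Suc i * b \<le> a}"
      by (simp add: sum.If_cases Int_def)
    also have "{i \<in> {..<a}. Suc i * b \<le> a} = {..<a div b}"
    proof -
      have "Suc i * b \<le> a \<longleftrightarrow> i < a div b" for i
        using False by (metis Suc_le_eq less_eq_div_iff_mult_less_eq neq0_conv)
      moreover have "a div b \<le> a" by simp
      ultimately show ?thesis by (auto intro: less_le_trans)
    qed
    finally show ?thesis using False by simp
  qed auto
  show ?thesis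
    by (subst *) (intro computable_if decidable_eq computable_sum computable_const computable_mult computable_Suc
        decidable_le assms computable_psnd computable_pfst computable_id computable_compose[OF assms(1)] computable_compose[OF assms(2)])
qed

lemma decidable_odd: "computable F \<Longrightarrow> decidable (\<lambda>x. odd (F x))"
proof -
  assume F: "computable F"
  have *: "(\<lambda>x. odd (F x)) = (\<lambda>x. F x \<noteq> 2 * (F x div 2))"
    by (rule ext) presburger
  show ?thesis
    unfolding * by (intro decidable_not decidable_eq computable_mult computable_const computable_div F)
qed

lemma decidable_even: "computable F \<Longrightarrow> decidable (\<lambda>x. even (F x))"
  using decidable_not[OF decidable_odd, of F] by simp

text \<open>The sum counts the numbers below the first witness: \<open>i\<close> contributes iff no
  \<open>j \<le> i\<close> satisfies \<open>P\<close>.\<close>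

lemma computable_Least_less:
  assumes "decidable (\<lambda>p. P (pfst p) (psnd p))" "computable g" "\<And>x. \<exists>i<g x. P x i"
  shows "computable (\<lambda>x. LEAST i. P x i)"
proof -
  have "computable (\<lambda>x. \<Sum>i<g x. if \<forall>j<Suc i. \<not> P x j then 1 else 0)"
  proof (intro computable_sum computable_if computable_const decidable_All_less decidable_not assms(2))
    have "decidable (\<lambda>p. (\<lambda>p. P (pfst p) (psnd p)) (prod_encode (pfst (pfst p), psnd p)))"
      by (intro decidable_compose[OF assms(1)] computable_prod_encode computable_pfst computable_psnd computable_id)
    then show "decidable (\<lambda>p. P (pfst (pfst p)) (psnd p))" by simp
  qed (intro computable_Suc computable_psnd computable_id)
  moreover have "(\<Sum>i<g x. if \<forall>j<Suc i. \<not> P x j then 1 else 0) = (LEAST i. P x i)" for x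
  proof -
    have "(\<Sum>i<g x. if \<forall>j<Suc i. \<not> P x j then 1 else 0) = card {i \<in> {..<g x}. \<forall>j<Suc i. \<not> P x j}"
      by (simp add: sum.If_cases Int_def)
    also have "{i \<in> {..<g x}. \<forall>j<Suc i. \<not> P x j} = {..<LEAST i. P x i}"
    proof -
      obtain i where i: "i < g x" "P x i" using assms(3) by blast
      then have l: "(LEAST i. P x i) < g x" "P x (LEAST i. P x i)"
        by (auto intro: le_less_trans[OF Least_le] LeastI)
      have "(\<forall>j<Suc k. \<not> P x j) \<longleftrightarrow> k < (LEAST i. P x i)" for k
        using l(2) not_less_Least[of _ "P x"] by (metis less_Suc_eq_le not_le order.strict_trans1)
      then show ?thesis using l(1) by auto
    qed
    finally show ?thesis by simp
  qed
  ultimately show ?thesis by simp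
qed

lemmas computable_intros = computable_const computable_id computable_Suc computable_add computable_mult
  computable_diff computable_power computable_div computable_prod_encode computable_pfst computable_psnd
  computable_if computable_sum
  decidable_const decidable_not decidable_conj decidable_disj decidable_imp decidable_le decidable_less
  decidable_eq decidable_odd decidable_Ex_less decidable_All_less

subsection \<open>A step-bounded evaluator\<close>

text \<open>Only the search in \<open>Mn\<close> is limited by \<open>t\<close>; the other
  constructors recurse structurally on the code, so evaluation terminates for every
  \<open>t\<close>.\<close>

fun appr :: "recf \<Rightarrow> nat \<Rightarrow> nat list \<Rightarrow> nat option" where
  "appr Z t xs = Some 0"
| "appr Sc t xs = (case xs of [] \<Rightarrow> None | x # _ \<Rightarrow> Some (Suc x))"
| "appr (Proj i) t xs = (if i < length xs then Some (xs ! i) else None)"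
| "appr (Cn f gs) t xs = (case those (map (\<lambda>g. appr g t xs) gs) of None \<Rightarrow> None | Some ys \<Rightarrow> appr f t ys)"
| "appr (Pr g h) t xs = (case xs of [] \<Rightarrow> None | n # zs \<Rightarrow>
     rec_nat (appr g t zs) (\<lambda>k r. case r of None \<Rightarrow> None | Some y \<Rightarrow> appr h t (k # y # zs)) n)"
| "appr (Mn f) t xs =
     (if \<exists>n<t. appr f t (n # xs) = Some 0 \<and> (\<forall>m<n. \<exists>y. appr f t (m # xs) = Some (Suc y))
      then Some (LEAST n. appr f t (n # xs) = Some 0) else None)"

lemma those_eq_Some_iff: "those xs = Some ys \<longleftrightarrow> xs = map Some ys"
proof (induction xs arbitrary: ys)
  case (Cons x xs)
  then show ?case by (cases ys) (auto split: option.splits)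
qed auto

lemma appr_Mn_eq_Some_iff:
  "appr (Mn f) t xs = Some n \<longleftrightarrow>
     n < t \<and> appr f t (n # xs) = Some 0 \<and> (\<forall>m<n. \<exists>y. appr f t (m # xs) = Some (Suc y))"
proof -
  have *: "(LEAST n. appr f t (n # xs) = Some 0) = n"
    if "appr f t (n # xs) = Some 0" "\<forall>m<n. \<exists>y. appr f t (m # xs) = Some (Suc y)" for n
    using that by (intro Least_equality) (auto simp: not_less[symmetric])
  show ?thesis using * by (auto simp: *)
qed

lemma appr_mono: "appr f t xs = Some y \<Longrightarrow> t \<le> t' \<Longrightarrow> appr f t' xs = Some y"
proof (induction f t xs arbitrary: y rule: appr.induct)
  case (4 f gs t xs)
  then obtain ys where ys: "map (\<lambda>g. appr g t xs) gs = map Some ys" "appr f t ys = Some y"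
    by (auto split: option.splits simp: those_eq_Some_iff)
  have "map (\<lambda>g. appr g t' xs) gs = map Some ys"
  proof (rule nth_equalityI)
    show l: "length (map (\<lambda>g. appr g t' xs) gs) = length (map Some ys)"
      using ys(1) by (metis length_map)
    fix i assume i: "i < length (map (\<lambda>g. appr g t' xs) gs)"
    then have "appr (gs ! i) t xs = Some (ys ! i)"
      using ys(1) l by (metis length_map nth_map)
    then show "map (\<lambda>g. appr g t' xs) gs ! i = map Some ys ! i"
      using 4(1)[of "gs ! i"] i l 4(4) by auto
  qed
  moreover have "appr f t' ys = Some y"
    using 4(2)[of ys] ys 4(4) by (simp add: those_eq_Some_iff)
  ultimately show ?case by (simp add: those_eq_Some_iff[THEN iffD2])
next
  case (5 g h t xs)
  show ?case
  proof (cases xs)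
    case (Cons n zs)
    have "rec_nat (appr g t' zs) (\<lambda>k r. case r of None \<Rightarrow> None | Some y \<Rightarrow> appr h t' (k # y # zs)) m = Some z"
      if "rec_nat (appr g t zs) (\<lambda>k r. case r of None \<Rightarrow> None | Some y \<Rightarrow> appr h t (k # y # zs)) m = Some z" for m z
      using that
    proof (induction m arbitrary: z)
      case 0
      then show ?case using 5(1)[OF Cons] 5(4) by simp
    next
      case (Suc m)
      then obtain y where "rec_nat (appr g t zs) (\<lambda>k r. case r of None \<Rightarrow> None | Some y \<Rightarrow> appr h t (k # y # zs)) m = Some y"
        "appr h t (m # y # zs) = Some z"
        by (auto split: option.splits)
      then show ?case
        using Suc.IH 5(2)[OF Cons _ ] 5(4) by simp
    qed
    then show ?thesis using 5(3) Cons by simp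
  qed (use 5 in simp)
next
  case (6 f t xs)
  have *: "appr f t (n # xs) = Some z \<Longrightarrow> appr f t' (n # xs) = Some z" for n z
    using 6 by blast
  show ?case
    using 6(4,5) unfolding appr_Mn_eq_Some_iff by (metis * order.strict_trans2)
qed (auto split: list.splits if_splits)

lemma appr_sound: "appr f t xs = Some y \<Longrightarrow> eval f xs y"
proof (induction f t xs arbitrary: y rule: appr.induct)
  case (1 t xs)
  then show ?case by (auto intro: eval.zero)
next
  case (2 t xs)
  then show ?case by (auto intro: eval.suc split: list.splits)
next
  case (3 i t xs)
  then show ?case by (auto intro: eval.proj split: if_splits)
next
  case (4 f gs t xs)
  then obtain ys where ys: "map (\<lambda>g. appr g t xs) gs = map Some ys" "appr f t ys = Some y"
    by (auto split: option.splits simp: those_eq_Some_iff)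
  have l: "length gs = length ys" using ys(1) by (metis length_map)
  moreover have "eval (gs ! i) xs (ys ! i)" if "i < length gs" for i
  proof (rule 4(1))
    show "gs ! i \<in> set gs" using that by simp
    show "appr (gs ! i) t xs = Some (ys ! i)" using that ys(1) l by (metis nth_map)
  qed
  ultimately have "list_all2 (\<lambda>g y. eval g xs y) gs ys"
    by (simp add: list_all2_conv_all_nth)
  moreover have "eval f ys y" using 4(2)[of ys] ys by (simp add: those_eq_Some_iff)
  ultimately show ?case by (rule eval.cn)
next
  case (5 g h t xs)
  show ?case
  proof (cases xs)
    case (Cons n zs)
    have "eval (Pr g h) (m # zs) z"
      if "rec_nat (appr g t zs) (\<lambda>k r. case r of None \<Rightarrow> None | Some y \<Rightarrow> appr h t (k # y # zs)) m = Some z" for m z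
      using that
    proof (induction m arbitrary: z)
      case 0
      then show ?case using 5(1)[OF Cons] by (auto intro: eval.pr0)
    next
      case (Suc m)
      then obtain y where "rec_nat (appr g t zs) (\<lambda>k r. case r of None \<Rightarrow> None | Some y \<Rightarrow> appr h t (k # y # zs)) m = Some y"
        "appr h t (m # y # zs) = Some z"
        by (auto split: option.splits)
      then show ?case
        using Suc.IH 5(2)[OF Cons _ ] by (auto intro: eval.prS)
    qed
    then show ?thesis using 5(3) Cons by simp
  qed (use 5 in simp)
next
  case (6 f t xs)
  have *: "appr f t (n # xs) = Some z \<Longrightarrow> eval f (n # xs) z" for n z
    using 6 by blast
  show ?case
    using 6(4) unfolding appr_Mn_eq_Some_iff by (auto intro!: eval.mn * dest!: *) 
qed

lemma appr_complete: "eval f xs y \<Longrightarrow> \<exists>t. appr f t xs = Some y"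
proof (induction rule: eval.induct)
  case (cn xs gs ys f z)
  then obtain t where t: "appr f t ys = Some z" by blast
  have "\<forall>i<length gs. \<exists>t. appr (gs ! i) t xs = Some (ys ! i)"
    using cn(1) by (auto simp: list_all2_conv_all_nth)
  then obtain T where T: "\<And>i. i < length gs \<Longrightarrow> appr (gs ! i) (T i) xs = Some (ys ! i)"
    by metis
  define t' where "t' = t + (\<Sum>i<length gs. T i)"
  have "appr (gs ! i) t' xs = Some (ys ! i)" if "i < length gs" for i
  proof (rule appr_mono[OF T[OF that]])
    have "T i \<le> (\<Sum>i<length gs. T i)" using that by (intro member_le_sum) auto
    then show "T i \<le> t'" by (simp add: t'_def)
  qed
  then have "map (\<lambda>g. appr g t' xs) gs = map Some ys"
    using cn(1) by (intro nth_equalityI) (auto simp: list_all2_conv_all_nth)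
  moreover have "appr f t' ys = Some z" by (rule appr_mono[OF t]) (simp add: t'_def)
  ultimately show ?case by (intro exI[of _ t']) (simp add: those_eq_Some_iff[THEN iffD2])
next
  case (prS g h n xs y z)
  then obtain t1 t2 where t: "appr (Pr g h) t1 (n # xs) = Some y" "appr h t2 (n # y # xs) = Some z"
    by blast
  have "appr (Pr g h) (t1 + t2) (n # xs) = Some y" "appr h (t1 + t2) (n # y # xs) = Some z"
    by (rule appr_mono[OF t(1)] appr_mono[OF t(2)]; simp)+
  then show ?case by (intro exI[of _ "t1 + t2"]) auto
next
  case (mn f n xs)
  then obtain t where t: "appr f t (n # xs) = Some 0" by blast
  have "\<forall>m<n. \<exists>t y. appr f t (m # xs) = Some (Suc y)" using mn by blast
  then obtain T where T: "\<And>m. m < n \<Longrightarrow> \<exists>y. appr f (T m) (m # xs) = Some (Suc y)"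
    by metis
  define t' where "t' = t + (\<Sum>i<n. T i) + Suc n"
  have "\<exists>y. appr f t' (m # xs) = Some (Suc y)" if "m < n" for m
  proof -
    have "T m \<le> (\<Sum>i<n. T i)" using that by (intro member_le_sum) auto
    then have "T m \<le> t'" by (simp add: t'_def)
    then show ?thesis using T[OF that] appr_mono by blast
  qed
  moreover have "appr f t' (n # xs) = Some 0" by (rule appr_mono[OF t]) (simp add: t'_def)
  ultimately show ?case
    by (intro exI[of _ t']) (simp add: appr_Mn_eq_Some_iff del: appr.simps, simp add: t'_def)
next
  case (pr0 g xs y h)
  then show ?case by auto
qed auto

lemma eval_iff_appr: "eval f xs y \<longleftrightarrow> (\<exists>t. appr f t xs = Some y)"
  using appr_sound appr_complete by blast

lemma eval_deterministic: "eval f xs y \<Longrightarrow> eval f xs z \<Longrightarrow> y = z"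
proof -
  assume "eval f xs y" "eval f xs z"
  then obtain t t' where t: "appr f t xs = Some y" "appr f t' xs = Some z"
    by (auto simp: eval_iff_appr)
  have "appr f (max t t') xs = Some y" "appr f (max t t') xs = Some z"
    by (rule appr_mono[OF t(1)] appr_mono[OF t(2)]; simp)+
  then show "y = z" by simp
qed

fun opt_code :: "nat option \<Rightarrow> nat" where
  "opt_code None = 0"
| "opt_code (Some y) = Suc y"

lemma opt_code_eq_0_iff [simp]: "opt_code r = 0 \<longleftrightarrow> r = None"
  and opt_code_eq_Suc_iff [simp]: "opt_code r = Suc y \<longleftrightarrow> r = Some y"
  by (cases r; auto)+

lemma list_decode_Suc': "list_decode (Suc n) = pfst n # list_decode (psnd n)"
  by (simp add: pfst_def psnd_def case_prod_beta)

lemma list_decode_eq: "list_decode c = (if c = 0 then [] else pfst (c - 1) # list_decode (psnd (c - 1)))"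
  by (cases c) (simp_all add: list_decode_Suc' del: list_decode.simps(2))

lemma list_decode_Suc_prod_encode:
  "list_decode (Suc (prod_encode (x, c))) = x # list_decode c"
  by (simp add: list_decode_Suc' del: list_decode.simps(2))

lemma computable_nth_opt:
  "computable F \<Longrightarrow> computable (\<lambda>x. opt_code (let xs = list_decode (F x) in if i < length xs then Some (xs ! i) else None))"
proof (induction i arbitrary: F)
  case 0
  have "computable (\<lambda>x. if F x = 0 then 0 else Suc (pfst (F x - 1)))"
    by (intro computable_intros 0)
  moreover have "(if F x = 0 then 0 else Suc (pfst (F x - 1))) =
    opt_code (let xs = list_decode (F x) in if 0 < length xs then Some (xs ! 0) else None)" for x
    by (subst list_decode_eq) simp
  ultimately show ?case by simp
next
  case (Suc i)
  have "computable (\<lambda>x. if F x = 0 then 0 else opt_code (let xs = list_decode (psnd (F x - 1)) in if i < length xs then Some (xs ! i) else None))"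
    by (intro computable_intros Suc)
  moreover have "(if F x = 0 then 0 else opt_code (let xs = list_decode (psnd (F x - 1)) in if i < length xs then Some (xs ! i) else None)) =
    opt_code (let xs = list_decode (F x) in if Suc i < length xs then Some (xs ! Suc i) else None)" for x
    by (subst (2) list_decode_eq) simp
  ultimately show ?case by simp
qed

lemma computable_those:
  assumes "\<And>g. g \<in> set gs \<Longrightarrow> computable (\<lambda>x. opt_code (A g x))"
  shows "computable (\<lambda>x. opt_code (map_option list_encode (those (map (\<lambda>g. A g x) gs))))"
  using assms
proof (induction gs)
  case Nil
  then show ?case by (simp add: computable_const)
next
  case (Cons g gs)
  let ?a = "\<lambda>x. opt_code (A g x)"
  let ?b = "\<lambda>x. opt_code (map_option list_encode (those (map (\<lambda>g. A g x) gs)))"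
  have "computable (\<lambda>x. if ?a x = 0 then 0 else if ?b x = 0 then 0 else Suc (Suc (prod_encode (?a x - 1, ?b x - 1))))"
    by (intro computable_intros Cons) (auto intro: Cons)
  moreover have "(if ?a x = 0 then 0 else if ?b x = 0 then 0 else Suc (Suc (prod_encode (?a x - 1, ?b x - 1)))) =
    opt_code (map_option list_encode (those (map (\<lambda>g. A g x) (g # gs))))" for x
    by (auto split: option.splits)
  ultimately show ?case by simp
qed

text \<open>Induction on \<open>f\<close>, which stays outside the computation: only argument lists
  and results are coded, and every fixed \<open>f\<close> gets its own computable stage
  function.\<close>

lemma computable_appr2:
  "computable T \<Longrightarrow> computable F \<Longrightarrow> computable (\<lambda>x. opt_code (appr f (T x) (list_decode (F x))))"
proof (induction f arbitrary: T F)
  case Z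
  then show ?case by (simp add: computable_const)
next
  case Sc
  have "computable (\<lambda>x. if F x = 0 then 0 else Suc (Suc (pfst (F x - 1))))"
    by (intro computable_intros Sc)
  moreover have "(if F x = 0 then 0 else Suc (Suc (pfst (F x - 1)))) = opt_code (appr Sc (T x) (list_decode (F x)))" for x
    by (subst list_decode_eq) simp
  ultimately show ?case by simp
next
  case (Proj i)
  then show ?case using computable_nth_opt[of F i] by (simp add: Let_def)
next
  case (Cn f gs)
  let ?b = "\<lambda>x. opt_code (map_option list_encode (those (map (\<lambda>g. appr g (T x) (list_decode (F x))) gs)))"
  have b: "computable ?b"
    using Cn by (intro computable_those) auto
  have "computable (\<lambda>x. if ?b x = 0 then 0 else opt_code (appr f (T x) (list_decode (?b x - 1))))"
    by (intro computable_intros b Cn)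
  moreover have "(if ?b x = 0 then 0 else opt_code (appr f (T x) (list_decode (?b x - 1)))) =
      opt_code (appr (Cn f gs) (T x) (list_decode (F x)))" for x
    by (auto split: option.splits)
  ultimately show ?case by (simp del: appr.simps)
next
  case (Pr g h)
  let ?h = "\<lambda>x k r. if r = 0 then 0 else opt_code (appr h (T x) (list_decode (Suc (prod_encode (k, Suc (prod_encode (r - 1, psnd (F x - 1))))))))"
  have "computable (\<lambda>x. if F x = 0 then 0 else rec_nat (opt_code (appr g (T x) (list_decode (psnd (F x - 1))))) (?h x) (pfst (F x - 1)))"
    by (intro computable_intros computable_rec Pr computable_compose[OF Pr(3)] computable_compose[OF Pr(4)])
  moreover have "(if F x = 0 then 0 else rec_nat (opt_code (appr g (T x) (list_decode (psnd (F x - 1))))) (?h x) (pfst (F x - 1))) =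
    opt_code (appr (Pr g h) (T x) (list_decode (F x)))" for x
  proof (cases "F x = 0")
    case False
    let ?zs = "list_decode (psnd (F x - 1))"
    have "rec_nat (opt_code (appr g (T x) ?zs)) (?h x) m =
      opt_code (rec_nat (appr g (T x) ?zs) (\<lambda>k r. case r of None \<Rightarrow> None | Some y \<Rightarrow> appr h (T x) (k # y # ?zs)) m)" for m
      by (induction m) (auto simp: list_decode_Suc_prod_encode simp del: list_decode.simps split: option.splits)
    moreover have "list_decode (F x) = pfst (F x - 1) # ?zs"
      using False by (subst list_decode_eq) simp
    ultimately show ?thesis
      using False by (simp only: appr.simps list.case if_False)
  qed (simp add: list_decode_eq[of 0])
  ultimately show ?case by (simp del: appr.simps)
next
  case (Mn f)
  let ?a = "\<lambda>x n. opt_code (appr f (T x) (list_decode (Suc (prod_encode (n, F x)))))"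
  let ?P = "\<lambda>x. \<exists>n<T x. ?a x n = 1 \<and> (\<forall>m<n. 1 < ?a x m)"
  have a: "computable (\<lambda>x. ?a (G x) (H x))" if "computable G" "computable H" for G H
    by (intro computable_intros Mn that computable_compose[OF Mn(2)] computable_compose[OF Mn(3)])
  have P: "decidable ?P"
    by (intro computable_intros a Mn(2))
  \<comment> \<open>The default \<open>n = 0\<close> outside \<open>?P\<close> provides a witness
    below \<open>Suc (T x)\<close> in every case, as \<open>computable_Least_less\<close> demands;
    the case distinction that follows discards it.\<close>
  have "computable (\<lambda>x. LEAST n. if ?P x then ?a x n = 1 else n = 0)"
  proof (rule computable_Least_less)
    have "decidable (\<lambda>p. if ?P (pfst p) then ?a (pfst p) (psnd p) = 1 else psnd p = 0)"
      by (simp only: if_bool_eq_conj) (intro computable_intros a decidable_compose[OF P])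
    then show "decidable (\<lambda>p. if ?P (pfst p) then ?a (pfst p) (psnd p) = 1 else psnd p = 0)" .
    show "computable (\<lambda>x. Suc (T x))" by (intro computable_intros Mn)
    show "\<exists>i<Suc (T x). if ?P x then ?a x i = 1 else i = 0" for x
    proof (cases "?P x")
      case True
      then obtain n where "n < T x" "?a x n = 1" by blast
      then show ?thesis using True by (metis less_SucI)
    next
      case False
      then show ?thesis by (metis zero_less_Suc)
    qed
  qed
  then have "computable (\<lambda>x. if ?P x then Suc (LEAST n. if ?P x then ?a x n = 1 else n = 0) else 0)"
    by (intro computable_if P computable_Suc computable_const)
  moreover have "(if ?P x then Suc (LEAST n. if ?P x then ?a x n = 1 else n = 0) else 0) =
    opt_code (appr (Mn f) (T x) (list_decode (F x)))" for x
  proof -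
    have 1: "?a x n = 1 \<longleftrightarrow> appr f (T x) (n # list_decode (F x)) = Some 0" for n
      by (simp add: list_decode_Suc_prod_encode del: list_decode.simps)
    have 2: "1 < ?a x n \<longleftrightarrow> (\<exists>y. appr f (T x) (n # list_decode (F x)) = Some (Suc y))" for n
      by (cases "appr f (T x) (n # list_decode (F x))")
        (auto simp: list_decode_Suc_prod_encode gr0_conv_Suc simp del: list_decode.simps)
    show ?thesis
      unfolding 1 2 appr.simps by auto
  qed
  ultimately show ?case by (simp del: appr.simps)
qed

lemma computable_appr1:
  assumes "computable T" "computable F"
  shows "computable (\<lambda>x. opt_code (appr f (T x) [F x]))"
proof -
  have "computable (\<lambda>x. opt_code (appr f (T x) (list_decode (Suc (prod_encode (F x, 0))))))"
    by (intro computable_appr2 computable_intros assms)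
  then show ?thesis by (simp add: list_decode_Suc_prod_encode del: list_decode.simps(2))
qed

lemma computable_appr_pair:
  assumes "computable T" "computable F" "computable G"
  shows "computable (\<lambda>x. opt_code (appr f (T x) [F x, G x]))"
proof -
  have "computable (\<lambda>x. opt_code (appr f (T x) (list_decode (Suc (prod_encode (F x, Suc (prod_encode (G x, 0))))))))"
    by (intro computable_appr2 computable_intros assms)
  then show ?thesis by (simp add: list_decode_Suc_prod_encode del: list_decode.simps(2))
qed

text \<open>Unbounded search for \<open>t\<close>, followed by the constant function
  \<open>c\<close>. \<open>Cn\<close> demands that its arguments be defined, so the composition
  diverges wherever the search does. The machine to be simulated by \<open>U\<close> is programmed
  in this way.\<close>

lemma eval_semidecidable:
  assumes "decidable (\<lambda>p. R (pfst p) (psnd p))"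
  obtains f where "\<And>n y. eval f [n] y \<longleftrightarrow> (\<exists>t. R n t) \<and> y = c"
proof -
  have "computable (\<lambda>p. if R (psnd p) (pfst p) then 0 else 1)"
  proof -
    have "decidable (\<lambda>p. (\<lambda>p. R (pfst p) (psnd p)) (prod_encode (psnd p, pfst p)))"
      by (intro decidable_compose[OF assms] computable_intros)
    then show ?thesis by (intro computable_if computable_const) simp
  qed
  then have "fcomp 2 (\<lambda>xs. (\<lambda>p. if R (psnd p) (pfst p) then 0 else 1) (prod_encode (xs ! 0, xs ! 1)))"
    unfolding computable_iff_fcomp by (rule fcomp_compose1) (intro fcomp_prod_encode fcomp_nth; simp)
  then obtain g where g: "\<And>xs. length xs = 2 \<Longrightarrow> eval g xs (if R (xs ! 1) (xs ! 0) then 0 else 1)"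
    unfolding fcomp_def by auto
  have g': "eval g [t, n] (if R n t then 0 else 1)" for t n using g[of "[t, n]"] by simp
  have M: "\<exists>y. eval (Mn g) [n] y" if "R n t" for n t
  proof
    have "R n (LEAST t. R n t)" using that by (rule LeastI)
    moreover have "\<not> R n m" if "m < (LEAST t. R n t)" for m using not_less_Least[OF that] .
    ultimately show "eval (Mn g) [n] (LEAST t. R n t)"
      using g' by (intro eval.mn) (metis, metis One_nat_def)
  qed
  have M': "\<exists>t. R n t" if "eval (Mn g) [n] y" for n y
    using that
  proof cases
    case mn
    then have "eval g [y, n] 0" by simp
    then show ?thesis using g'[of y n] eval_deterministic by (metis zero_neq_one)
  qed
  obtain h where h: "\<And>x. eval h [x] c" using computable_const[of c] unfolding computable_def by blast
  have "eval (Cn h [Mn g]) [n] y \<longleftrightarrow> (\<exists>t. R n t) \<and> y = c" for n y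
  proof
    assume "eval (Cn h [Mn g]) [n] y"
    then show "(\<exists>t. R n t) \<and> y = c"
      by cases (auto simp: list_all2_Cons1 dest: M' eval_deterministic[OF h])
  next
    assume *: "(\<exists>t. R n t) \<and> y = c"
    then obtain z where "eval (Mn g) [n] z" using M by blast
    then show "eval (Cn h [Mn g]) [n] y" using h * by (intro eval.cn[where ys = "[z]"]) auto
  qed
  then show ?thesis by (rule that)
qed

subsection \<open>Computable sequences of dyadic rationals\<close>

text \<open>Dyadic rationals given exactly, not reals given by approximations: order is then
  decidable, and sums and products stay within the class. Division does not, which is why ratios are
  always compared after multiplying out.\<close>

definition computable_real :: "(nat \<Rightarrow> real) \<Rightarrow> bool" where
  "computable_real r \<longleftrightarrow> (\<exists>P Q E. computable P \<and> computable Q \<and> computable E \<and>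
     (\<forall>x. r x = (real (P x) - real (Q x)) / 2 ^ E x))"

lemma computable_realI:
  assumes "computable P" "computable Q" "computable E" "\<And>x. r x = (real (P x) - real (Q x)) / 2 ^ E x"
  shows "computable_real r"
  unfolding computable_real_def using assms by blast

lemma computable_realE:
  assumes "computable_real r"
  obtains P Q E where "computable P" "computable Q" "computable E" "\<And>x. r x = (real (P x) - real (Q x)) / 2 ^ E x"
  using assms unfolding computable_real_def by blast

lemma computable_real_of_nat: "computable F \<Longrightarrow> computable_real (\<lambda>x. real (F x))"
  by (rule computable_realI[of F "\<lambda>x. 0" "\<lambda>x. 0"]) (auto intro: computable_const)

lemma computable_real_half_power: "computable F \<Longrightarrow> computable_real (\<lambda>x. (1/2) ^ F x)"
  by (rule computable_realI[of "\<lambda>x. 1" "\<lambda>x. 0" F]) (auto intro: computable_const simp: power_divide)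

lemma computable_real_const_0: "computable_real (\<lambda>x. 0)"
  and computable_real_const_1: "computable_real (\<lambda>x. 1)"
  and computable_real_const_numeral: "computable_real (\<lambda>x. numeral k)"
  using computable_real_of_nat[OF computable_const, of 0] computable_real_of_nat[OF computable_const, of 1]
    computable_real_of_nat[OF computable_const, of "numeral k"] by simp_all

lemma computable_real_const_nat: "computable_real (\<lambda>x. real n)"
  by (intro computable_real_of_nat computable_const)

lemma computable_real_power2: "computable F \<Longrightarrow> computable_real (\<lambda>x. 2 ^ F x)"
  using computable_real_of_nat[OF computable_power[OF computable_const[of 2]], of F] by simp

lemma computable_real_add:
  assumes "computable_real r" "computable_real s"
  shows "computable_real (\<lambda>x. r x + s x)"
proof -
  obtain P Q E where 1: "computable P" "computable Q" "computable E" "\<And>x. r x = (real (P x) - real (Q x)) / 2 ^ E x"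
    using computable_realE[OF assms(1)] by blast
  obtain P' Q' E' where 2: "computable P'" "computable Q'" "computable E'" "\<And>x. s x = (real (P' x) - real (Q' x)) / 2 ^ E' x"
    using computable_realE[OF assms(2)] by blast
  show ?thesis
  proof (rule computable_realI[of "\<lambda>x. P x * 2 ^ E' x + P' x * 2 ^ E x" "\<lambda>x. Q x * 2 ^ E' x + Q' x * 2 ^ E x" "\<lambda>x. E x + E' x"])
    show "r x + s x = (real (P x * 2 ^ E' x + P' x * 2 ^ E x) - real (Q x * 2 ^ E' x + Q' x * 2 ^ E x)) / 2 ^ (E x + E' x)" for x
      unfolding 1(4) 2(4) by (simp add: field_simps power_add)
  qed (intro computable_intros 1 2)+
qed

lemma computable_real_mult:
  assumes "computable_real r" "computable_real s"
  shows "computable_real (\<lambda>x. r x * s x)"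
proof -
  obtain P Q E where 1: "computable P" "computable Q" "computable E" "\<And>x. r x = (real (P x) - real (Q x)) / 2 ^ E x"
    using computable_realE[OF assms(1)] by blast
  obtain P' Q' E' where 2: "computable P'" "computable Q'" "computable E'" "\<And>x. s x = (real (P' x) - real (Q' x)) / 2 ^ E' x"
    using computable_realE[OF assms(2)] by blast
  show ?thesis
  proof (rule computable_realI[of "\<lambda>x. P x * P' x + Q x * Q' x" "\<lambda>x. P x * Q' x + Q x * P' x" "\<lambda>x. E x + E' x"])
    show "r x * s x = (real (P x * P' x + Q x * Q' x) - real (P x * Q' x + Q x * P' x)) / 2 ^ (E x + E' x)" for x
      unfolding 1(4) 2(4) by (simp add: field_simps power_add)
  qed (intro computable_intros 1 2)+
qed

lemma computable_real_minus:
  assumes "computable_real r"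
  shows "computable_real (\<lambda>x. - r x)"
proof -
  obtain P Q E where 1: "computable P" "computable Q" "computable E" "\<And>x. r x = (real (P x) - real (Q x)) / 2 ^ E x"
    using computable_realE[OF assms(1)] by blast
  show ?thesis
    by (rule computable_realI[of Q P E]) (use 1 in \<open>auto simp: field_simps\<close>)
qed

lemma computable_real_diff:
  "computable_real r \<Longrightarrow> computable_real s \<Longrightarrow> computable_real (\<lambda>x. r x - s x)"
  using computable_real_add[OF _ computable_real_minus, of r s] by simp

lemma computable_real_if:
  assumes "decidable R" "computable_real r" "computable_real s"
  shows "computable_real (\<lambda>x. if R x then r x else s x)"
proof -
  have "computable_real (\<lambda>x. real (if R x then 1 else 0))"
    using assms(1) unfolding decidable_def by (rule computable_real_of_nat)
  then have "computable_real (\<lambda>x. real (if R x then 1 else 0) * r x + (1 - real (if R x then 1 else 0)) * s x)"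
    by (intro computable_real_add computable_real_mult computable_real_diff computable_real_const_1 assms)
  moreover have "real (if R x then 1 else 0) * r x + (1 - real (if R x then 1 else 0)) * s x = (if R x then r x else s x)" for x
    by simp
  ultimately show ?thesis by simp
qed

lemma computable_real_compose:
  assumes "computable_real r" "computable F"
  shows "computable_real (\<lambda>x. r (F x))"
proof -
  obtain P Q E where 1: "computable P" "computable Q" "computable E" "\<And>x. r x = (real (P x) - real (Q x)) / 2 ^ E x"
    using computable_realE[OF assms(1)] by blast
  show ?thesis
    by (rule computable_realI[of "\<lambda>x. P (F x)" "\<lambda>x. Q (F x)" "\<lambda>x. E (F x)"])
      (use 1 assms(2) in \<open>auto intro: computable_compose\<close>)
qed

lemma computable_real_sum:
  assumes "computable_real (\<lambda>p. r (pfst p) (psnd p))" "computable g"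
  shows "computable_real (\<lambda>x. \<Sum>i<g x. r x i)"
proof -
  obtain P Q E where 1: "computable P" "computable Q" "computable E" "\<And>p. r (pfst p) (psnd p) = (real (P p) - real (Q p)) / 2 ^ E p"
    using computable_realE[OF assms(1)] by blast
  have r: "r x i = (real (P (prod_encode (x, i))) - real (Q (prod_encode (x, i)))) / 2 ^ E (prod_encode (x, i))" for x i
    using 1(4)[of "prod_encode (x, i)"] by simp
  \<comment> \<open>Exponent of a common denominator: the sum of all exponents is at least each of
    them.\<close>
  define T where "T x = (\<Sum>i<g x. E (prod_encode (x, i)))" for x
  have T: "computable T"
    unfolding T_def by (intro computable_sum computable_compose[OF 1(3)] computable_prod_encode computable_pfst computable_psnd computable_id assms)
  have *: "computable (\<lambda>x. \<Sum>i<g x. P (prod_encode (x, i)) * 2 ^ (T x - E (prod_encode (x, i))))" if "computable P" for P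
    by (intro computable_sum computable_mult computable_power computable_diff computable_const computable_compose[OF that] computable_compose[OF 1(3)]
         computable_compose[OF T] computable_prod_encode computable_pfst computable_psnd computable_id assms)
  show ?thesis
  proof (rule computable_realI[OF *[OF 1(1)] *[OF 1(2)] T])
    fix x
    have "r x i = (real (P (prod_encode (x, i)) * 2 ^ (T x - E (prod_encode (x, i)))) - real (Q (prod_encode (x, i)) * 2 ^ (T x - E (prod_encode (x, i))))) / 2 ^ T x"
      if "i < g x" for i
    proof -
      have "E (prod_encode (x, i)) \<le> T x" unfolding T_def using that by (intro member_le_sum) auto
      then have "(2::real) ^ T x = 2 ^ (T x - E (prod_encode (x, i))) * 2 ^ E (prod_encode (x, i))"
        by (simp add: power_add[symmetric])
      then show ?thesis unfolding r by (simp add: field_simps)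
    qed
    then show "(\<Sum>i<g x. r x i) = (real (\<Sum>i<g x. P (prod_encode (x, i)) * 2 ^ (T x - E (prod_encode (x, i)))) -
      real (\<Sum>i<g x. Q (prod_encode (x, i)) * 2 ^ (T x - E (prod_encode (x, i))))) / 2 ^ T x"
      by (simp add: sum_subtractf[symmetric] sum_divide_distrib)
  qed
qed

lemma decidable_real_le:
  assumes "computable_real r" "computable_real s"
  shows "decidable (\<lambda>x. r x \<le> s x)"
proof -
  obtain P Q E where 1: "computable P" "computable Q" "computable E" "\<And>x. r x - s x = (real (P x) - real (Q x)) / 2 ^ E x"
    using computable_realE[OF computable_real_diff[OF assms]] by blast
  have "r x \<le> s x \<longleftrightarrow> P x \<le> Q x" for x
  proof -
    have "r x \<le> s x \<longleftrightarrow> r x - s x \<le> 0" by simp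
    also have "\<dots> \<longleftrightarrow> real (P x) - real (Q x) \<le> 0"
      unfolding 1(4) by (subst pos_divide_le_eq) simp_all
    also have "\<dots> \<longleftrightarrow> real (P x) \<le> real (Q x)" by simp
    finally show ?thesis by simp
  qed
  then show ?thesis using 1 by (simp add: decidable_le)
qed

lemma decidable_real_less:
  "computable_real r \<Longrightarrow> computable_real s \<Longrightarrow> decidable (\<lambda>x. r x < s x)"
  using decidable_not[OF decidable_real_le, of s r] by (simp add: not_le)

lemmas computable_real_intros = computable_real_const_0 computable_real_const_1 computable_real_const_numeral
  computable_real_const_nat computable_real_of_nat computable_real_half_power computable_real_power2
  computable_real_add computable_real_mult computable_real_minus computable_real_diff computable_real_if
  computable_real_sum decidable_real_le decidable_real_less

subsection \<open>Codes of strings\<close>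

fun str_dec :: "nat \<Rightarrow> bool list" where
  "str_dec n = (if n = 0 then [] else even n # str_dec ((n - 1) div 2))"

declare str_dec.simps [simp del]

lemma str_dec_code [simp]: "str_dec (str_code \<sigma>) = \<sigma>"
proof (induction \<sigma>)
  case Nil
  show ?case by (simp add: str_dec.simps[of 0])
next
  case (Cons b \<sigma>)
  then show ?case by (subst str_dec.simps) auto
qed

lemma str_code_dec [simp]: "str_code (str_dec n) = n"
proof (induction n rule: str_dec.induct)
  case (1 n)
  show ?case
  proof (cases "n = 0")
    case False
    then have "2 * ((n - 1) div 2) + (if even n then 2 else 1) = n" by presburger
    then show ?thesis using 1 False by (subst str_dec.simps) simp
  qed (simp add: str_dec.simps[of 0])
qed

lemma str_dec_inj [simp]: "str_dec m = str_dec n \<longleftrightarrow> m = n"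
  by (metis str_code_dec)

definition len :: "nat \<Rightarrow> nat" where "len n = length (str_dec n)"

lemma len_0 [simp]: "len 0 = 0"
  by (simp add: len_def str_dec.simps[of 0])

lemma len_Suc: "len (Suc n) = Suc (len (n div 2))"
  by (simp add: len_def str_dec.simps[of "Suc n"])

text \<open>\<open>n + 1\<close> in binary is a leading 1 followed by the bits of the coded string
  in reverse, the first bit of the string being the least significant. The same picture explains
  \<open>nth_str_dec\<close>.\<close>

lemma len_bounds: "2 ^ len n \<le> n + 1" "n + 1 < 2 ^ Suc (len n)"
proof -
  have "2 ^ len n \<le> n + 1 \<and> n + 1 < 2 ^ Suc (len n)"
  proof (induction n rule: less_induct)
    case (less n)
    show ?case
    proof (cases n)
      case (Suc m)
      then have "2 ^ len (m div 2) \<le> m div 2 + 1 \<and> m div 2 + 1 < 2 ^ Suc (len (m div 2))"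
        using less[of "m div 2"] by auto
      then show ?thesis unfolding Suc len_Suc by auto
    qed simp
  qed
  then show "2 ^ len n \<le> n + 1" "n + 1 < 2 ^ Suc (len n)" by auto
qed

lemma len_le: "len n \<le> n"
  using len_bounds(1)[of n] less_exp[of "len n"] by linarith

lemma len_code [simp]: "len (str_code \<sigma>) = length \<sigma>"
  by (simp add: len_def)

lemma computable_len: "computable F \<Longrightarrow> computable (\<lambda>x. len (F x))"
proof -
  assume F: "computable F"
  have "len n = (\<Sum>k<n. if 2 ^ Suc k \<le> n + 1 then 1 else 0)" for n
  proof -
    have "2 ^ Suc k \<le> n + 1 \<longleftrightarrow> k < len n" for k
    proof
      assume "k < len n"
      then have "(2::nat) ^ Suc k \<le> 2 ^ len n" by (intro power_increasing) auto
      then show "2 ^ Suc k \<le> n + 1" using len_bounds(1)[of n] by linarith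
    next
      assume "2 ^ Suc k \<le> n + 1"
      then have "(2::nat) ^ Suc k < 2 ^ Suc (len n)" using len_bounds(2)[of n] by linarith
      then have "Suc k < Suc (len n)" by (rule power_less_imp_less_exp[rotated]) simp
      then show "k < len n" by simp
    qed
    then have "(\<Sum>k<n. if 2 ^ Suc k \<le> n + 1 then 1 else 0) = card {k \<in> {..<n}. k < len n}"
      by (simp add: sum.If_cases Int_def)
    also have "{k \<in> {..<n}. k < len n} = {..<len n}" using len_le[of n] by auto
    finally show ?thesis by simp
  qed
  then have "(\<lambda>x. len (F x)) = (\<lambda>x. \<Sum>k<F x. if 2 ^ Suc k \<le> F x + 1 then 1 else 0)" by simp
  then show ?thesis
    by (simp only:) (intro computable_intros F computable_compose[OF F])
qed

lemma nth_str_dec: "i < len n \<Longrightarrow> str_dec n ! i \<longleftrightarrow> odd ((n + 1) div 2 ^ i)"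
proof (induction n arbitrary: i rule: less_induct)
  case (less n)
  show ?case
  proof (cases n)
    case 0
    then show ?thesis using less by simp
  next
    case (Suc m)
    show ?thesis
    proof (cases i)
      case 0
      then show ?thesis using Suc by (simp add: str_dec.simps[of "Suc m"])
    next
      case (Suc j)
      then have "str_dec (m div 2) ! j \<longleftrightarrow> odd ((m div 2 + 1) div 2 ^ j)"
        using \<open>n = Suc m\<close> less(1)[of "m div 2" j] less(2) by (auto simp: len_Suc)
      moreover have "(n + 1) div 2 = m div 2 + 1" using \<open>n = Suc m\<close> by simp
      ultimately show ?thesis using Suc \<open>n = Suc m\<close> by (simp add: str_dec.simps[of "Suc m"] div_mult2_eq)
    qed
  qed
qed

definition lo :: "nat \<Rightarrow> real" where "lo n = dyadic_lo (str_dec n)"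

lemma computable_lo: "computable F \<Longrightarrow> computable_real (\<lambda>x. lo (F x))"
proof -
  assume F: "computable F"
  have "lo n = (\<Sum>i<len n. if odd ((n + 1) div 2 ^ i) then (1/2) ^ Suc i else 0)" for n
    unfolding lo_def dyadic_lo_def by (auto simp: len_def[symmetric] nth_str_dec intro!: sum.cong)
  then have "(\<lambda>x. lo (F x)) = (\<lambda>x. \<Sum>i<len (F x). if odd ((F x + 1) div 2 ^ i) then (1/2) ^ Suc i else 0)" by simp
  then show ?thesis
    by (simp only:) (intro computable_real_intros computable_intros F computable_compose[OF F] computable_len)
qed

lemma str_code_append: "str_code (\<sigma> @ \<tau>) = str_code \<sigma> + 2 ^ length \<sigma> * str_code \<tau>"
  by (induction \<sigma>) (auto simp: algebra_simps)

lemma str_code_replicate_True: "str_code (replicate e True) = 2 * (2 ^ e - 1)"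
proof (induction e)
  case (Suc e)
  have "(1::nat) \<le> 2 ^ e" by simp
  then have "2 * (2 * (2 ^ e - 1)) + 2 = (2 * (2 * 2 ^ e - 1) :: nat)" by linarith
  then show ?case using Suc by simp
qed simp

section \<open>Dyadic intervals of strings and the Kraft inequality\<close>

lemma dyadic_lo_Nil [simp]: "dyadic_lo [] = 0"
  by (simp add: dyadic_lo_def)

lemma dyadic_lo_Cons: "dyadic_lo (b # \<sigma>) = (if b then 1/2 else 0) + dyadic_lo \<sigma> / 2"
proof -
  have "dyadic_lo (b # \<sigma>) = (if b then 1/2 else 0) + (\<Sum>i<length \<sigma>. if \<sigma> ! i then (1/2) ^ (Suc (Suc i)) else 0)"
    unfolding dyadic_lo_def by (simp add: sum.lessThan_Suc_shift del: sum.lessThan_Suc)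
  also have "(\<Sum>i<length \<sigma>. if \<sigma> ! i then (1/2::real) ^ (Suc (Suc i)) else 0) = dyadic_lo \<sigma> / 2"
    unfolding dyadic_lo_def by (simp add: sum_divide_distrib if_distrib[of "\<lambda>x. x / 2"] cong: if_cong)
  finally show ?thesis .
qed

lemma dyadic_lo_nonneg: "0 \<le> dyadic_lo \<sigma>"
  by (simp add: dyadic_lo_def sum_nonneg)

lemma dyadic_lo_append: "dyadic_lo (\<sigma> @ \<tau>) = dyadic_lo \<sigma> + (1/2) ^ length \<sigma> * dyadic_lo \<tau>"
  by (induction \<sigma>) (auto simp: dyadic_lo_Cons algebra_simps)

lemma dyadic_lo_less: "dyadic_lo \<sigma> + (1/2) ^ length \<sigma> \<le> 1"
  by (induction \<sigma>) (auto simp: dyadic_lo_Cons)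

text \<open>The cylinders of length \<open>n\<close> are the cells of the grid of width 2^-n, so
  they can be counted, and their left ends compared, as integers.\<close>

lemma dyadic_lo_upto:
  "bij_betw (\<lambda>\<sigma>. dyadic_lo \<sigma> * 2 ^ n) {\<sigma>. length \<sigma> = n} (real ` {..<2 ^ n})"
proof (induction n)
  case 0
  then show ?case by (auto simp: bij_betw_def)
next
  case (Suc n)
  define f where "f n \<sigma> = dyadic_lo \<sigma> * 2 ^ n" for n \<sigma>
  have f: "f (Suc n) (b # \<sigma>) = (if b then 2 ^ n else 0) + f n \<sigma>" for b \<sigma>
    by (simp add: f_def dyadic_lo_Cons algebra_simps)
  have IH: "inj_on (f n) {\<sigma>. length \<sigma> = n}" "f n ` {\<sigma>. length \<sigma> = n} = real ` {..<2 ^ n}"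
    using Suc unfolding f_def[abs_def] bij_betw_def by auto
  have r: "f n \<sigma> < 2 ^ n" "0 \<le> f n \<sigma>" if "length \<sigma> = n" for \<sigma>
  proof -
    have "f n \<sigma> \<in> real ` {..<2 ^ n}" using IH(2) that by blast
    then show "f n \<sigma> < 2 ^ n" "0 \<le> f n \<sigma>" by auto
  qed
  have "inj_on (f (Suc n)) {\<sigma>. length \<sigma> = Suc n}"
  proof (rule inj_onI)
    fix \<sigma> \<tau> assume *: "\<sigma> \<in> {\<sigma>. length \<sigma> = Suc n}" "\<tau> \<in> {\<sigma>. length \<sigma> = Suc n}" "f (Suc n) \<sigma> = f (Suc n) \<tau>"
    then obtain b \<sigma>' c \<tau>' where "\<sigma> = b # \<sigma>'" "\<tau> = c # \<tau>'" "length \<sigma>' = n" "length \<tau>' = n"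
      by (auto simp: length_Suc_conv)
    then show "\<sigma> = \<tau>" using *(3) r[of \<sigma>'] r[of \<tau>'] IH(1) by (auto simp: f inj_on_def split: if_splits)
  qed
  moreover have "f (Suc n) ` {\<sigma>. length \<sigma> = Suc n} = real ` {..<2 ^ Suc n}"
  proof -
    have "f (Suc n) ` {\<sigma>. length \<sigma> = Suc n} = f n ` {\<sigma>. length \<sigma> = n} \<union> (\<lambda>x. 2 ^ n + x) ` f n ` {\<sigma>. length \<sigma> = n}"
    proof -
      have "{\<sigma>. length \<sigma> = Suc n} = (\<lambda>\<sigma>. False # \<sigma>) ` {\<sigma>. length \<sigma> = n} \<union> (\<lambda>\<sigma>. True # \<sigma>) ` {\<sigma>. length \<sigma> = n}"
        by (auto simp: length_Suc_conv)
      then show ?thesis by (simp add: image_Un image_image f)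
    qed
    also have "\<dots> = real ` {..<2 ^ n} \<union> real ` ((\<lambda>x. 2 ^ n + x) ` {..<2 ^ n})"
      unfolding IH(2) by (simp add: image_image)
    also have "(\<lambda>x. 2 ^ n + x) ` {..<2 ^ n} = {2 ^ n..<(2::nat) ^ Suc n}"
    proof -
      have "(\<lambda>x. (2::nat) ^ n + x) ` {0..<2 ^ n} = {0 + 2 ^ n..<2 ^ n + 2 ^ n}"
        using image_add_atLeastLessThan[of "(2::nat) ^ n" 0 "2 ^ n"] by (simp add: add.commute)
      then show ?thesis by (simp add: atLeast0LessThan mult_2)
    qed
    also have "real ` {..<2 ^ n} \<union> real ` {2 ^ n..<2 ^ Suc n} = real ` {..<2 ^ Suc n}"
      unfolding image_Un[symmetric] by (auto simp: ivl_disj_un)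
    finally show ?thesis .
  qed
  ultimately show ?case unfolding f_def[abs_def] bij_betw_def by blast
qed

text \<open>Extend every string in all ways to a common length \<open>n\<close>: prefix-freeness
  makes the sets of extensions disjoint, and together they have at most 2^n members.\<close>

lemma Kraft_prefix_free:
  fixes F :: "bool list set"
  assumes "finite F" and pf: "\<And>\<sigma> \<tau>. \<sigma> \<in> F \<Longrightarrow> \<tau> \<in> F \<Longrightarrow> prefix \<sigma> \<tau> \<Longrightarrow> \<sigma> = \<tau>"
  shows "(\<Sum>\<sigma>\<in>F. (1/2) ^ length \<sigma>) \<le> (1::real)"
proof -
  define n where "n = Max (insert 0 (length ` F))"
  have n: "length \<sigma> \<le> n" if "\<sigma> \<in> F" for \<sigma>
    unfolding n_def using that assms(1) by (intro Max_ge) auto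
  define E where "E \<sigma> = (\<lambda>\<tau>. \<sigma> @ \<tau>) ` {\<tau>::bool list. length \<tau> = n - length \<sigma>}" for \<sigma>
  have fin: "finite {\<tau>::bool list. length \<tau> = k}" for k
    using finite_lists_length_eq[of "UNIV :: bool set" k] by simp
  have cd: "card {\<tau>::bool list. length \<tau> = k} = 2 ^ k" for k
    using card_lists_length_eq[of "UNIV :: bool set" k] by simp
  have cardE: "card (E \<sigma>) = 2 ^ (n - length \<sigma>)" for \<sigma>
    unfolding E_def by (subst card_image) (auto simp: inj_on_def cd)
  have "card (\<Union>\<sigma>\<in>F. E \<sigma>) = (\<Sum>\<sigma>\<in>F. card (E \<sigma>))"
  proof (rule card_UN_disjoint)
    show "\<forall>i\<in>F. \<forall>j\<in>F. i \<noteq> j \<longrightarrow> E i \<inter> E j = {}"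
    proof (intro ballI impI)
      fix i j assume *: "i \<in> F" "j \<in> F" "i \<noteq> j"
      show "E i \<inter> E j = {}"
      proof (rule ccontr)
        assume "E i \<inter> E j \<noteq> {}"
        then obtain x where "x \<in> E i" "x \<in> E j" by blast
        then have "prefix i x" "prefix j x" unfolding E_def prefix_def by blast+
        then have "prefix i j \<or> prefix j i" by (rule prefix_same_cases)
        then show False using * pf by metis
      qed
    qed
  qed (use assms fin in \<open>auto simp: E_def\<close>)
  moreover have "card (\<Union>\<sigma>\<in>F. E \<sigma>) \<le> card {\<tau>::bool list. length \<tau> = n}"
    using n by (intro card_mono fin) (auto simp: E_def)
  ultimately have "(\<Sum>\<sigma>\<in>F. 2 ^ (n - length \<sigma>)) \<le> (2::nat) ^ n"
    by (simp add: cardE cd)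
  then have "real (\<Sum>\<sigma>\<in>F. 2 ^ (n - length \<sigma>)) \<le> real (2 ^ n)"
    by (simp only: of_nat_le_iff)
  then have "(\<Sum>\<sigma>\<in>F. 2 ^ (n - length \<sigma>)) \<le> (2::real) ^ n"
    by simp
  moreover have "(\<Sum>\<sigma>\<in>F. 2 ^ (n - length \<sigma>)) = (\<Sum>\<sigma>\<in>F. (1/2) ^ length \<sigma>) * (2::real) ^ n"
    unfolding sum_distrib_right
    by (intro sum.cong refl) (use n in \<open>simp add: power_diff power_divide\<close>)
  ultimately show ?thesis by simp
qed

subsection \<open>Nested chains of stages\<close>

text \<open>The start of the current run at stage \<open>t\<close>. A new run starts when
  \<open>P\<close> fires for the base \<open>N\<close>, the current start and the present stage; up
  to stage \<open>N\<close> the value is \<open>N\<close>.\<close>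

primrec chain :: "(nat \<Rightarrow> nat \<Rightarrow> nat \<Rightarrow> bool) \<Rightarrow> nat \<Rightarrow> nat \<Rightarrow> nat" where
  "chain P N 0 = N"
| "chain P N (Suc t) = (if N \<le> t \<and> P N (chain P N t) (Suc t) then Suc t else chain P N t)"

text \<open>Level \<open>Suc j\<close> is evaluated afresh for the current start of level
  \<open>j\<close>, so a restart at one level restarts all deeper ones, like injury in a priority
  construction.\<close>

primrec nest :: "(nat \<Rightarrow> nat \<Rightarrow> nat \<Rightarrow> nat \<Rightarrow> bool) \<Rightarrow> nat \<Rightarrow> nat \<Rightarrow> nat \<Rightarrow> nat" where
  "nest P n0 0 t = n0"
| "nest P n0 (Suc j) t = chain (P j) (nest P n0 j t) t"

lemma chain_le: "t \<le> N \<Longrightarrow> chain P N t = N"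
  by (induction t) auto

lemma chain_bounds:
  assumes "N \<le> t"
  shows "N \<le> chain P N t" "chain P N t \<le> t"
proof -
  have "N \<le> chain P N t \<and> chain P N t \<le> t"
    using assms by (induction t rule: dec_induct) (auto simp: chain_le)
  then show "N \<le> chain P N t" "chain P N t \<le> t" by auto
qed

lemma chain_stable:
  assumes "chain P N t \<le> v" "v \<le> t" "N \<le> v"
  shows "chain P N v = chain P N t"
  using assms(2,1,3)
proof (induction t rule: dec_induct)
  case (step t)
  then show ?case by (auto split: if_splits)
qed simp

lemma chain_untriggered:
  assumes "N \<le> t" "chain P N t < v" "v \<le> t"
  shows "\<not> P N (chain P N t) v"
proof
  assume "P N (chain P N t) v"
  moreover have N: "N \<le> chain P N t" using chain_bounds assms by auto
  then obtain v' where v: "v = Suc v'" "N \<le> v'" "chain P N t \<le> v'"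
    using assms(2) by (cases v) auto
  moreover have "chain P N v' = chain P N t"
    using v assms by (intro chain_stable) auto
  ultimately have "chain P N v = v" by simp
  moreover have "chain P N v = chain P N t" using v assms by (intro chain_stable) auto
  ultimately show False using assms by simp
qed

lemma chain_mono: "t \<le> t' \<Longrightarrow> chain P N t \<le> chain P N t'"
proof (induction t' rule: dec_induct)
  case (step m)
  then show ?case
    using chain_bounds(2)[of N m P] by (auto split: if_splits)
qed simp

lemma nest_bounds:
  assumes "n0 \<le> t"
  shows "n0 \<le> nest P n0 j t" "nest P n0 j t \<le> t"
proof -
  have "n0 \<le> nest P n0 j t \<and> nest P n0 j t \<le> t"
  proof (induction j)
    case (Suc j)
    then show ?case using chain_bounds[of "nest P n0 j t" t "P j"] by auto
  qed (use assms in simp)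
  then show "n0 \<le> nest P n0 j t" "nest P n0 j t \<le> t" by auto
qed

lemma nest_le_Suc: "n0 \<le> t \<Longrightarrow> nest P n0 j t \<le> nest P n0 (Suc j) t"
  using chain_bounds(1)[of "nest P n0 j t" t "P j"] nest_bounds(2)[of n0 t P j] by simp

lemma nest_step: "n0 \<le> t \<Longrightarrow> nest P n0 j (Suc t) = nest P n0 j t \<or> nest P n0 j (Suc t) = Suc t"
proof (induction j)
  case (Suc j)
  then show ?case
    using chain_le[of "Suc t" "Suc t" "P j"] by (auto split: if_splits simp del: chain.simps) (auto split: if_splits)
qed simp

lemma nest_Suc_Suc:
  assumes "n0 \<le> t"
  shows "nest P n0 (Suc j) (Suc t) =
    (if nest P n0 j (Suc t) \<noteq> nest P n0 j t \<or> P j (nest P n0 j t) (nest P n0 (Suc j) t) (Suc t) then Suc t else nest P n0 (Suc j) t)"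
proof (cases "nest P n0 j (Suc t) = nest P n0 j t")
  case True
  then show ?thesis using nest_bounds(2)[OF assms, of P j] by simp
next
  case False
  then have "nest P n0 j (Suc t) = Suc t" using nest_step[OF assms, of P j] by blast
  moreover have "chain (P j) (Suc t) (Suc t) = Suc t" by (rule chain_le) simp
  ultimately show ?thesis using False by (simp del: chain.simps)
qed

lemma nest_stable:
  assumes "n0 \<le> v" "nest P n0 j t \<le> v" "v \<le> t"
  shows "nest P n0 j v = nest P n0 j t"
  using assms(3,2)
proof (induction t rule: dec_induct)
  case (step t)
  then show ?case using nest_step[of n0 t P j] assms(1) by auto
qed simp

lemma nest_nest: "n0 \<le> t \<Longrightarrow> nest P n0 j (nest P n0 j t) = nest P n0 j t"
  using nest_bounds[of n0 t P j] by (intro nest_stable) auto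

lemma nest_untriggered:
  assumes "n0 \<le> t" "nest P n0 (Suc j) t < v" "v \<le> t"
  shows "\<not> P j (nest P n0 j t) (nest P n0 (Suc j) t) v"
  using chain_untriggered[of "nest P n0 j t" t "P j" v] nest_bounds(2)[of n0 t P j] assms by simp

text \<open>Finite injury: once level \<open>j\<close> has settled, level \<open>Suc j\<close> is a
  chain with a fixed base, and such chains settle by assumption.\<close>

lemma nest_converges:
  assumes "\<And>j N. n0 \<le> N \<Longrightarrow> \<exists>u. \<forall>\<^sub>F t in sequentially. chain (P j) N t = u"
  shows "\<exists>u\<ge>n0. \<forall>\<^sub>F t in sequentially. nest P n0 j t = u"
proof (induction j)
  case (Suc j)
  then obtain N where N: "n0 \<le> N" "\<forall>\<^sub>F t in sequentially. nest P n0 j t = N" by auto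
  obtain u where u: "\<forall>\<^sub>F t in sequentially. chain (P j) N t = u" using assms[OF N(1)] by blast
  have ev: "\<forall>\<^sub>F t in sequentially. nest P n0 (Suc j) t = u"
    using N(2) u by eventually_elim simp
  then have "\<forall>\<^sub>F t in sequentially. nest P n0 (Suc j) t = u \<and> n0 \<le> t"
    by (intro eventually_conj eventually_ge_at_top)
  then obtain t where "nest P n0 (Suc j) t = u" "n0 \<le> t"
    by (auto dest: eventually_happens)
  then show ?case using nest_bounds(1)[of n0 t P "Suc j"] ev by auto
qed auto

lemma computable_chain:
  assumes "decidable (\<lambda>p. P (pfst p) (N (pfst p)) (psnd (psnd p)) (Suc (pfst (psnd p))))"
    "computable N" "computable T"
  shows "computable (\<lambda>x. chain (P x) (N x) (T x))"
proof -
  have "computable (\<lambda>x. rec_nat (N x) (\<lambda>t u. if N x \<le> t \<and> P x (N x) u (Suc t) then Suc t else u) (T x))"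
    by (intro computable_rec computable_intros computable_compose[OF assms(2)] assms)
  moreover have "rec_nat (N x) (\<lambda>t u. if N x \<le> t \<and> P x (N x) u (Suc t) then Suc t else u) t = chain (P x) (N x) t" for x t
    by (induction t) auto
  ultimately show ?thesis by simp
qed

lemma computable_nest:
  assumes "decidable (\<lambda>q. P (pfst (pfst q)) (pfst (psnd (pfst q))) (psnd (psnd (pfst q))) (psnd (psnd q)) (Suc (pfst (psnd q))))"
    "computable n0" "computable J" "computable T"
  shows "computable (\<lambda>x. nest (P x) (n0 x) (J x) (T x))"
proof -
  have "computable (\<lambda>x. rec_nat (n0 x) (\<lambda>j N. chain (P x j) N (T x)) (J x))"
    by (intro computable_rec computable_chain computable_intros computable_compose[OF assms(4)] assms)
  moreover have "rec_nat (n0 x) (\<lambda>j N. chain (P x j) N (T x)) j = nest (P x) (n0 x) j (T x)" for x j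
    by (induction j) auto
  ultimately show ?thesis by simp
qed

text \<open>A trigger that compares values makes the chain move exactly to strict new minima of
  \<open>f\<close>.\<close>

lemma chain_record:
  assumes "\<And>u v. P N u v \<longleftrightarrow> f v < f u" "N \<le> v" "v \<le> t"
  shows "(f (chain P N t) :: real) \<le> f v"
proof -
  have "\<forall>v. N \<le> v \<and> v \<le> t \<longrightarrow> f (chain P N t) \<le> f v" if "N \<le> t"
    using that
  proof (induction t rule: dec_induct)
    case base
    then show ?case using chain_le by auto
  next
    case (step t)
    show ?case
    proof (intro allI impI)
      fix v assume v: "N \<le> v \<and> v \<le> Suc t"
      show "f (chain P N (Suc t)) \<le> f v"
      proof (cases "f (Suc t) < f (chain P N t)")
        case True
        then have "chain P N (Suc t) = Suc t" using step by (simp add: assms(1))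
        then show ?thesis using True step v by (cases "v = Suc t") force+
      next
        case False
        then have "chain P N (Suc t) = chain P N t" using step by (simp add: assms(1))
        then show ?thesis using False step v by (cases "v = Suc t") force+
      qed
    qed
  qed
  then show ?thesis using assms by auto
qed

text \<open>As \<open>f s\<close> lies below the limit, all late values exceed it, so only finitely
  many stages compete for the minimum.\<close>

lemma attains_min:
  fixes f :: "nat \<Rightarrow> real"
  assumes "f \<longlonglongrightarrow> l" "N \<le> s" "f s < l"
  obtains m where "N \<le> m" "\<And>t. N \<le> t \<Longrightarrow> f m \<le> f t"
proof -
  have "\<forall>\<^sub>F t in sequentially. f s < f t"
    using assms(1,3) by (rule order_tendstoD)
  then obtain T where T: "\<And>t. T \<le> t \<Longrightarrow> f s < f t"
    unfolding eventually_sequentially by blast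
  define m where "m = arg_min_on f {N..max T s}"
  have "m \<in> {N..max T s}" "\<And>t. t \<in> {N..max T s} \<Longrightarrow> f m \<le> f t"
    unfolding m_def using assms(2)
    by (intro arg_min_if_finite(1) arg_min_least; force)+
  moreover have "f m \<le> f t" if "N \<le> t" for t
  proof (cases "t \<le> max T s")
    case False
    then have "f s < f t" using T by simp
    moreover have "f m \<le> f s" using assms calculation(1) \<open>\<And>t. t \<in> {N..max T s} \<Longrightarrow> f m \<le> f t\<close> by simp
    ultimately show ?thesis by simp
  qed (use calculation that in auto)
  ultimately show ?thesis using that by auto
qed

lemma chain_record_converges:
  assumes P: "\<And>u v. P N u v \<longleftrightarrow> (f v :: real) < f u" and "f \<longlonglongrightarrow> l" "N \<le> s" "f s < l"
  shows "\<exists>u. \<forall>\<^sub>F t in sequentially. chain P N t = u"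
proof -
  obtain m where m: "N \<le> m" "\<And>t. N \<le> t \<Longrightarrow> f m \<le> f t"
    using attains_min[OF assms(2-4)] by blast
  have "chain P N t = chain P N m" if "m \<le> t" for t
    using that
  proof (induction t rule: dec_induct)
    case (step t)
    have "f (chain P N t) \<le> f m" using chain_record[of P N f m t] P step m by auto
    then have "\<not> f (Suc t) < f (chain P N t)" using m(2)[of "Suc t"] m(1) step by simp
    then show ?case using step P by simp
  qed simp
  then show ?thesis unfolding eventually_sequentially by blast
qed

text \<open>Either the chain reaches \<open>T\<close>, after which nothing can move it, or it is
  bounded by \<open>T\<close> and, being nondecreasing, becomes constant.\<close>

lemma chain_eventually_untriggered_converges:
  assumes "\<And>u v. T \<le> u \<Longrightarrow> u < v \<Longrightarrow> \<not> P N u v"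
  shows "\<exists>u. \<forall>\<^sub>F t in sequentially. chain P N t = u"
proof (cases "\<exists>t\<ge>N. T \<le> chain P N t")
  case True
  then obtain t where t: "N \<le> t" "T \<le> chain P N t" by blast
  have "chain P N t' = chain P N t" if "t \<le> t'" for t'
    using that
  proof (induction t' rule: dec_induct)
    case (step t')
    have "chain P N t' \<le> t'" using chain_bounds(2)[of N t' P] step t by simp
    then have "\<not> P N (chain P N t) (Suc t')" using step t by (intro assms) auto
    then show ?case using step by simp
  qed simp
  then show ?thesis unfolding eventually_sequentially by blast
next
  case False
  define M where "M = Max (chain P N ` {N..})"
  have fin: "finite (chain P N ` {N..})"
    by (rule finite_subset[of _ "{..<T}"]) (use False in auto)
  then have "M \<in> chain P N ` {N..}" unfolding M_def by (intro Max_in) auto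
  then obtain t where t: "N \<le> t" "M = chain P N t" by auto
  have "chain P N t' = M" if "t \<le> t'" for t'
  proof (rule antisym)
    show "chain P N t' \<le> M" unfolding M_def using fin that t by (intro Max_ge) auto
    show "M \<le> chain P N t'" unfolding t(2) using that by (rule chain_mono)
  qed
  then show ?thesis unfolding eventually_sequentially by blast
qed

subsection \<open>Solovay complete approximations\<close>

locale solovay_complete =
  fixes \<alpha> :: "nat \<Rightarrow> real" and x :: real
  assumes computable_\<alpha>: "computable_real \<alpha>"
    and mono_\<alpha>: "incseq \<alpha>"
    and lim_\<alpha>: "\<alpha> \<longlonglongrightarrow> x"
    and complete: "\<And>\<theta> K. computable_real \<theta> \<Longrightarrow> incseq \<theta> \<Longrightarrow> \<theta> 0 = 0 \<Longrightarrow> (\<And>t. \<theta> t \<le> real K) \<Longrightarrow>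
      \<exists>c>0. \<forall>s t. s \<le> t \<longrightarrow> c * (\<theta> t - \<theta> s) \<le> x - \<alpha> s"
begin

lemma \<alpha>_le: "\<alpha> s \<le> x"
  using mono_\<alpha> lim_\<alpha> by (rule incseq_le)

text \<open>The bound 4^-i leaves room for weights 2^i with a convergent sum, so one
  \<open>e\<close> yields the gain 2^i at every index. The sum is cut at \<open>t\<close> to be
  computable; terms missing at stage \<open>s\<close> only enlarge the later increments.\<close>

lemma complete_family:
  assumes comp: "computable_real (\<lambda>t. \<Sum>i<t. 2 ^ i * G i t)"
    and mono: "\<And>i s t. s \<le> t \<Longrightarrow> G i s \<le> G i t" and nonneg: "\<And>i t. 0 \<le> G i t"
    and bound: "\<And>i t. G i t \<le> K * (1/4) ^ i"
  obtains e where "0 < e" "\<And>i s t. s \<le> t \<Longrightarrow> e * (2 ^ i * (G i t - G i s)) \<le> x - \<alpha> s"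
proof -
  define \<theta> where "\<theta> t = (\<Sum>i<t. 2 ^ i * G i t)" for t
  have diff: "2 ^ i * (G i t - G i s) \<le> \<theta> t - \<theta> s" if "s \<le> t" "i < t" for i s t
  proof -
    have "\<theta> s \<le> (\<Sum>j<t. 2 ^ j * G j s)"
      unfolding \<theta>_def using that nonneg by (intro sum_mono2) auto
    also have "\<dots> + 2 ^ i * (G i t - G i s) =
      (\<Sum>j<t. 2 ^ j * G j s + (if j = i then 2 ^ i * (G i t - G i s) else 0))"
      using that by (simp add: sum.distrib sum.delta)
    also have "\<dots> \<le> \<theta> t"
      unfolding \<theta>_def using that by (intro sum_mono) (auto simp: algebra_simps mono)
    finally show ?thesis by simp
  qed
  have inc: "incseq \<theta>"
  proof (rule incseq_SucI)
    fix n
    have "0 \<le> 2 ^ 0 * (G 0 (Suc n) - G 0 n)" using mono[of n "Suc n"] by simp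
    also have "\<dots> \<le> \<theta> (Suc n) - \<theta> n" by (intro diff) auto
    finally show "\<theta> n \<le> \<theta> (Suc n)" by simp
  qed
  have K: "0 \<le> K" using order_trans[OF nonneg[of 0 0] bound[of 0 0]] by simp
  obtain N :: nat where N: "K * 2 \<le> real N" using real_arch_simple by blast
  have "\<theta> t \<le> real N" for t
  proof -
    have "\<theta> t \<le> (\<Sum>i<t. K * (1/2) ^ i)"
      unfolding \<theta>_def
    proof (rule sum_mono)
      fix i
      have "2 ^ i * G i t \<le> 2 ^ i * (K * (1/4) ^ i)" by (intro mult_left_mono bound) auto
      also have "\<dots> = K * (1/2) ^ i" by (simp add: power_mult_distrib[symmetric])
      finally show "2 ^ i * G i t \<le> K * (1/2) ^ i" .
    qed
    also have "\<dots> = K * (\<Sum>i<t. (1/2) ^ i)" by (simp add: sum_distrib_left)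
    also have "\<dots> \<le> K * 2" using K by (intro mult_left_mono) (simp_all add: geometric_sum)
    finally show ?thesis using N by simp
  qed
  then obtain e where e: "0 < e" "\<And>s t. s \<le> t \<Longrightarrow> e * (\<theta> t - \<theta> s) \<le> x - \<alpha> s"
    using complete[of \<theta> N] comp inc by (auto simp: \<theta>_def[abs_def])
  have "e * (2 ^ i * (G i t - G i s)) \<le> x - \<alpha> s" if "s \<le> t" for i s t
  proof -
    \<comment> \<open>Term \<open>i\<close> enters the truncated sum only after stage
      \<open>i\<close>, hence the passage to a later stage.\<close>
    define t' where "t' = max t (Suc i)"
    have "2 ^ i * (G i t - G i s) \<le> 2 ^ i * (G i t' - G i s)"
      using mono[of t t' i] by (simp add: t'_def)
    also have "\<dots> \<le> \<theta> t' - \<theta> s" using that by (intro diff) (auto simp: t'_def)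
    finally have "e * (2 ^ i * (G i t - G i s)) \<le> e * (\<theta> t' - \<theta> s)"
      using e(1) by (intro mult_left_mono) auto
    also have "\<dots> \<le> x - \<alpha> s" using that by (intro e(2)) (auto simp: t'_def)
    finally show ?thesis .
  qed
  with e(1) show ?thesis by (rule that)
qed

end

section \<open>Oscillation of the ratio across two thresholds\<close>

locale crossing = solovay_complete +
  fixes a :: "nat \<Rightarrow> real" and A c d :: real
  assumes computable_a: "computable_real a"
    and mono_a: "incseq a"
    and lim_a: "a \<longlonglongrightarrow> A"
    and c: "0 < c" "computable_real (\<lambda>x. c)"
    and d: "c < d" "computable_real (\<lambda>x. d)"
    and good: "\<exists>\<^sub>F s in sequentially. A - a s < c * (x - \<alpha> s)"
    and bad: "\<exists>\<^sub>F s in sequentially. A - a s > d * (x - \<alpha> s)"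
begin

text \<open>\<open>h\<close> is below its limit iff the ratio exceeds \<open>d\<close>, and
  \<open>k\<close> is below its limit iff the ratio is less than \<open>c\<close>. Where
  \<open>h\<close> stays above its value at \<open>u\<close>, the growth of \<open>a\<close> since
  \<open>u\<close> is at least \<open>d\<close> times that of \<alpha>; where \<open>k\<close> does,
  it is at most \<open>c\<close> times that of \<alpha>.\<close>

definition "h s = a s - d * \<alpha> s"
definition "k s = c * \<alpha> s - a s"

text \<open>\<open>P j\<close> governs level \<open>Suc j\<close>, so \<open>k\<close> belongs to
  the odd levels and \<open>h\<close> to the even ones.\<close>

definition P :: "nat \<Rightarrow> nat \<Rightarrow> nat \<Rightarrow> nat \<Rightarrow> bool" where
  "P j N u v \<longleftrightarrow> (if even j then k v < k u else h v < h u)"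

lemma lim_h: "h \<longlonglongrightarrow> A - d * x"
  unfolding h_def[abs_def] by (intro tendsto_intros lim_a lim_\<alpha>)

lemma lim_k: "k \<longlonglongrightarrow> c * x - A"
  unfolding k_def[abs_def] by (intro tendsto_intros lim_a lim_\<alpha>)

lemma bad': "\<exists>s\<ge>N. h s < A - d * x"
  using bad unfolding h_def frequently_sequentially by (auto simp: algebra_simps) 

lemma good': "\<exists>s\<ge>N. k s < c * x - A"
  using good unfolding k_def frequently_sequentially by (auto simp: algebra_simps) 

text \<open>Starting where \<open>h\<close> is minimal from then on makes level 0 a window of the
  same kind as the later even levels.\<close>

definition "n0 = (SOME n. \<forall>t\<ge>n. h n \<le> h t)"

lemma n0: "n0 \<le> t \<Longrightarrow> h n0 \<le> h t"
proof -
  obtain s where "h s < A - d * x" using bad'[of 0] by blast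
  then obtain m where m: "\<And>t. h m \<le> h t"
    using attains_min[OF lim_h, of 0 s] by auto
  have "\<exists>n. \<forall>t\<ge>n. h n \<le> h t" using m by blast
  from someI_ex[OF this] show "n0 \<le> t \<Longrightarrow> h n0 \<le> h t" unfolding n0_def by blast
qed

text \<open>Even levels of the nest are windows on which h stays above its initial value, so that \<alpha> stays covered;
  odd levels are windows on which k does, so that a grows slowly. A restart costs nothing: only the growth of a
  inside the windows of depth 2n is counted.\<close>
definition "G n t = (\<Sum>t'<t. if n0 \<le> t' \<and> nest P n0 (2 * n) (Suc t') = nest P n0 (2 * n) t' then a (Suc t') - a t' else 0)"

lemma a_mono: "s \<le> t \<Longrightarrow> a s \<le> a t" and \<alpha>_mono: "s \<le> t \<Longrightarrow> \<alpha> s \<le> \<alpha> t"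
  using mono_a mono_\<alpha> by (auto dest: incseqD)

lemma G_mono: "s \<le> t \<Longrightarrow> G n s \<le> G n t"
  unfolding G_def by (intro sum_mono2) (auto simp: a_mono)

lemma G_nonneg: "0 \<le> G n t"
  unfolding G_def by (intro sum_nonneg) (auto simp: a_mono)

lemma G_n0: "t \<le> n0 \<Longrightarrow> G n t = 0"
  unfolding G_def by (intro sum.neutral) auto

lemma G_window:
  assumes "n0 \<le> t"
  shows "G n t = G n (nest P n0 (2 * n) t) + (a t - a (nest P n0 (2 * n) t))"
  using assms
proof (induction t rule: dec_induct)
  case base
  then show ?case using nest_bounds[of n0 n0 P] by (metis add.right_neutral diff_self dual_order.antisym order_refl)
next
  case (step t)
  consider "nest P n0 (2 * n) (Suc t) = nest P n0 (2 * n) t" | "nest P n0 (2 * n) (Suc t) = Suc t" "nest P n0 (2 * n) (Suc t) \<noteq> nest P n0 (2 * n) t"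
    using nest_step[OF step(1), of P "2 * n"] by blast
  then show ?case
  proof cases
    case 1
    then have "G n (Suc t) = G n t + (a (Suc t) - a t)" using step(1) by (simp add: G_def)
    then show ?thesis unfolding 1 using step by simp
  qed simp
qed

lemma h_window:
  assumes "n0 \<le> t" "nest P n0 (2 * n) t \<le> v" "v \<le> t"
  shows "h (nest P n0 (2 * n) t) \<le> h v"
proof (cases n)
  case 0
  then show ?thesis using n0 assms by simp
next
  case (Suc m)
  show ?thesis
  proof (cases "nest P n0 (2 * n) t = v")
    case False
    then have "\<not> P (2 * m + 1) (nest P n0 (2 * m + 1) t) (nest P n0 (Suc (2 * m + 1)) t) v"
      using assms Suc by (intro nest_untriggered) (auto simp del: nest.simps)
    then show ?thesis by (simp add: P_def Suc del: nest.simps)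
  qed simp
qed

lemma k_window:
  assumes "n0 \<le> t" "nest P n0 (Suc (2 * n)) t \<le> v" "v \<le> t"
  shows "k (nest P n0 (Suc (2 * n)) t) \<le> k v"
proof (cases "nest P n0 (Suc (2 * n)) t = v")
  case False
  then have "\<not> P (2 * n) (nest P n0 (2 * n) t) (nest P n0 (Suc (2 * n)) t) v"
    using assms by (intro nest_untriggered) (auto simp del: nest.simps)
  then show ?thesis by (simp add: P_def del: nest.simps)
qed simp

lemma d_pos: "0 < d" using c d by simp

text \<open>Let \<open>p\<close> and \<open>r\<close> be the current starts at levels 2n and 2n + 1.
  The first right side is a running account: finished odd windows since \<open>p\<close> are paid by
  \<open>c\<close> times the growth of \<alpha>, the open one by the growth of \<open>a\<close>, and
  everything before \<open>p\<close> by \<open>c / d * G n p\<close>. When \<open>r\<close> moves,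
  \<open>k\<close> converts growth of \<open>a\<close> into growth of \<alpha>; when
  \<open>p\<close> moves, \<open>h\<close> converts that into \<open>c / d\<close> times the growth
  of \<open>a\<close>.\<close>

lemma G_bound_aux:
  assumes "n0 \<le> t"
  shows "G (Suc n) t \<le> c * (\<alpha> (nest P n0 (Suc (2 * n)) t) - \<alpha> (nest P n0 (2 * n) t))
    + (a t - a (nest P n0 (Suc (2 * n)) t)) + c / d * G n (nest P n0 (2 * n) t)"
  and "G (Suc n) t \<le> c / d * G n t"
proof -
  have *: "c * (\<alpha> (nest P n0 (Suc (2 * n)) t) - \<alpha> (nest P n0 (2 * n) t))
    + (a t - a (nest P n0 (Suc (2 * n)) t)) + c / d * G n (nest P n0 (2 * n) t) \<le> c / d * G n t"
    and **: "a t - a (nest P n0 (Suc (2 * n)) t) \<le> c * (\<alpha> t - \<alpha> (nest P n0 (Suc (2 * n)) t))"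
    if "n0 \<le> t" for t
  proof -
    let ?p = "nest P n0 (2 * n) t" and ?r = "nest P n0 (Suc (2 * n)) t"
    have "k ?r \<le> k t" using nest_bounds[OF that] that by (intro k_window) (auto simp del: nest.simps)
    then show 1: "a t - a ?r \<le> c * (\<alpha> t - \<alpha> ?r)" by (simp add: k_def algebra_simps)
    have "h ?p \<le> h t" using nest_bounds[OF that] that by (intro h_window) auto
    then have "d * (\<alpha> t - \<alpha> ?p) \<le> a t - a ?p" by (simp add: h_def algebra_simps)
    then have "c / d * (d * (\<alpha> t - \<alpha> ?p)) \<le> c / d * (a t - a ?p)"
      using c d_pos by (intro mult_left_mono) auto
    then have "c * (\<alpha> t - \<alpha> ?p) \<le> c / d * (a t - a ?p)" using d_pos by simp
    then show "c * (\<alpha> ?r - \<alpha> ?p) + (a t - a ?r) + c / d * G n ?p \<le> c / d * G n t"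
      using 1 unfolding G_window[OF that, of n] by (simp add: algebra_simps)
  qed
  show 1: "G (Suc n) t \<le> c * (\<alpha> (nest P n0 (Suc (2 * n)) t) - \<alpha> (nest P n0 (2 * n) t))
    + (a t - a (nest P n0 (Suc (2 * n)) t)) + c / d * G n (nest P n0 (2 * n) t)"
    using assms
  proof (induction t rule: dec_induct)
    case base
    have "nest P n0 j n0 = n0" for j using nest_bounds[of n0 n0 P j] by auto
    then show ?case by (simp only: G_n0) simp
  next
    case (step t)
    let ?p = "nest P n0 (2 * n) t" and ?r = "nest P n0 (Suc (2 * n)) t"
    let ?p' = "nest P n0 (2 * n) (Suc t)" and ?r' = "nest P n0 (Suc (2 * n)) (Suc t)"
    have G: "G (Suc n) (Suc t) = G (Suc n) t + (if nest P n0 (Suc (Suc (2 * n))) (Suc t) = nest P n0 (Suc (Suc (2 * n))) t then a (Suc t) - a t else 0)"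
      using step(1) by (simp add: G_def del: nest.simps)
    show ?case
    proof (cases "?p' = ?p")
      case p: False
      then have p': "?p' = Suc t" using nest_step[OF step(1), of P "2 * n"] by blast
      then have r': "?r' = Suc t" using nest_Suc_Suc[OF step(1), of P "2 * n"] p by simp
      then have "?r' \<noteq> ?r" using nest_bounds(2)[OF step(1), of P "Suc (2 * n)"] by simp
      then have s': "nest P n0 (Suc (Suc (2 * n))) (Suc t) = Suc t"
        using nest_Suc_Suc[OF step(1), of P "Suc (2 * n)"] by presburger
      then have "G (Suc n) (Suc t) = G (Suc n) t"
        using G nest_bounds(2)[OF step(1), of P "Suc (Suc (2 * n))"] by simp
      also have "\<dots> \<le> c / d * G n t" using step *[OF step(1)] by simp
      also have "\<dots> \<le> c / d * G n (Suc t)" using c d_pos by (intro mult_left_mono G_mono) auto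
      finally show ?thesis unfolding p' r' by simp
    next
      case p: True
      show ?thesis
      proof (cases "?r' = ?r")
        case r: False
        then have r': "?r' = Suc t" using nest_step[OF step(1), of P "Suc (2 * n)"] by blast
        then have s': "nest P n0 (Suc (Suc (2 * n))) (Suc t) = Suc t"
          using nest_Suc_Suc[OF step(1), of P "Suc (2 * n)"] r by presburger
        then have "G (Suc n) (Suc t) = G (Suc n) t"
          using G nest_bounds(2)[OF step(1), of P "Suc (Suc (2 * n))"] by simp
        moreover have "a t - a ?r \<le> c * (\<alpha> (Suc t) - \<alpha> ?r)"
        proof -
          have "c * \<alpha> t \<le> c * \<alpha> (Suc t)" using c by (intro mult_left_mono \<alpha>_mono) auto
          then show ?thesis using **[OF step(1)] by (simp add: algebra_simps)
        qed
        ultimately show ?thesis unfolding p r' using step(3) by (simp add: algebra_simps)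
      next
        case r: True
        have "G (Suc n) (Suc t) \<le> G (Suc n) t + (a (Suc t) - a t)"
          unfolding G using a_mono[of t "Suc t"] by simp
        then show ?thesis unfolding p r using step(3) by simp
      qed
    qed
  qed
  then show "G (Suc n) t \<le> c / d * G n t" using *[OF assms] by linarith
qed

lemma G_bound: "G n t \<le> (c / d) ^ n * (A - a n0)"
proof (induction n)
  case 0
  show ?case
  proof (cases "n0 \<le> t")
    case True
    then have "G 0 t = a t - a n0" using G_window[of t 0] G_n0[of n0] by simp
    then show ?thesis using incseq_le[OF mono_a lim_a, of t] by simp
  next
    case False
    then show ?thesis using G_n0[of t 0] incseq_le[OF mono_a lim_a, of n0] by simp
  qed
next
  case (Suc n)
  have "G (Suc n) t \<le> c / d * G n t"
  proof (cases "n0 \<le> t")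
    case False
    then show ?thesis using G_n0[of t] by simp
  qed (rule G_bound_aux)
  also have "\<dots> \<le> c / d * ((c / d) ^ n * (A - a n0))"
    using c d_pos Suc by (intro mult_left_mono) auto
  finally show ?case by simp
qed

text \<open>After the final start \<open>s\<close> of level \<open>2 * (L * i)\<close> all growth of
  \<open>a\<close> counts in \<open>G\<close>, so completeness gives
  \<open>e * 2 ^ i * (A - a s) \<le> x - \<alpha> s\<close>. A later bad stage in the same window
  shows \<open>d * (x - \<alpha> s) < A - a s\<close>. The two are incompatible once
  \<open>2 ^ i > 1 / (e * d)\<close>.\<close>

lemma contradiction: False
proof -
  have q: "0 \<le> c / d" "c / d < 1" using c d d_pos by auto
  then have "\<forall>\<^sub>F n in sequentially. (c / d) ^ n < 1/4"
    by (intro order_tendstoD[OF LIMSEQ_realpow_zero]) auto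
  \<comment> \<open>Using only every \<open>L\<close>-th even level turns the decay rate
    \<open>c / d\<close> into the rate 1/4 that \<open>complete_family\<close> wants.\<close>
  then obtain L where L: "(c / d) ^ L < 1/4"
    by (auto dest: eventually_happens)
  have nest_comp: "computable (\<lambda>y. nest P n0 (F y) (T y))" if "computable F" "computable T" for F T
    unfolding P_def h_def k_def
    by (intro computable_nest that computable_intros decidable_even decidable_real_less computable_real_diff computable_real_mult
        c d computable_real_compose[OF computable_a] computable_real_compose[OF computable_\<alpha>]
       | simp only: if_bool_eq_conj)+
  have comp: "computable_real (\<lambda>t. \<Sum>i<t. 2 ^ i * G (L * i) t)"
    unfolding G_def
    by (intro computable_real_intros computable_intros nest_comp
        computable_real_compose[OF computable_a])
  have bound: "G (L * i) t \<le> (A - a n0) * (1/4) ^ i" for i t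
  proof -
    have "G (L * i) t \<le> ((c / d) ^ L) ^ i * (A - a n0)" using G_bound[of "L * i" t] by (simp add: power_mult)
    also have "\<dots> \<le> (1/4) ^ i * (A - a n0)"
      using q L incseq_le[OF mono_a lim_a, of n0] by (intro mult_right_mono power_mono) auto
    finally show ?thesis by (simp add: mult.commute)
  qed
  obtain e where e: "0 < e" "\<And>i s t. s \<le> t \<Longrightarrow> e * (2 ^ i * (G (L * i) t - G (L * i) s)) \<le> x - \<alpha> s"
    using complete_family[OF comp _ _ bound] G_mono G_nonneg by blast
  obtain i where i: "1 / (e * d) < 2 ^ i" using real_arch_pow[of 2 "1 / (e * d)"] by auto
  have "\<exists>u\<ge>n0. \<forall>\<^sub>F t in sequentially. nest P n0 (2 * (L * i)) t = u"
  proof (rule nest_converges)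
    fix j N
    show "\<exists>u. \<forall>\<^sub>F t in sequentially. chain (P j) N t = u"
    proof (cases "even j")
      case True
      then show ?thesis using good'[of N] chain_record_converges[of "P j" N k, OF _ lim_k] by (auto simp: P_def)
    next
      case False
      then show ?thesis using bad'[of N] chain_record_converges[of "P j" N h, OF _ lim_h] by (auto simp: P_def)
    qed
  qed
  then obtain s where s: "n0 \<le> s" "\<forall>\<^sub>F t in sequentially. nest P n0 (2 * (L * i)) t = s" by blast
  obtain b where b: "s \<le> b" "h b < A - d * x" using bad' by blast
  have ev: "\<forall>\<^sub>F t in sequentially. nest P n0 (2 * (L * i)) t = s \<and> b \<le> t"
    using s(2) by (intro eventually_conj eventually_ge_at_top)
  then obtain t where t: "nest P n0 (2 * (L * i)) t = s" "b \<le> t" by (auto dest: eventually_happens)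
  have "h s \<le> h b" using h_window[of t "L * i" b] t b s by simp
  then have 1: "d * (x - \<alpha> s) < A - a s" using b by (simp add: h_def algebra_simps)
  have "\<forall>\<^sub>F t in sequentially. e * (2 ^ i * (a t - a s)) \<le> x - \<alpha> s"
    using ev
  proof eventually_elim
    case (elim t)
    then have "a t - a s = G (L * i) t - G (L * i) s" using G_window[of t "L * i"] s b by simp
    then show ?case using e(2)[of s t i] elim b by simp
  qed
  moreover have "(\<lambda>t. e * (2 ^ i * (a t - a s))) \<longlonglongrightarrow> e * (2 ^ i * (A - a s))"
    by (intro tendsto_intros lim_a)
  ultimately have 2: "e * (2 ^ i * (A - a s)) \<le> x - \<alpha> s"
    by (intro tendsto_upperbound[where F = sequentially]) auto
  have "0 < A - a s" using 1 \<alpha>_le[of s] d_pos by (meson diff_ge_0_iff_ge dual_order.strict_trans2 less_imp_le mult_nonneg_nonneg)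
  then have "1 * (A - a s) < e * d * 2 ^ i * (A - a s)"
    using i e(1) d_pos by (intro mult_strict_right_mono) (auto simp: field_simps)
  also have "\<dots> = d * (e * (2 ^ i * (A - a s)))" by simp
  also have "\<dots> \<le> d * (x - \<alpha> s)" using 2 d_pos by (intro mult_left_mono) auto
  finally show False using 1 by simp
qed

end

subsection \<open>Approximations by additions and removals of whole items\<close>

locale item_game =
  fixes w :: "nat \<Rightarrow> real" and A B :: "nat \<Rightarrow> nat set"
  assumes w: "\<And>i. (1/2) ^ i \<le> w i"
    and mono_A: "\<And>s t. s \<le> t \<Longrightarrow> A s \<subseteq> A t"
    and mono_B: "\<And>s t. s \<le> t \<Longrightarrow> B s \<subseteq> B t"
    and B_sub_A: "\<And>t. B t \<subseteq> A t"
    and A_bound: "\<And>t. A t \<subseteq> {..<t}"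
    and w_bound: "\<And>t. sum w (A t) \<le> 1"
begin

definition "\<beta> t = sum w (A t - B t)"

definition "removed S t = sum w ((B (Suc t) - B t) \<inter> S)"

lemma w_nonneg: "0 \<le> w i"
  using w[of i] by (meson order_trans zero_le_divide_1_iff zero_le_numeral zero_le_power)

lemma finite_A [simp]: "finite (A t)"
  by (rule finite_subset[OF A_bound]) simp

lemma finite_B [simp]: "finite (B t)"
  by (rule finite_subset[OF B_sub_A]) simp

lemma removed_mono: "S \<subseteq> T \<Longrightarrow> removed S t \<le> removed T t"
  unfolding removed_def by (intro sum_mono2) (auto simp: w_nonneg)

lemma removed_nonneg: "0 \<le> removed S t"
  unfolding removed_def by (intro sum_nonneg w_nonneg)

lemma sum_removed_le: "(\<Sum>t\<in>{s..<s'}. removed S t) \<le> 1"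
proof -
  have "(\<Sum>t\<in>{s..<s'}. removed UNIV t) \<le> sum w (B s')"
  proof (induction s')
    case (Suc s')
    have "(\<Sum>t\<in>{s..<Suc s'}. removed UNIV t) \<le> (\<Sum>t\<in>{s..<s'}. removed UNIV t) + removed UNIV s'"
      using removed_nonneg by (cases "s \<le> s'") auto
    also have "\<dots> \<le> sum w (B s') + removed UNIV s'" using Suc by simp
    also have "\<dots> = sum w (B (Suc s'))"
      unfolding removed_def using mono_B[of s' "Suc s'"] by (simp add: sum_diff)
    finally show ?case .
  qed (simp add: sum_nonneg w_nonneg)
  also have "\<dots> \<le> sum w (A s')" by (intro sum_mono2 B_sub_A finite_A w_nonneg)
  also have "\<dots> \<le> 1" by (rule w_bound)
  finally have "(\<Sum>t\<in>{s..<s'}. removed UNIV t) \<le> 1" .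
  moreover have "(\<Sum>t\<in>{s..<s'}. removed S t) \<le> (\<Sum>t\<in>{s..<s'}. removed UNIV t)"
    by (intro sum_mono removed_mono) auto
  ultimately show ?thesis by simp
qed

text \<open>Items added after \<open>u\<close> contribute nonnegatively at \<open>v\<close>, even if
  some of them have been removed again, so only removals from \<open>A u\<close> can lower the
  value.\<close>

lemma drop_le_removed:
  assumes "u \<le> v"
  shows "\<beta> u - \<beta> v \<le> (\<Sum>t\<in>{u..<v}. removed (A u) t)"
proof -
  have "\<beta> u - sum w (A u - B v) \<le> (\<Sum>t\<in>{u..<v}. removed (A u) t)"
    using assms
  proof (induction v rule: dec_induct)
    case (step v)
    have "A u - B v = (A u - B (Suc v)) \<union> ((B (Suc v) - B v) \<inter> A u)"
      using mono_B[of v "Suc v"] by auto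
    then have "sum w (A u - B v) = sum w (A u - B (Suc v)) + removed (A u) v"
      unfolding removed_def by (simp add: sum.union_disjoint[symmetric] Int_commute Int_Diff)
        (subst sum.union_disjoint[symmetric], auto)
    then show ?case using step by simp
  qed (simp add: \<beta>_def)
  moreover have "sum w (A u - B v) \<le> \<beta> v"
    unfolding \<beta>_def using mono_A[OF assms] by (intro sum_mono2) (auto simp: w_nonneg)
  ultimately show ?thesis by simp
qed

lemma removed_pos:
  assumes "0 < (\<Sum>t\<in>{u..<v}. removed (A N) t)"
  shows "(1/2) ^ N \<le> (\<Sum>t\<in>{u..<v}. removed (A N) t)"
proof -
  obtain t where t: "t \<in> {u..<v}" "0 < removed (A N) t"
    using assms removed_nonneg by (metis (no_types, lifting) linorder_not_less sum_nonpos)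
  then obtain i where i: "i \<in> (B (Suc t) - B t) \<inter> A N"
    unfolding removed_def by (metis equals0I order_less_irrefl sum.empty)
  then have "i < N" using A_bound by auto
  then have "(1/2) ^ N \<le> (1/2 :: real) ^ i" by (intro power_decreasing) auto
  also have "\<dots> \<le> w i" by (rule w)
  also have "\<dots> \<le> removed (A N) t"
    unfolding removed_def using i by (intro member_le_sum) (auto simp: w_nonneg)
  also have "\<dots> \<le> (\<Sum>t\<in>{u..<v}. removed (A N) t)"
    using t by (intro member_le_sum removed_nonneg) auto
  finally show ?thesis .
qed

end

section \<open>The total length of nested runs\<close>

locale item_nest = item_game +
  fixes \<eta> \<kappa> :: real and n0 :: nat
  assumes \<eta>: "0 < \<eta>" and \<kappa>: "0 < \<kappa>"
begin

text \<open>The factor 2^-N matches the least possible removal from \<open>A N\<close> and makes the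
  sum over all possible starts at most 2\<kappa>.\<close>

definition "\<mu> N = \<kappa> * (1/2) ^ N"

definition P :: "nat \<Rightarrow> nat \<Rightarrow> nat \<Rightarrow> nat \<Rightarrow> bool" where
  "P j N u v \<longleftrightarrow> \<eta> * \<mu> N \<le> \<beta> u - \<beta> v"

text \<open>A run at level j + 1 lasts until the value has dropped by \<eta> \<mu>(N), where N is the start of the enclosing
  run at level j; C adds up the lengths \<mu>(N).\<close>
definition "C j t = (\<Sum>s<t. if n0 \<le> s \<and> nest P n0 (Suc j) s = s then \<mu> (nest P n0 j s) else 0)"

lemma \<mu>_pos: "0 < \<mu> N"
  using \<kappa> by (simp add: \<mu>_def)

lemma C_mono: "s \<le> t \<Longrightarrow> C j s \<le> C j t"
  unfolding C_def by (intro sum_mono2) (auto simp: less_imp_le[OF \<mu>_pos])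

lemma C_nonneg: "0 \<le> C j t"
  unfolding C_def by (intro sum_nonneg) (auto simp: less_imp_le[OF \<mu>_pos])

lemma C_Suc: "n0 \<le> s \<Longrightarrow> C j (Suc s) = C j s + (if nest P n0 (Suc j) s = s then \<mu> (nest P n0 j s) else 0)"
  by (simp add: C_def)

lemma C_n0: "C j n0 = 0"
  unfolding C_def by (intro sum.neutral) auto

lemma nest_n0: "nest P n0 j n0 = n0"
  using nest_bounds[of n0 n0 P j] by simp

text \<open>The sum of \<mu> over all stages up to \<open>u\<close>. It pays for runs that open only
  because an enclosing run restarts; as such restarts happen at distinct stages, the total stays
  below 2\<kappa>.\<close>

definition "budget u = \<kappa> * (\<Sum>n<Suc u. (1/2) ^ n)"

lemma budget_le: "budget u \<le> 2 * \<kappa>"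
proof -
  have "(\<Sum>n<Suc u. (1/2::real) ^ n) \<le> 2" by (simp add: geometric_sum)
  then show ?thesis unfolding budget_def using \<kappa> by (simp add: mult.commute)
qed

lemma budget_Suc: "budget u + \<mu> (Suc t) \<le> budget (Suc t)" if "u \<le> t"
proof -
  have "(\<Sum>n<Suc u. (1/2::real) ^ n) \<le> (\<Sum>n<Suc t. (1/2) ^ n)"
    using that by (intro sum_mono2) auto
  then have "budget u \<le> budget t" unfolding budget_def using \<kappa> by (intro mult_left_mono) auto
  then show ?thesis by (simp add: budget_def \<mu>_def algebra_simps)
qed

lemma not_dropped:
  assumes "n0 \<le> t" "nest P n0 (Suc j) t \<le> v" "v \<le> t"
  shows "\<beta> (nest P n0 (Suc j) t) - \<beta> v < \<eta> * \<mu> (nest P n0 j t)"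
proof (cases "nest P n0 (Suc j) t = v")
  case True
  then show ?thesis using \<eta> \<mu>_pos by simp
next
  case False
  then show ?thesis using nest_untriggered[OF assms(1), of P j v] assms by (simp add: P_def)
qed

text \<open>Let \<open>N\<close>, \<open>u\<close>, \<open>v\<close> be the current starts at levels
  j, j + 1, j + 2. Inside the run of \<open>u\<close>, each new run at level j + 2 costs a drop of
  \<open>\<eta> * \<mu> u\<close>, and these drops together stay below
  \<open>\<eta> * \<mu> N\<close>, which would end the run of \<open>u\<close>. So
  \<open>C (Suc j)\<close> grows there by at most the \<open>\<mu> N\<close> that \<open>C j\<close>
  booked for this run, plus \<open>\<mu> u\<close> for the first subrun, taken from the budget.
  Subtracting \<open>\<mu> N\<close> keeps the booking of the open run unspent.\<close>

lemma C_Suc_le_aux: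
  assumes "n0 \<le> t"
  shows "\<eta> * C (Suc j) (Suc t) \<le> \<eta> * (C j (Suc t) - \<mu> (nest P n0 j t))
    + (\<beta> (nest P n0 (Suc j) t) - \<beta> (nest P n0 (Suc (Suc j)) t)) + \<eta> * budget (nest P n0 (Suc j) t)"
  using assms
proof (induction t rule: dec_induct)
  case base
  have "\<mu> n0 \<le> budget n0"
    unfolding \<mu>_def budget_def using \<kappa> by (intro mult_left_mono) (auto intro: sum_nonneg)
  then show ?case using \<eta> by (simp add: C_Suc C_n0 nest_n0 del: nest.simps)
next
  case (step t)
  let ?N = "nest P n0 j t" and ?u = "nest P n0 (Suc j) t" and ?v = "nest P n0 (Suc (Suc j)) t"
  let ?N' = "nest P n0 j (Suc t)" and ?u' = "nest P n0 (Suc j) (Suc t)" and ?v' = "nest P n0 (Suc (Suc j)) (Suc t)"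
  note le = nest_bounds(2)[OF step(1), of P]
  note S = nest_Suc_Suc[OF step(1), of P "Suc j"] nest_Suc_Suc[OF step(1), of P j]
  have t: "n0 \<le> Suc t" using step(1) by simp
  show ?case
  proof (cases "?u' = ?u")
    case True
    then have N: "?N' = ?N" using S(2) le[of "Suc j"] by (metis Suc_n_not_le_n)
    have C: "C j (Suc (Suc t)) = C j (Suc t)"
      using True le[of "Suc j"] unfolding C_Suc[OF t] by (simp del: nest.simps)
    show ?thesis
    proof (cases "?v' = ?v")
      case v: True
      then have "C (Suc j) (Suc (Suc t)) = C (Suc j) (Suc t)"
        using le[of "Suc (Suc j)"] unfolding C_Suc[OF t, of "Suc j"] by (simp del: nest.simps)
      then show ?thesis unfolding True v N C using step by simp
    next
      case v: False
      then have v': "?v' = Suc t" "P (Suc j) ?u ?v (Suc t)" using S(1) True by (auto split: if_splits simp del: nest.simps)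
      then have "C (Suc j) (Suc (Suc t)) = C (Suc j) (Suc t) + \<mu> ?u"
        using True unfolding C_Suc[OF t, of "Suc j"] by (simp del: nest.simps)
      moreover have "\<eta> * \<mu> ?u \<le> \<beta> ?v - \<beta> (Suc t)"
        using v'(2) unfolding P_def .
      ultimately show ?thesis
        unfolding True v' N C using step(3) by (simp add: algebra_simps del: nest.simps)
    qed
  next
    case False
    then have u': "?u' = Suc t" using nest_step[OF step(1), of P "Suc j"] by blast
    then have v': "?v' = Suc t" using S(1) False by (simp del: nest.simps)
    have C: "C j (Suc (Suc t)) = C j (Suc t) + \<mu> ?N'"
      using u' unfolding C_Suc[OF t] by (simp del: nest.simps)
    have C': "C (Suc j) (Suc (Suc t)) = C (Suc j) (Suc t) + \<mu> (Suc t)"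
      using u' v' unfolding C_Suc[OF t, of "Suc j"] by (simp del: nest.simps)
    have "\<beta> ?u - \<beta> ?v < \<eta> * \<mu> ?N"
      using le[of "Suc (Suc j)"] nest_le_Suc[OF step(1), of P "Suc j"] by (intro not_dropped step)
    then have "\<eta> * C (Suc j) (Suc t) \<le> \<eta> * C j (Suc t) + \<eta> * budget ?u"
      using step(3) by (simp add: algebra_simps del: nest.simps)
    moreover have "\<eta> * (budget ?u + \<mu> (Suc t)) \<le> \<eta> * budget (Suc t)"
      using \<eta> le[of "Suc j"] by (intro mult_left_mono budget_Suc) auto
    ultimately show ?thesis unfolding u' v' C C' by (simp add: algebra_simps del: nest.simps)
  qed
qed

lemma C_Suc_le: "C (Suc j) t \<le> C j t + 2 * \<kappa>"
proof (cases "n0 < t")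
  case True
  then obtain s where s: "t = Suc s" "n0 \<le> s" by (cases t) auto
  have "\<beta> (nest P n0 (Suc j) s) - \<beta> (nest P n0 (Suc (Suc j)) s) < \<eta> * \<mu> (nest P n0 j s)"
    using nest_bounds(2)[OF s(2), of P "Suc (Suc j)"] nest_le_Suc[OF s(2), of P "Suc j"] by (intro not_dropped s)
  then have "\<eta> * C (Suc j) (Suc s) \<le> \<eta> * C j (Suc s) + \<eta> * budget (nest P n0 (Suc j) s)"
    using C_Suc_le_aux[OF s(2), of j] by (simp add: algebra_simps del: nest.simps)
  then have "\<eta> * C (Suc j) (Suc s) \<le> \<eta> * (C j (Suc s) + budget (nest P n0 (Suc j) s))"
    by (simp add: algebra_simps)
  then have "C (Suc j) (Suc s) \<le> C j (Suc s) + budget (nest P n0 (Suc j) s)"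
    using \<eta> by simp
  then show ?thesis unfolding s using budget_le[of "nest P n0 (Suc j) s"] by linarith
next
  case False
  then have "C (Suc j) t \<le> C (Suc j) n0" by (intro C_mono) auto
  then show ?thesis using C_nonneg[of j t] \<kappa> by (simp add: C_n0)
qed

lemma C_add_le: "C (j + i) t \<le> C j t + 2 * \<kappa> * real i"
proof (induction i)
  case (Suc i)
  then show ?case using C_Suc_le[of "j + i" t] by (simp add: algebra_simps)
qed simp

text \<open>Removals of items known at the start of the current run at level j + 1 but not at the start of the enclosing
  run. These classes are disjoint for different j, which is where the gain of a factor d comes from.\<close>
definition "cls j s t = (\<Sum>r\<in>{s..<t}. removed (A (nest P n0 (Suc j) r)) r - removed (A (nest P n0 j r)) r)"

text \<open>Removals of items known already at \<open>N\<close> enter with the tiny factor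
  \<open>\<eta> * \<kappa>\<close>: as a single one weighs at least 2^-N, it still covers
  \<open>\<eta> * \<mu> N\<close>. The discounted part therefore stays negligible when summed over
  all stages.\<close>

definition "charge N u r = (removed (A u) r - removed (A N) r) + \<eta> * \<kappa> * removed (A N) r"

lemma charge_nonneg: "N \<le> u \<Longrightarrow> 0 \<le> charge N u r"
  unfolding charge_def using removed_mono[OF mono_A, of N u r] removed_nonneg \<eta> \<kappa>
  by (intro add_nonneg_nonneg mult_nonneg_nonneg) auto

text \<open>A run ended by a drop is paid by the removals during it: either one of them hits
  \<open>A N\<close>, and the discounted part suffices, or all of them fall into the class between
  \<open>N\<close> and \<open>u\<close>. The sum on the left holds back the charges of the open run
  until it ends. Runs opened by a restart of level \<open>j\<close> are paid by the budget.\<close>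

lemma C_le_charge_aux:
  assumes "n0 \<le> t"
  shows "\<eta> * C j (Suc t) + (\<Sum>r\<in>{nest P n0 (Suc j) t..<t}. charge (nest P n0 j t) (nest P n0 (Suc j) t) r)
    \<le> (\<Sum>r\<in>{n0..<t}. charge (nest P n0 j r) (nest P n0 (Suc j) r) r) + \<eta> * budget (nest P n0 j t)"
  using assms
proof (induction t rule: dec_induct)
  case base
  have "\<mu> n0 \<le> budget n0"
    unfolding \<mu>_def budget_def using \<kappa> by (intro mult_left_mono) (auto intro: sum_nonneg)
  then show ?case using \<eta> by (simp add: C_Suc C_n0 nest_n0 del: nest.simps)
next
  case (step t)
  let ?N = "nest P n0 j t" and ?u = "nest P n0 (Suc j) t"
  let ?N' = "nest P n0 j (Suc t)" and ?u' = "nest P n0 (Suc j) (Suc t)"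
  let ?S = "\<Sum>r\<in>{n0..<t}. charge (nest P n0 j r) (nest P n0 (Suc j) r) r"
  note le = nest_bounds(2)[OF step(1), of P]
  note S = nest_Suc_Suc[OF step(1), of P j]
  have t: "n0 \<le> Suc t" using step(1) by simp
  have sum: "(\<Sum>r\<in>{n0..<Suc t}. charge (nest P n0 j r) (nest P n0 (Suc j) r) r) = ?S + charge ?N ?u t"
    using step(1) by (simp del: nest.simps)
  have Nu: "?N \<le> ?u" using step(1) by (rule nest_le_Suc)
  have sum': "(\<Sum>r\<in>{?u..<Suc t}. charge ?N ?u r) = (\<Sum>r\<in>{?u..<t}. charge ?N ?u r) + charge ?N ?u t"
    using le[of "Suc j"] by (simp del: nest.simps)
  show ?case
  proof (cases "?u' = ?u")
    case True
    then have N: "?N' = ?N" using S le[of "Suc j"] by (metis Suc_n_not_le_n)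
    have C: "C j (Suc (Suc t)) = C j (Suc t)"
      using True le[of "Suc j"] unfolding C_Suc[OF t] by (simp del: nest.simps)
    show ?thesis unfolding True N C sum sum' using step(3) by simp
  next
    case False
    then have u': "?u' = Suc t" using nest_step[OF step(1), of P "Suc j"] by blast
    have C: "C j (Suc (Suc t)) = C j (Suc t) + \<mu> ?N'"
      using u' unfolding C_Suc[OF t] by (simp del: nest.simps)
    have base: "\<eta> * C j (Suc t) + (\<Sum>r\<in>{?u..<Suc t}. charge ?N ?u r) \<le> ?S + charge ?N ?u t + \<eta> * budget ?N"
      unfolding sum' using step(3) by simp
    show ?thesis
    proof (cases "?N' = ?N")
      case N: True
      then have "P j ?N ?u (Suc t)" using S False by (auto split: if_splits simp del: nest.simps)
      then have "\<eta> * \<mu> ?N \<le> \<beta> ?u - \<beta> (Suc t)" by (simp add: P_def)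
      also have "\<dots> \<le> (\<Sum>r\<in>{?u..<Suc t}. removed (A ?u) r)"
        using le[of "Suc j"] by (intro drop_le_removed) (simp del: nest.simps)
      finally have D: "\<eta> * \<mu> ?N \<le> (\<Sum>r\<in>{?u..<Suc t}. removed (A ?u) r)" .
      let ?Do = "\<Sum>r\<in>{?u..<Suc t}. removed (A ?N) r"
      have ch: "(\<Sum>r\<in>{?u..<Suc t}. charge ?N ?u r) = ((\<Sum>r\<in>{?u..<Suc t}. removed (A ?u) r) - ?Do) + \<eta> * \<kappa> * ?Do"
        unfolding charge_def sum.distrib sum_subtractf sum_distrib_left ..
      have "\<eta> * \<mu> ?N \<le> (\<Sum>r\<in>{?u..<Suc t}. charge ?N ?u r)"
      proof (cases "0 < ?Do")
        case True
        have "\<eta> * \<kappa> * (1/2) ^ ?N \<le> \<eta> * \<kappa> * ?Do"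
          using \<eta> \<kappa> by (intro mult_left_mono removed_pos True) auto
        moreover have "?Do \<le> (\<Sum>r\<in>{?u..<Suc t}. removed (A ?u) r)"
          by (intro sum_mono removed_mono mono_A Nu)
        ultimately show ?thesis unfolding ch \<mu>_def by (simp add: mult.assoc)
      next
        case False
        then have "?Do = 0" using sum_nonneg[of "{?u..<Suc t}" "removed (A ?N)"] removed_nonneg by (metis order_antisym_conv not_less)
        then show ?thesis unfolding ch using D by simp
      qed
      then show ?thesis unfolding u' N C sum using base by (simp add: algebra_simps del: nest.simps)
    next
      case N: False
      then have N': "?N' = Suc t" using nest_step[OF step(1), of P j] by blast
      have "\<eta> * (budget ?N + \<mu> (Suc t)) \<le> \<eta> * budget (Suc t)"
        using \<eta> le[of j] by (intro mult_left_mono budget_Suc) auto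
      moreover have "0 \<le> (\<Sum>r\<in>{?u..<Suc t}. charge ?N ?u r)"
        by (intro sum_nonneg charge_nonneg Nu)
      ultimately show ?thesis unfolding u' N' C sum using base by (simp add: algebra_simps del: nest.simps)
    qed
  qed
qed

lemma C_le_cls:
  assumes "n0 \<le> t"
  shows "\<eta> * C j (Suc t) \<le> cls j n0 t + 3 * \<eta> * \<kappa>"
proof -
  have "0 \<le> (\<Sum>r\<in>{nest P n0 (Suc j) t..<t}. charge (nest P n0 j t) (nest P n0 (Suc j) t) r)"
    by (intro sum_nonneg charge_nonneg nest_le_Suc assms)
  then have "\<eta> * C j (Suc t) \<le> (\<Sum>r\<in>{n0..<t}. charge (nest P n0 j r) (nest P n0 (Suc j) r) r) + \<eta> * budget (nest P n0 j t)"
    using C_le_charge_aux[OF assms, of j] by linarith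
  also have "(\<Sum>r\<in>{n0..<t}. charge (nest P n0 j r) (nest P n0 (Suc j) r) r) =
      cls j n0 t + \<eta> * \<kappa> * (\<Sum>r\<in>{n0..<t}. removed (A (nest P n0 j r)) r)"
    unfolding cls_def charge_def by (simp add: sum.distrib sum_distrib_left del: nest.simps)
  also have "(\<Sum>r\<in>{n0..<t}. removed (A (nest P n0 j r)) r) \<le> 1"
    by (rule order_trans[OF sum_mono[OF removed_mono[of _ UNIV]] sum_removed_le]) auto
  also have "\<eta> * budget (nest P n0 j t) \<le> \<eta> * (2 * \<kappa>)"
    using \<eta> by (intro mult_left_mono budget_le) auto
  finally show ?thesis using \<eta> \<kappa> by (simp add: mult_left_mono algebra_simps)
qed

text \<open>At each stage the sum over \<open>j\<close> telescopes to removals counted at level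
  \<open>d\<close> minus those counted at level 0.\<close>

lemma sum_cls_le: "(\<Sum>j<d. cls j n0 t) \<le> 1"
proof -
  have "(\<Sum>j<d. cls j n0 t) = (\<Sum>r\<in>{n0..<t}. removed (A (nest P n0 d r)) r - removed (A (nest P n0 0 r)) r)"
    unfolding cls_def
    by (subst sum.swap) (intro sum.cong refl sum_lessThan_telescope[of "\<lambda>j. removed (A (nest P n0 j _)) _"])
  also have "\<dots> \<le> (\<Sum>r\<in>{n0..<t}. removed UNIV r)"
  proof (rule sum_mono)
    fix r
    show "removed (A (nest P n0 d r)) r - removed (A (nest P n0 0 r)) r \<le> removed UNIV r"
      using removed_nonneg[of "A (nest P n0 0 r)" r] removed_mono[of "A (nest P n0 d r)" UNIV r] by simp
  qed
  also have "\<dots> \<le> 1" by (rule sum_removed_le)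
  finally show ?thesis .
qed

text \<open>Averaging over the levels below \<open>d\<close>: each \<open>C j\<close> bounds
  \<open>C d\<close> up to 2\<kappa>d, and the classes share a total removal of at most 1, which
  leaves \<open>1 / (\<eta> * d)\<close> for the average level.\<close>

lemma C_bound:
  assumes "0 < d"
  shows "C d t \<le> 1 / (\<eta> * real d) + 3 * \<kappa> + 2 * \<kappa> * real d"
proof -
  have "C d t \<le> C d (Suc (max n0 t))" by (intro C_mono) auto
  define T where "T = max n0 t"
  have "real d * C d (Suc T) = (\<Sum>j<d. C d (Suc T))" by simp
  also have "\<dots> \<le> (\<Sum>j<d. cls j n0 T / \<eta> + 3 * \<kappa> + 2 * \<kappa> * real d)"
  proof (rule sum_mono)
    fix j assume "j \<in> {..<d}"
    then have "C d (Suc T) \<le> C j (Suc T) + 2 * \<kappa> * real (d - j)"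
      using C_add_le[of j "d - j" "Suc T"] by simp
    also have "2 * \<kappa> * real (d - j) \<le> 2 * \<kappa> * real d" using \<kappa> by simp
    also have "C j (Suc T) \<le> cls j n0 T / \<eta> + 3 * \<kappa>"
      using C_le_cls[of T j] \<eta> unfolding T_def by (simp add: field_simps)
    finally show "C d (Suc T) \<le> cls j n0 T / \<eta> + 3 * \<kappa> + 2 * \<kappa> * real d" by simp
  qed
  also have "\<dots> = (\<Sum>j<d. cls j n0 T) / \<eta> + real d * (3 * \<kappa> + 2 * \<kappa> * real d)"
    by (simp add: sum.distrib sum_divide_distrib algebra_simps)
  also have "\<dots> \<le> 1 / \<eta> + real d * (3 * \<kappa> + 2 * \<kappa> * real d)"
    using sum_cls_le[where d = d and t = T] \<eta> by (simp add: divide_right_mono)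
  also have "\<dots> = real d * (1 / (\<eta> * real d) + 3 * \<kappa> + 2 * \<kappa> * real d)"
    using assms by (simp add: field_simps)
  finally have "C d (Suc T) \<le> 1 / (\<eta> * real d) + 3 * \<kappa> + 2 * \<kappa> * real d"
    using assms by simp
  then show ?thesis using \<open>C d t \<le> C d (Suc (max n0 t))\<close> unfolding T_def by simp
qed

end

section \<open>Impossibility of a steady drop\<close>

context solovay_complete
begin

text \<open>Let \<open>N\<close> and \<open>u\<close> be the final starts at levels
  \<open>d i\<close> and \<open>Suc (d i)\<close>. At \<open>u\<close>, \<open>C\<close> grows by
  \<open>\<mu> N\<close>, so \<alpha> still has to rise by \<open>e * 2 ^ i * \<mu> N\<close>, and
  by hypothesis the value has to fall by \<eta> times that. But the final run is never ended by a
  drop, so the fall is at most \<open>\<eta> * \<mu> N\<close>.\<close>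

lemma no_steady_drop:
  assumes game: "item_game w A B"
    and comp: "computable_real (item_game.\<beta> w A B)"
    and lim: "item_game.\<beta> w A B \<longlonglongrightarrow> b"
    and drop: "\<And>n. n0 \<le> n \<Longrightarrow> (1/2) ^ h * (x - \<alpha> n) \<le> item_game.\<beta> w A B n - b"
  shows False
proof -
  interpret item_game w A B by (rule game)
  define \<eta> :: real where "\<eta> = (1/2) ^ h"
  have \<eta>: "0 < \<eta>" by (simp add: \<eta>_def)
  \<comment> \<open>Chosen with \<open>d\<close> below so that \<open>1 / (\<eta> * d i)\<close> and
    \<open>\<kappa> i * d i\<close> both equal 4^-i; then the three terms of \<open>C_bound\<close>
    add up to at most 6 * 4^-i.\<close>
  define \<kappa> :: "nat \<Rightarrow> real" where "\<kappa> i = (1/2) ^ (h + 4 * i)" for i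
  define d :: "nat \<Rightarrow> nat" where "d i = 2 ^ (h + 2 * i)" for i
  have nest: "item_nest w A B \<eta> (\<kappa> i)" for i
    by unfold_locales (auto simp: \<eta> \<kappa>_def)
  define P where "P i = item_nest.P w A B \<eta> (\<kappa> i)" for i
  define C where "C i t = item_nest.C w A B \<eta> (\<kappa> i) n0 (d i) t" for i t
  define \<mu> where "\<mu> i N = \<kappa> i * (1/2) ^ N" for i N
  have P: "P i j N u v \<longleftrightarrow> \<eta> * \<mu> i N \<le> \<beta> u - \<beta> v" for i j N u v
    unfolding P_def \<mu>_def item_nest.P_def[OF nest] item_nest.\<mu>_def[OF nest] ..
  have C: "C i t = (\<Sum>s<t. if n0 \<le> s \<and> nest (P i) n0 (Suc (d i)) s = s then \<mu> i (nest (P i) n0 (d i) s) else 0)" for i t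
    unfolding C_def P_def \<mu>_def item_nest.C_def[OF nest] item_nest.\<mu>_def[OF nest] ..
  have C_mono: "s \<le> t \<Longrightarrow> C i s \<le> C i t" for i s t
    unfolding C_def by (rule item_nest.C_mono[OF nest])
  have C_nonneg: "0 \<le> C i t" for i t
    unfolding C_def by (rule item_nest.C_nonneg[OF nest])
  have C_bound: "C i t \<le> 6 * (1/4) ^ i" for i t
  proof -
    have "C i t \<le> 1 / (\<eta> * real (d i)) + 3 * \<kappa> i + 2 * \<kappa> i * real (d i)"
      unfolding C_def by (intro item_nest.C_bound[OF nest]) (simp add: d_def)
    also have "1 / (\<eta> * real (d i)) = (1/4) ^ i"
      by (simp add: \<eta>_def d_def power_add power_divide power_mult power_mult_distrib[symmetric])
    also have "\<kappa> i * real (d i) = (1/4) ^ i"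
    proof -
      have "(2::real) ^ (4 * i) = 4 ^ i * 4 ^ i" "(2::real) ^ (2 * i) = 4 ^ i"
        by (simp_all add: power_mult power_mult_distrib[symmetric])
      then show ?thesis
        by (simp add: \<kappa>_def d_def power_add power_divide)
    qed
    then have "2 * \<kappa> i * real (d i) = 2 * (1/4) ^ i" by simp
    also have "\<kappa> i \<le> (1/4) ^ i"
    proof -
      have "\<kappa> i \<le> (1/2) ^ (2 * i)" unfolding \<kappa>_def by (intro power_decreasing) auto
      then show ?thesis by (simp add: power_mult power_divide)
    qed
    finally show ?thesis by simp
  qed
  have nest_comp: "computable (\<lambda>y. nest (P (F y)) n0 (G y) (T y))"
    if "computable F" "computable G" "computable T" for F G T
    unfolding P \<mu>_def \<kappa>_def \<eta>_def
    by (intro computable_nest computable_intros computable_real_intros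
        computable_compose[OF that(1)] that computable_real_compose[OF comp])
  have comp': "computable_real (\<lambda>t. \<Sum>i<t. 2 ^ i * C i t)"
    unfolding C d_def \<mu>_def \<kappa>_def
    by (intro computable_real_intros computable_intros nest_comp)
  obtain e where e: "0 < e" "\<And>i s t. s \<le> t \<Longrightarrow> e * (2 ^ i * (C i t - C i s)) \<le> x - \<alpha> s"
    using complete_family[OF comp' _ _ C_bound] C_mono C_nonneg by blast
  obtain i where i: "1 / e < 2 ^ i" using real_arch_pow[of 2 "1 / e"] by auto
  have \<mu>_pos: "0 < \<mu> i N" for N by (simp add: \<mu>_def \<kappa>_def)
  have conv: "\<exists>u\<ge>n0. \<forall>\<^sub>F t in sequentially. nest (P i) n0 j t = u" for j
  proof (rule nest_converges)
    fix j N
    \<comment> \<open>For a fixed base the required drop is fixed, and a convergent sequence makes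
      no such drop between late stages.\<close>
    have "\<forall>\<^sub>F t in sequentially. b - \<eta> * \<mu> i N / 2 < \<beta> t \<and> \<beta> t < b + \<eta> * \<mu> i N / 2"
      using lim \<eta> \<mu>_pos[of N] by (intro eventually_conj order_tendstoD) auto
    then obtain T where "\<And>t. T \<le> t \<Longrightarrow> b - \<eta> * \<mu> i N / 2 < \<beta> t \<and> \<beta> t < b + \<eta> * \<mu> i N / 2"
      unfolding eventually_sequentially by blast
    then have "\<not> P i j N u v" if "T \<le> u" "u < v" for u v
      using that by (smt (verit) P field_sum_of_halves less_imp_le order_trans)
    then show "\<exists>u. \<forall>\<^sub>F t in sequentially. chain (P i j) N t = u"
      by (rule chain_eventually_untriggered_converges)
  qed
  obtain N where N: "n0 \<le> N" "\<forall>\<^sub>F t in sequentially. nest (P i) n0 (d i) t = N" using conv by blast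
  obtain u where u: "n0 \<le> u" "\<forall>\<^sub>F t in sequentially. nest (P i) n0 (Suc (d i)) t = u" using conv by blast
  have ev: "\<forall>\<^sub>F t in sequentially. nest (P i) n0 (d i) t = N \<and> nest (P i) n0 (Suc (d i)) t = u \<and> u < t"
    using N(2) u(2) by (intro eventually_conj eventually_gt_at_top)
  then obtain t where t: "nest (P i) n0 (d i) t = N" "nest (P i) n0 (Suc (d i)) t = u" "u < t"
    by (auto dest: eventually_happens)
  have nt: "n0 \<le> t" using t u by simp
  have Nu: "N \<le> u" using nest_le_Suc[OF nt, of "P i" "d i"] t by simp
  have "nest (P i) n0 (Suc (d i)) u = u" using nest_nest[OF nt, of "P i" "Suc (d i)"] t by simp
  moreover have "nest (P i) n0 (d i) u = N"
    using nest_stable[OF u(1), of "P i" "d i" t] t Nu by simp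
  ultimately have "C i (Suc u) = C i u + \<mu> i N" unfolding C using u(1) by (simp del: nest.simps)
  then have "\<mu> i N \<le> C i t - C i u" using C_mono[of "Suc u" t i] t by simp
  then have "2 ^ i * \<mu> i N \<le> 2 ^ i * (C i t - C i u)" by (intro mult_left_mono) auto
  then have "e * (2 ^ i * \<mu> i N) \<le> e * (2 ^ i * (C i t - C i u))" using e(1) by (intro mult_left_mono) auto
  also have "\<dots> \<le> x - \<alpha> u" using t by (intro e(2)) simp
  finally have "\<eta> * (e * (2 ^ i * \<mu> i N)) \<le> \<eta> * (x - \<alpha> u)" using \<eta> by (intro mult_left_mono) auto
  also have "\<dots> \<le> \<beta> u - b" using drop[OF u(1)] by (simp add: \<eta>_def)
  also have "\<dots> \<le> \<eta> * \<mu> i N"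
  proof (rule tendsto_upperbound[where F = sequentially])
    show "(\<lambda>v. \<beta> u - \<beta> v) \<longlonglongrightarrow> \<beta> u - b" by (intro tendsto_intros lim)
    show "\<forall>\<^sub>F v in sequentially. \<beta> u - \<beta> v \<le> \<eta> * \<mu> i N"
      using ev
    proof eventually_elim
      case (elim v)
      then have "\<not> P i (d i) N u v" using nest_untriggered[of n0 v "P i" "d i" v] u by auto
      then show ?case unfolding P by simp
    qed
  qed simp
  finally have "e * 2 ^ i * (\<eta> * \<mu> i N) \<le> 1 * (\<eta> * \<mu> i N)" by (simp add: algebra_simps)
  then have "e * 2 ^ i \<le> 1" using \<eta> \<mu>_pos[of N] by (subst (asm) mult_le_cancel_right_pos) auto
  then show False using i e(1) by (simp add: field_simps)
qed

end

lemma dyadic_between: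
  fixes a b :: real
  assumes "0 \<le> a" "a < b"
  obtains c where "a < c" "c < b" "computable_real (\<lambda>_. c)"
proof -
  obtain n where n: "1 / (b - a) < 2 ^ n" using real_arch_pow[of 2 "1 / (b - a)"] by auto
  then have n': "1 < (b - a) * 2 ^ n" using assms by (simp add: field_simps)
  define m where "m = nat \<lfloor>a * 2 ^ n\<rfloor> + 1"
  have "real m = of_int \<lfloor>a * 2 ^ n\<rfloor> + 1" using assms by (simp add: m_def)
  then have m: "a * 2 ^ n < real m" "real m \<le> a * 2 ^ n + 1" by linarith+
  have "a < real m * (1/2) ^ n" "real m * (1/2) ^ n < b"
    using m n' by (auto simp: field_simps power_divide)
  moreover have "computable_real (\<lambda>_. real m * (1/2) ^ n)"
    by (intro computable_real_intros computable_intros)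
  ultimately show ?thesis by (rule that)
qed

section \<open>Existence and sign of the derivative relative to \<alpha>\<close>

context solovay_complete
begin

text \<open>Completeness applied to a \<theta> that never stops growing. This makes the denominators
  of the ratios positive.\<close>

lemma \<alpha>_less: "\<alpha> s < x"
proof -
  define \<theta> :: "nat \<Rightarrow> real" where "\<theta> t = 1 - (1/2) ^ t" for t
  have "computable_real \<theta>"
    unfolding \<theta>_def[abs_def] by (intro computable_real_intros computable_intros)
  moreover have "incseq \<theta>" unfolding \<theta>_def by (intro incseq_SucI) simp
  ultimately obtain c where c: "0 < c" "\<And>s t. s \<le> t \<Longrightarrow> c * (\<theta> t - \<theta> s) \<le> x - \<alpha> s"
    using complete[of \<theta> 1] by (auto simp: \<theta>_def)
  have "0 < c * (\<theta> (Suc s) - \<theta> s)" using c(1) by (simp add: \<theta>_def)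
  also have "\<dots> \<le> x - \<alpha> s" by (rule c(2)) simp
  finally show ?thesis by simp
qed

lemma dominates:
  assumes "computable_real a" "incseq a" "a \<longlonglongrightarrow> A"
  obtains K where "\<And>s. A - a s \<le> K * (x - \<alpha> s)"
proof -
  define \<theta> where "\<theta> t = a t - a 0" for t
  have "computable_real \<theta>"
    unfolding \<theta>_def[abs_def]
    by (intro computable_real_intros computable_intros computable_real_compose[OF assms(1)] assms(1))
  moreover have "incseq \<theta>" using assms(2) by (auto simp: \<theta>_def incseq_def)
  moreover obtain K where "A - a 0 \<le> real K" using real_arch_simple by blast
  then have "\<theta> t \<le> real K" for t
    using incseq_le[OF assms(2,3), of t] by (simp add: \<theta>_def)
  ultimately obtain c where c: "0 < c" "\<And>s t. s \<le> t \<Longrightarrow> c * (\<theta> t - \<theta> s) \<le> x - \<alpha> s"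
    using complete[of \<theta> K] by (auto simp: \<theta>_def)
  have "A - a s \<le> 1 / c * (x - \<alpha> s)" for s
  proof -
    have "c * (A - a s) \<le> x - \<alpha> s"
    proof (rule tendsto_upperbound[where F = sequentially])
      show "(\<lambda>t. c * (a t - a s)) \<longlonglongrightarrow> c * (A - a s)" by (intro tendsto_intros assms)
      show "\<forall>\<^sub>F t in sequentially. c * (a t - a s) \<le> x - \<alpha> s"
        using eventually_ge_at_top[of s] by eventually_elim (use c(2) in \<open>auto simp: \<theta>_def\<close>)
    qed simp
    then show ?thesis using c(1) by (simp add: field_simps)
  qed
  then show ?thesis by (rule that)
qed

text \<open>Boundedness gives a limit point \<open>l\<close>. If the ratio does not tend to
  \<open>l\<close>, it keeps returning to the far side of some \<open>y \<noteq> l\<close>, and two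
  dyadic numbers between \<open>y\<close> and \<open>l\<close> are the thresholds of a
  crossing.\<close>

lemma ratio_converges:
  assumes "computable_real a" "incseq a" "a \<longlonglongrightarrow> A"
  shows "\<exists>l. (\<lambda>s. (A - a s) / (x - \<alpha> s)) \<longlonglongrightarrow> l"
proof -
  define \<rho> where "\<rho> s = (A - a s) / (x - \<alpha> s)" for s
  obtain K where K: "\<And>s. A - a s \<le> K * (x - \<alpha> s)" using dominates[OF assms] by blast
  have pos: "0 < x - \<alpha> s" for s using \<alpha>_less[of s] by simp
  have \<rho>: "0 \<le> \<rho> s" "\<rho> s \<le> K" for s
    using K[of s] pos[of s] incseq_le[OF assms(2,3), of s] by (auto simp: \<rho>_def field_simps)
  have less_iff: "\<rho> s < c \<longleftrightarrow> A - a s < c * (x - \<alpha> s)" "c < \<rho> s \<longleftrightarrow> A - a s > c * (x - \<alpha> s)" for s c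
    using pos[of s] by (auto simp: \<rho>_def field_simps)
  have "compact {0..K}" by simp
  then obtain l r where l: "l \<in> {0..K}" "strict_mono r" "(\<rho> \<circ> r) \<longlonglongrightarrow> l"
    unfolding compact_eq_seq_compact_metric seq_compact_def using \<rho> by (metis atLeastAtMost_iff)
  have near: "\<exists>\<^sub>F s in sequentially. Q (\<rho> s)" if "\<forall>\<^sub>F t in sequentially. Q (\<rho> (r t))" for Q
  proof -
    have "\<exists>\<^sub>F t in sequentially. Q (\<rho> (r t))" using that by (intro eventually_frequently) auto
    then show ?thesis
      unfolding frequently_sequentially by (meson l(2) order_trans seq_suble)
  qed
  have no_crossing: False
    if "0 < c" "c < d" "computable_real (\<lambda>_. c)" "computable_real (\<lambda>_. d)"
      "\<exists>\<^sub>F s in sequentially. \<rho> s < c" "\<exists>\<^sub>F s in sequentially. d < \<rho> s" for c d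
  proof -
    have "crossing \<alpha> x a A c d"
      using that assms unfolding less_iff by unfold_locales auto
    then show False by (rule crossing.contradiction)
  qed
  have "\<rho> \<longlonglongrightarrow> l"
  proof (rule order_tendstoI)
    fix y assume y: "y < l"
    show "\<forall>\<^sub>F s in sequentially. y < \<rho> s"
    proof (rule ccontr)
      assume "\<not> ?thesis"
      then have fr: "\<exists>\<^sub>F s in sequentially. \<rho> s \<le> y" by (simp add: not_eventually not_less)
      then obtain s where "\<rho> s \<le> y" by (auto dest: frequently_ex)
      then have "0 \<le> y" using \<rho>(1)[of s] by simp
      then obtain d where d: "y < d" "d < l" "computable_real (\<lambda>_. d)" using y dyadic_between by blast
      obtain c where c: "y < c" "c < d" "computable_real (\<lambda>_. c)" using d \<open>0 \<le> y\<close> dyadic_between by blast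
      have "\<exists>\<^sub>F s in sequentially. \<rho> s < c" using fr by (rule frequently_elim1) (use c in auto)
      moreover have "\<exists>\<^sub>F s in sequentially. d < \<rho> s"
        using order_tendstoD(1)[OF l(3) d(2)] by (intro near) simp
      ultimately show False using no_crossing[of c d] c d \<open>0 \<le> y\<close> by simp
    qed
  next
    fix y assume y: "l < y"
    show "\<forall>\<^sub>F s in sequentially. \<rho> s < y"
    proof (rule ccontr)
      assume "\<not> ?thesis"
      then have fr: "\<exists>\<^sub>F s in sequentially. y \<le> \<rho> s" by (simp add: not_eventually not_less)
      have "0 \<le> l" using l(1) by simp
      then obtain d where d: "l < d" "d < y" "computable_real (\<lambda>_. d)" using y dyadic_between by blast
      obtain c where c: "l < c" "c < d" "computable_real (\<lambda>_. c)" using d \<open>0 \<le> l\<close> dyadic_between by blast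
      have "\<exists>\<^sub>F s in sequentially. d < \<rho> s" using fr by (rule frequently_elim1) (use d in auto)
      moreover have "\<exists>\<^sub>F s in sequentially. \<rho> s < c"
        using order_tendstoD(2)[OF l(3) c(1)] by (intro near) simp
      ultimately show False using no_crossing[of c d] c d \<open>0 \<le> l\<close> by simp
    qed
  qed
  then show ?thesis unfolding \<rho>_def by blast
qed

text \<open>\<open>lb - la\<close> is the limit ratio of the drop that \<beta> still has to make; if
  it were positive, some 2^-h below it would witness a steady drop. The 1/2 stands for any positive
  number; the later use needs it below 1.\<close>

theorem item_game_derivative:
  assumes game: "item_game w A B"
    and comp_A: "computable_real (\<lambda>t. sum w (A t))" and comp_B: "computable_real (\<lambda>t. sum w (B t))"
    and lim_A: "(\<lambda>t. sum w (A t)) \<longlonglongrightarrow> a" and lim_B: "(\<lambda>t. sum w (B t)) \<longlonglongrightarrow> b"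
  shows "\<forall>\<^sub>F s in sequentially. - (x - \<alpha> s) / 2 \<le> (a - b) - (sum w (A s) - sum w (B s))"
proof -
  interpret item_game w A B by (rule game)
  have \<beta>: "\<beta> t = sum w (A t) - sum w (B t)" for t
    unfolding \<beta>_def using B_sub_A by (simp add: sum_diff)
  have pos: "0 < x - \<alpha> s" for s using \<alpha>_less[of s] by simp
  have inc: "incseq (\<lambda>t. sum w (A t))" "incseq (\<lambda>t. sum w (B t))"
    by (intro incseq_SucI sum_mono2 finite_A finite_B mono_A mono_B w_nonneg; simp)+
  obtain la where la: "(\<lambda>s. (a - sum w (A s)) / (x - \<alpha> s)) \<longlonglongrightarrow> la"
    using ratio_converges[OF comp_A inc(1) lim_A] by blast
  obtain lb where lb: "(\<lambda>s. (b - sum w (B s)) / (x - \<alpha> s)) \<longlonglongrightarrow> lb"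
    using ratio_converges[OF comp_B inc(2) lim_B] by blast
  have diff: "(\<lambda>s. (b - sum w (B s)) / (x - \<alpha> s) - (a - sum w (A s)) / (x - \<alpha> s)) \<longlonglongrightarrow> lb - la"
    by (intro tendsto_intros la lb)
  have eq: "(b - sum w (B s)) / (x - \<alpha> s) - (a - sum w (A s)) / (x - \<alpha> s) = (\<beta> s - (a - b)) / (x - \<alpha> s)" for s
    by (simp add: \<beta> diff_divide_distrib)
  have "lb \<le> la"
  proof (rule ccontr)
    assume "\<not> lb \<le> la"
    then have "0 < lb - la" by simp
    then obtain h :: nat where h: "(1/2) ^ h < lb - la"
      using real_arch_pow_inv[of "lb - la" "1/2"] by auto
    then obtain n0 where n0: "\<And>n. n0 \<le> n \<Longrightarrow> (1/2) ^ h < (\<beta> n - (a - b)) / (x - \<alpha> n)"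
      using order_tendstoD(1)[OF diff] unfolding eq eventually_sequentially by blast
    show False
    proof (rule no_steady_drop[OF game])
      show "computable_real \<beta>"
        unfolding \<beta> by (intro computable_real_diff comp_A comp_B)
      show "\<beta> \<longlonglongrightarrow> a - b" unfolding \<beta>[abs_def] by (intro tendsto_intros lim_A lim_B)
      show "(1/2) ^ h * (x - \<alpha> n) \<le> \<beta> n - (a - b)" if "n0 \<le> n" for n
        using n0[OF that] pos[of n] by (simp add: field_simps)
    qed
  qed
  then have "\<forall>\<^sub>F s in sequentially. (\<beta> s - (a - b)) / (x - \<alpha> s) < 1/2"
    using order_tendstoD(2)[OF diff, of "1/2"] unfolding eq by simp
  then show ?thesis
  proof eventually_elim
    case (elim s)
    then show ?case using pos[of s] by (simp add: \<beta> field_simps)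
  qed
qed

end

subsection \<open>Martin-Loef tests\<close>

lemma level_fmeasurable:
  assumes "mltest W"
  shows "level W n \<in> fmeasurable lborel" "measure lborel (level W n) \<le> (1/2) ^ n"
proof -
  have "countable {\<sigma>. (n, \<sigma>) \<in> W}" by (rule countableI_type)
  moreover have "cyl \<sigma> \<in> sets lborel" for \<sigma>
  proof -
    have "cyl \<sigma> = {dyadic_lo \<sigma>..<dyadic_lo \<sigma> + (1/2) ^ length \<sigma>}" by (auto simp: cyl_def)
    then show ?thesis by simp
  qed
  ultimately have s: "level W n \<in> sets lborel"
    unfolding level_def by (intro sets.countable_UN'') auto
  have e: "emeasure lborel (level W n) \<le> ennreal ((1/2) ^ n)"
    using assms unfolding mltest_def by blast
  then show "level W n \<in> fmeasurable lborel"
    using s by (intro fmeasurableI) (auto intro: le_less_trans)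
  then have "emeasure lborel (level W n) = ennreal (measure lborel (level W n))"
    by (intro emeasure_eq_measure2) (auto simp: fmeasurable_def top.not_eq_extremum)
  then show "measure lborel (level W n) \<le> (1/2) ^ n"
    using e by simp
qed

text \<open>One step of an account that runs from left to right: the new interval lies to the right
  of everything counted so far.\<close>

lemma measure_extend:
  fixes S :: "real set"
  assumes "S \<in> fmeasurable lborel" "{a..<b} \<subseteq> S" "e \<le> a" "a \<le> b"
  shows "measure lborel (S \<inter> {..<e}) + (b - a) \<le> measure lborel (S \<inter> {..<b})"
proof -
  have f: "S \<inter> {..<e} \<in> fmeasurable lborel" "S \<inter> {..<b} \<in> fmeasurable lborel"
    by (intro fmeasurable_Int_fmeasurable assms; simp)+
  have g: "{a..<b} \<in> fmeasurable lborel" using assms(4) by (intro fmeasurableI) auto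
  have "measure lborel (S \<inter> {..<e}) + (b - a) = measure lborel (S \<inter> {..<e}) + measure lborel {a..<b}"
    using assms by simp
  also have "\<dots> = measure lborel ((S \<inter> {..<e}) \<union> {a..<b})"
    using f g assms by (intro measure_Union[symmetric]) (auto simp: fmeasurable_def)
  also have "\<dots> \<le> measure lborel (S \<inter> {..<b})"
    using f g assms by (intro measure_mono_fmeasurable) (auto simp: fmeasurable_def)
  finally show ?thesis .
qed

section \<open>Transfer of randomness from \<open>x\<close> to \<open>y\<close>\<close>

locale random_transfer = solovay_complete +
  fixes q :: "nat \<Rightarrow> real" and y c :: real and n0 :: nat and W :: "(nat \<times> bool list) set" and f :: recf and F :: nat
  assumes computable_q: "computable_real q"
    and mono_q: "\<And>s t. s \<le> t \<Longrightarrow> q s \<le> q t"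
    and lim_q: "q \<longlonglongrightarrow> y"
    and c: "0 < c" and le: "\<And>t. n0 \<le> t \<Longrightarrow> c * (x - \<alpha> t) \<le> y - q t"
    and W: "mltest W" and f: "\<And>n \<sigma>. (n, \<sigma>) \<in> W \<longleftrightarrow> (\<exists>z. eval f [n, str_code \<sigma>] z)"
    and F: "frac y = y - real F"
begin

definition "R i = real F + lo i + (1/2) ^ len i"

text \<open>Cylinders are extended to the left by their own length, so that the approximations to a left
  endpoint are caught as well.\<close>
definition hit :: "nat \<Rightarrow> nat \<Rightarrow> nat \<Rightarrow> bool" where
  "hit n t i \<longleftrightarrow> opt_code (appr f t [n, i]) \<noteq> 0 \<and> real F + lo i - (1/2) ^ len i \<le> q t \<and> q t < R i"

text \<open>Preferring the rightmost end ensures that, once a cylinder around \<open>frac y\<close>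
  is a permanent hit, any further request would reach beyond \<open>y\<close>.\<close>

definition best :: "nat \<Rightarrow> nat \<Rightarrow> nat \<Rightarrow> bool" where
  "best n t i \<longleftrightarrow> hit n t i \<and> (\<forall>j<t. hit n t j \<longrightarrow> R j \<le> R i)"

definition choice :: "nat \<Rightarrow> nat \<Rightarrow> nat" where
  "choice n t = (LEAST i. if \<exists>i<t. best n t i then best n t i \<and> i < t else i = 0)"

definition request :: "nat \<Rightarrow> nat \<Rightarrow> nat \<Rightarrow> bool" where
  "request n t u \<longleftrightarrow> n0 \<le> t \<and> (u = 0 \<or> R (u - 1) \<le> q t) \<and> (\<exists>i<t. best n t i)"

text \<open>State 0: nothing pending; state Suc i: the approximation has to pass the right end R i.\<close>
primrec state :: "nat \<Rightarrow> nat \<Rightarrow> nat" where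
  "state n 0 = 0"
| "state n (Suc t) = (if request n t (state n t) then Suc (choice n t) else state n t)"

text \<open>The source of the \<theta> given to completeness: a request is worth the distance that
  \<open>q\<close> has to travel to pass its right end.\<close>

definition "cost n t = (\<Sum>s<t. if request n s (state n s) then R (choice n s) - q s else 0)"

lemma choice:
  assumes "\<exists>i<t. best n t i"
  shows "best n t (choice n t)" "choice n t < t"
proof -
  have "\<exists>i. if \<exists>i<t. best n t i then best n t i \<and> i < t else i = 0" using assms by auto
  from LeastI_ex[OF this] show "best n t (choice n t)" "choice n t < t"
    unfolding choice_def using assms by auto
qed

lemma best_ex:
  assumes "hit n t i" "i < t"
  shows "\<exists>i<t. best n t i"
proof -
  define S where "S = {i. i < t \<and> hit n t i}"
  have S: "finite S" "S \<noteq> {}" using assms by (auto simp: S_def)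
  then obtain m where m: "m \<in> S" "\<And>j. j \<in> S \<Longrightarrow> R j \<le> R m"
    using arg_min_if_finite(1)[of S "\<lambda>i. - R i"] arg_min_least[of S _ "\<lambda>i. - R i"] by force
  then show ?thesis unfolding best_def S_def by auto
qed

lemma computable_R: "computable G \<Longrightarrow> computable_real (\<lambda>x. R (G x))"
  unfolding R_def by (intro computable_real_intros computable_lo computable_len)

lemma decidable_hit:
  "computable N \<Longrightarrow> computable T \<Longrightarrow> computable I \<Longrightarrow> decidable (\<lambda>x. hit (N x) (T x) (I x))"
  unfolding hit_def
  by (intro computable_intros computable_real_intros computable_appr_pair computable_lo computable_len computable_R
      computable_real_compose[OF computable_q])

lemma decidable_best:
  assumes "computable N" "computable T" "computable I"
  shows "decidable (\<lambda>x. best (N x) (T x) (I x))"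
  unfolding best_def
  by (intro computable_intros decidable_hit decidable_real_le computable_R computable_compose[OF assms(1)]
     computable_compose[OF assms(2)] computable_compose[OF assms(3)] assms)

lemma computable_choice:
  assumes "computable N" "computable T"
  shows "computable (\<lambda>x. choice (N x) (T x))"
  unfolding choice_def
proof (rule computable_Least_less)
  show "computable (\<lambda>x. Suc (T x))" by (intro computable_Suc assms)
  show "\<exists>i<Suc (T x). if \<exists>i<T x. best (N x) (T x) i then best (N x) (T x) i \<and> i < T x else i = 0" for x
    by (cases "\<exists>i<T x. best (N x) (T x) i") (auto intro: less_SucI)
  show "decidable (\<lambda>p. if \<exists>i<T (pfst p). best (N (pfst p)) (T (pfst p)) i
      then best (N (pfst p)) (T (pfst p)) (psnd p) \<and> psnd p < T (pfst p) else psnd p = 0)"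
    unfolding if_bool_eq_conj
    by (intro computable_intros decidable_best computable_compose[OF assms(1)] computable_compose[OF assms(2)])
qed

lemma decidable_request:
  assumes "computable N" "computable T" "computable I"
  shows "decidable (\<lambda>x. request (N x) (T x) (I x))"
  unfolding request_def
  by (intro computable_intros decidable_best decidable_real_le computable_R computable_compose[OF assms(1)]
     computable_compose[OF assms(2)] computable_compose[OF assms(3)] assms computable_real_compose[OF computable_q])

lemma computable_state:
  assumes "computable N" "computable T"
  shows "computable (\<lambda>x. state (N x) (T x))"
proof -
  have "computable (\<lambda>x. rec_nat 0 (\<lambda>t u. if request (N x) t u then Suc (choice (N x) t) else u) (T x))"
    by (intro computable_rec computable_intros decidable_request computable_choice computable_compose[OF assms(1)] assms)
  moreover have "rec_nat 0 (\<lambda>t u. if request n t u then Suc (choice n t) else u) t = state n t" for n t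
    by (induction t) auto
  ultimately show ?thesis by simp
qed

lemma request_pos: "request n t u \<Longrightarrow> 0 < R (choice n t) - q t"
  using choice[of t n] unfolding request_def best_def hit_def by auto

lemma cost_mono: "s \<le> t \<Longrightarrow> cost n s \<le> cost n t"
  unfolding cost_def by (intro sum_mono2) (auto intro: less_imp_le[OF request_pos, simplified])

lemma cost_nonneg: "0 \<le> cost n t"
  unfolding cost_def by (intro sum_nonneg) (auto intro: less_imp_le[OF request_pos, simplified])

text \<open>A request charges the part of its cylinder to the right of \<open>q t\<close>. Because
  cylinders are extended only by their own length, the distance to \<open>R\<close> is at most twice
  the length of that part. The parts are disjoint, as a new request waits until \<open>q\<close> has
  passed the previous right end.\<close>

lemma cost_bound_aux:
  "cost n t \<le> 2 * (if state n t = 0 then 0 else measure lborel (level W n \<inter> {..<R (state n t - 1) - real F}))"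
proof (induction t)
  case 0
  show ?case by (simp add: cost_def)
next
  case (Suc t)
  show ?case
  proof (cases "request n t (state n t)")
    case False
    then have "cost n (Suc t) = cost n t" "state n (Suc t) = state n t" by (auto simp: cost_def)
    then show ?thesis using Suc by presburger
  next
    case True
    let ?i = "choice n t"
    have st: "state n (Suc t) = Suc ?i" using True by simp
    have cst: "cost n (Suc t) = cost n t + (R ?i - q t)" using True by (simp add: cost_def)
    have "best n t ?i" using True choice by (simp add: request_def)
    then have hit: "hit n t ?i" by (simp add: best_def)
    then have "eval f [n, ?i] (the (appr f t [n, ?i]))"
      unfolding hit_def by (intro appr_sound) auto
    then have inW: "(n, str_dec ?i) \<in> W" using f[of n "str_dec ?i"] by auto
    define a where "a = max (lo ?i) (q t - real F)"
    have a: "a \<le> R ?i - real F" "R ?i - q t \<le> 2 * (R ?i - real F - a)"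
      using hit by (auto simp: a_def hit_def R_def max_def)
    have sub: "{a..<R ?i - real F} \<subseteq> level W n"
      using inW unfolding level_def cyl_def a_def R_def lo_def len_def by auto
    show ?thesis
    proof (cases "state n t = 0")
      case z: True
      have "measure lborel (level W n \<inter> {..<a}) + (R ?i - real F - a) \<le> measure lborel (level W n \<inter> {..<R ?i - real F})"
        using level_fmeasurable(1)[OF W] sub a by (intro measure_extend) auto
      then have "R ?i - real F - a \<le> measure lborel (level W n \<inter> {..<R ?i - real F})"
        using measure_nonneg[of lborel "level W n \<inter> {..<a}"] by linarith
      then show ?thesis using Suc z a unfolding st cst by simp
    next
      case z: False
      then have "R (state n t - 1) - real F \<le> a" using True by (auto simp: request_def a_def)
      then have "measure lborel (level W n \<inter> {..<R (state n t - 1) - real F}) + (R ?i - real F - a) \<le> measure lborel (level W n \<inter> {..<R ?i - real F})"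
        using level_fmeasurable(1)[OF W] sub a by (intro measure_extend) auto
      then show ?thesis using Suc z a unfolding st cst by simp
    qed
  qed
qed

lemma cost_bound: "cost n t \<le> 2 * (1/2) ^ n"
proof -
  have "measure lborel (level W n \<inter> {..<e}) \<le> (1/2) ^ n" for e
    using level_fmeasurable[OF W, of n]
    by (intro order_trans[OF measure_mono_fmeasurable level_fmeasurable(2)[OF W]]) (auto simp: fmeasurable_def)
  then show ?thesis using cost_bound_aux[of n t] by (smt (verit) zero_le_power divide_nonneg_nonneg)
qed

text \<open>For large \<open>n\<close> completeness makes \<alpha>, and hence \<open>q\<close>,
  still move farther than any request demands, so requested ends lie below \<open>y\<close>. A
  cylinder around \<open>frac y\<close> has its end beyond \<open>y\<close> and is eventually always
  a hit, so from then on no request can be made. This leaves some end below \<open>y\<close> pending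
  forever, although \<open>q\<close> tends to \<open>y\<close>.\<close>

lemma not_covered: "\<exists>n. frac y \<notin> level W n"
proof (rule ccontr)
  assume "\<not> ?thesis"
  then have cov: "frac y \<in> level W n" for n by blast
  have "computable_real (\<lambda>t. \<Sum>n<t. 2 ^ n * cost (2 * n) t)"
    unfolding cost_def
    by (intro computable_real_intros computable_intros decidable_request computable_state computable_R
        computable_choice computable_real_compose[OF computable_q])
  moreover have "cost (2 * n) t \<le> 2 * (1/4) ^ n" for n t
    using cost_bound[of "2 * n" t] by (simp add: power_mult power2_eq_square)
  ultimately obtain e where e: "0 < e" "\<And>n s t. s \<le> t \<Longrightarrow> e * (2 ^ n * (cost (2 * n) t - cost (2 * n) s)) \<le> x - \<alpha> s"
    using complete_family[of "\<lambda>n. cost (2 * n)" 2] cost_mono cost_nonneg by blast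
  obtain n where n: "1 / (c * e) < 2 ^ n" using real_arch_pow[of 2 "1 / (c * e)"] by auto
  then have n': "1 < c * e * 2 ^ n" using c e(1) by (simp add: field_simps)
  have passed: "R (choice (2 * n) t) < y" if "request (2 * n) t (state (2 * n) t)" for t
  proof -
    let ?w = "R (choice (2 * n) t) - q t"
    have w: "0 < ?w" using request_pos[OF that] .
    have "?w = cost (2 * n) (Suc t) - cost (2 * n) t" using that by (simp add: cost_def)
    then have "c * (e * (2 ^ n * ?w)) \<le> c * (x - \<alpha> t)" using c e(2)[of t "Suc t" n] by simp
    also have "\<dots> \<le> y - q t" using that by (intro le) (simp add: request_def)
    finally have "c * e * 2 ^ n * ?w \<le> y - q t" by (simp add: algebra_simps)
    moreover have "1 * ?w < c * e * 2 ^ n * ?w" using w n' by (intro mult_strict_right_mono) auto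
    ultimately show ?thesis by simp
  qed
  have q_le: "q t \<le> y" for t using lim_q mono_q by (intro incseq_le) (auto simp: incseq_def)
  obtain \<sigma> where \<sigma>: "(2 * n, \<sigma>) \<in> W" "frac y \<in> cyl \<sigma>" using cov[of "2 * n"] by (auto simp: level_def)
  define i where "i = str_code \<sigma>"
  have i: "real F + lo i \<le> y" "y < R i"
    using \<sigma>(2) F by (auto simp: cyl_def R_def lo_def i_def)
  obtain z where "eval f [2 * n, i] z" using f \<sigma>(1) unfolding i_def by blast
  then obtain t0 where t0: "appr f t0 [2 * n, i] = Some z" using appr_complete by blast
  have "real F + lo i - (1/2) ^ len i < y" using i(1) by (smt (verit) zero_less_power divide_pos_pos)
  then have "\<forall>\<^sub>F t in sequentially. real F + lo i - (1/2) ^ len i < q t"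
    by (rule order_tendstoD(1)[OF lim_q])
  then obtain t1 where t1: "\<And>t. t1 \<le> t \<Longrightarrow> real F + lo i - (1/2) ^ len i < q t"
    unfolding eventually_sequentially by blast
  \<comment> \<open>Late enough for the cylinder to be enumerated, for \<open>q\<close> to have
    entered its extension, for requests to be allowed, and for \<open>i\<close> to be below the
    stage.\<close>
  define T where "T = t0 + t1 + n0 + Suc i"
  have hit: "hit (2 * n) t i" if "T \<le> t" for t
  proof -
    have "appr f t [2 * n, i] = Some z" using that by (intro appr_mono[OF t0]) (simp add: T_def)
    moreover have "real F + lo i - (1/2) ^ len i < q t" using that by (intro t1) (simp add: T_def)
    ultimately show ?thesis using q_le[of t] i(2) by (simp add: hit_def)
  qed
  have no_request: "\<not> request (2 * n) t (state (2 * n) t)" if "T \<le> t" for t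
  proof
    assume r: "request (2 * n) t (state (2 * n) t)"
    then have "best (2 * n) t (choice (2 * n) t)" using choice by (simp add: request_def)
    moreover have "i < t" using that by (simp add: T_def)
    ultimately have "R i \<le> R (choice (2 * n) t)" using hit[OF that] by (auto simp: best_def)
    then show False using passed[OF r] i(2) by simp
  qed
  then have pending: "state (2 * n) t \<noteq> 0 \<and> q t < R (state (2 * n) t - 1)" if "T \<le> t" for t
    using best_ex[OF hit[OF that]] that by (force simp: request_def T_def)
  have const: "state (2 * n) t = state (2 * n) T" if "T \<le> t" for t
    using that
  proof (induction t rule: dec_induct)
    case (step t)
    then show ?case using no_request[of t] by simp
  qed simp
  have inv: "state (2 * n) t \<noteq> 0 \<Longrightarrow> R (state (2 * n) t - 1) < y" for t
    by (induction t) (auto simp: passed)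
  have "R (state (2 * n) T - 1) < y" using inv pending[of T] by simp
  then have "\<forall>\<^sub>F t in sequentially. R (state (2 * n) T - 1) < q t \<and> T \<le> t"
    by (intro eventually_conj order_tendstoD(1)[OF lim_q] eventually_ge_at_top)
  then obtain t where "R (state (2 * n) T - 1) < q t" "T \<le> t" by (auto dest: eventually_happens)
  then show False using pending[of t] const[of t] by simp
qed

end

lemma (in solovay_complete) random_above:
  assumes "computable_real q" "incseq q" "q \<longlonglongrightarrow> y" "0 \<le> y" "0 < c" "\<And>t. n0 \<le> t \<Longrightarrow> c * (x - \<alpha> t) \<le> y - q t"
  shows "martin_loef_random y"
  unfolding martin_loef_random_def
proof (intro allI impI)
  fix W assume W: "mltest W"
  then obtain f where f: "\<And>n \<sigma>. (n, \<sigma>) \<in> W \<longleftrightarrow> (\<exists>z. eval f [n, str_code \<sigma>] z)"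
    unfolding mltest_def ce_seq_set_def by blast
  have "frac y = y - real (nat \<lfloor>y\<rfloor>)" using assms(4) by (simp add: frac_def)
  then interpret random_transfer \<alpha> x q y c n0 W f "nat \<lfloor>y\<rfloor>"
    using assms W f by unfold_locales (auto dest: incseqD)
  show "frac y \<notin> (\<Inter>n. level W n)" using not_covered by blast
qed

lemma left_ceI:
  assumes "computable_real q" "incseq q" "q \<longlonglongrightarrow> y"
  shows "left_ce y"
proof -
  obtain P Q E where 1: "computable P" "computable Q" "computable E" "\<And>t. q t = (real (P t) - real (Q t)) / 2 ^ E t"
    using computable_realE[OF assms(1)] by blast
  \<comment> \<open>\<open>int_decode\<close> reads \<open>2 * k\<close> as \<open>k\<close> and
    \<open>Suc (2 * k)\<close> as \<open>- k - 1\<close>, and \<open>rat_of_code\<close> adds 1 to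
    the denominator; both shifts are compensated.\<close>
  define C where "C t = prod_encode (if Q t \<le> P t then 2 * (P t - Q t) else Suc (2 * (Q t - P t - 1)), 2 ^ E t - 1)" for t
  have "computable C"
    unfolding C_def[abs_def] by (intro computable_intros 1)
  then obtain f where f: "\<And>t. eval f [t] (C t)" unfolding computable_def by blast
  have "rat_of_code (C t) = q t" for t
  proof -
    have "int_decode (2 * (P t - Q t)) = int (P t - Q t)" for t
      by (simp add: int_decode_def sum_decode_def)
    moreover have "int_decode (Suc (2 * (Q t - P t - 1))) = - int (Q t - P t)" if "P t < Q t" for t
      using that by (simp add: int_decode_def sum_decode_def)
    moreover have "real (Suc (2 ^ E t - 1)) = 2 ^ E t" by simp
    ultimately show ?thesis
      unfolding rat_of_code_def C_def 1(4) by (auto simp: of_nat_diff)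
  qed
  then have eq: "(\<lambda>t. rat_of_code (C t)) = q" by auto
  show ?thesis
    unfolding left_ce_def
    by (intro exI[of _ f] conjI allI exI[of _ C]) (use f assms eq in auto)
qed

subsection \<open>Halting probabilities of a universal machine\<close>

lemma sum_tendsto_infsum:
  fixes f :: "nat \<Rightarrow> real"
  assumes "f summable_on (\<Union>t. S t)" "\<And>t. finite (S t)" "\<And>s t. s \<le> t \<Longrightarrow> S s \<subseteq> S t"
  shows "(\<lambda>t. sum f (S t)) \<longlonglongrightarrow> infsum f (\<Union>t. S t)"
proof -
  have "filterlim S (finite_subsets_at_top (\<Union>t. S t)) sequentially"
    unfolding filterlim_finite_subsets_at_top
  proof (intro allI impI)
    fix X assume X: "finite X \<and> X \<subseteq> (\<Union>t. S t)"
    then have "\<forall>x\<in>X. \<exists>t. x \<in> S t" by blast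
    then obtain T where T: "\<And>x. x \<in> X \<Longrightarrow> x \<in> S (T x)" by metis
    have "\<forall>t\<ge>(\<Sum>x\<in>X. T x). finite (S t) \<and> X \<subseteq> S t \<and> S t \<subseteq> (\<Union>t. S t)"
    proof (intro allI impI conjI subsetI)
      fix t x assume t: "(\<Sum>x\<in>X. T x) \<le> t" and x: "x \<in> X"
      have "T x \<le> (\<Sum>x\<in>X. T x)" using X x by (intro member_le_sum) auto
      then show "x \<in> S t" using T[OF x] assms(3)[of "T x" t] t by auto
    qed (use assms in auto)
    then show "\<forall>\<^sub>F t in sequentially. finite (S t) \<and> X \<subseteq> S t \<and> S t \<subseteq> (\<Union>t. S t)"
      unfolding eventually_sequentially by blast
  qed
  from filterlim_compose[OF infsum_tendsto[OF assms(1)] this] show ?thesis by simp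
qed

definition weight :: "nat \<Rightarrow> real" where "weight i = (1/2) ^ len i"

lemma weight_pos: "0 < weight i"
  by (simp add: weight_def)

lemma weight_ge: "(1/2) ^ i \<le> weight i"
  unfolding weight_def using len_le[of i] by (intro power_decreasing) auto

lemma computable_weight: "computable G \<Longrightarrow> computable_real (\<lambda>x. weight (G x))"
  unfolding weight_def by (intro computable_real_intros computable_len)

lemma card_dyadic_interval:
  fixes a b :: nat
  assumes "a \<le> b" "b \<le> 2 ^ L"
  shows "finite {j. len j = L \<and> real a \<le> lo j * 2 ^ L \<and> lo j * 2 ^ L < real b}"
    "card {j. len j = L \<and> real a \<le> lo j * 2 ^ L \<and> lo j * 2 ^ L < real b} = b - a"
proof -
  let ?J = "{j. len j = L \<and> real a \<le> lo j * 2 ^ L \<and> lo j * 2 ^ L < real b}"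
  note bij = dyadic_lo_upto[of L]
  have bij': "bij_betw (\<lambda>j. lo j * 2 ^ L) {j. len j = L} (real ` {..<2 ^ L})"
  proof -
    have "bij_betw str_dec {j. len j = L} {\<sigma>. length \<sigma> = L}"
      by (rule bij_betw_byWitness[where f' = str_code]) (auto simp: len_def)
    from bij_betw_trans[OF this bij] show ?thesis by (simp add: o_def lo_def)
  qed
  have "bij_betw (\<lambda>j. lo j * 2 ^ L) ?J (real ` {a..<b})"
  proof (rule bij_betw_subset[OF bij'])
    show "(\<lambda>j. lo j * 2 ^ L) ` ?J = real ` {a..<b}"
    proof (intro equalityI subsetI)
      fix r assume "r \<in> (\<lambda>j. lo j * 2 ^ L) ` ?J"
      then obtain j where j: "r = lo j * 2 ^ L" "len j = L" "real a \<le> r" "r < real b" by auto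
      then have "r \<in> real ` {..<2 ^ L}" using bij' unfolding bij_betw_def by blast
      then show "r \<in> real ` {a..<b}" using j by auto
    next
      fix r assume r: "r \<in> real ` {a..<b}"
      then have "r \<in> real ` {..<2 ^ L}" using assms by auto
      then obtain j where "r = lo j * 2 ^ L" "len j = L" using bij' unfolding bij_betw_def by blast
      then show "r \<in> (\<lambda>j. lo j * 2 ^ L) ` ?J" using r by auto
    qed
  qed auto
  then show "finite ?J" "card ?J = b - a"
    using bij_betw_finite[of _ ?J "real ` {a..<b}"] bij_betw_same_card[of _ ?J "real ` {a..<b}"]
    by (auto simp: card_image)
qed

locale universal_machine =
  fixes V :: "nat \<Rightarrow> machine" and U :: machine and s :: "nat \<Rightarrow> bool list" and f :: recf
  assumes V: "effective_list V"
    and pf: "prefix_free_machine U"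
    and f: "\<And>\<sigma> \<tau>. U \<sigma> = Some \<tau> \<longleftrightarrow> eval f [str_code \<sigma>] (str_code \<tau>)"
    and s: "computable (\<lambda>e. str_code (s e))"
    and U: "\<And>e \<tau>. U (s e @ \<tau>) = V e \<tau>"
begin

definition out :: "nat \<Rightarrow> nat \<Rightarrow> nat" where "out t i = opt_code (appr f t [i])"

lemma computable_out: "computable F \<Longrightarrow> computable G \<Longrightarrow> computable (\<lambda>x. out (F x) (G x))"
  unfolding out_def by (rule computable_appr1)

lemma out_mono: "out t i \<noteq> 0 \<Longrightarrow> t \<le> t' \<Longrightarrow> out t' i = out t i"
  unfolding out_def using appr_mono[of f t "[i]" _ t'] by (cases "appr f t [i]") auto

lemma U_iff_out: "U (str_dec i) = Some (str_dec y) \<longleftrightarrow> (\<exists>t. out t i = Suc y)"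
  unfolding f by (simp add: out_def eval_iff_appr)

lemma out_unique: "out t i = Suc y \<Longrightarrow> out t' i = Suc z \<Longrightarrow> y = z"
  using U_iff_out[of i y] U_iff_out[of i z] by auto

lemma out_dom: "out t i \<noteq> 0 \<Longrightarrow> str_dec i \<in> dom U"
  using U_iff_out[of i] by (cases "out t i") auto

definition halting :: "nat set" where "halting = {i. \<exists>t. out t i \<noteq> 0}"

lemma weight_sum_le:
  assumes "finite F" "F \<subseteq> halting"
  shows "sum weight F \<le> 1"
proof -
  have "sum weight F = (\<Sum>\<sigma>\<in>str_dec ` F. (1/2) ^ length \<sigma>)"
    by (subst sum.reindex) (auto simp: inj_on_def weight_def len_def)
  also have "\<dots> \<le> 1"
  proof (rule Kraft_prefix_free)
    fix \<sigma> \<tau> assume "\<sigma> \<in> str_dec ` F" "\<tau> \<in> str_dec ` F" "prefix \<sigma> \<tau>"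
    moreover have "str_dec ` F \<subseteq> dom U" using assms(2) out_dom by (auto simp: halting_def)
    ultimately show "\<sigma> = \<tau>" using pf unfolding prefix_free_machine_def by blast
  qed (use assms in auto)
  finally show ?thesis .
qed

lemma weight_summable: "S \<subseteq> halting \<Longrightarrow> weight summable_on S"
  by (rule nonneg_bdd_above_summable_on)
    (auto intro!: bdd_aboveI[of _ 1] weight_sum_le less_imp_le[OF weight_pos])

end

section \<open>Completeness of the probability of a single output\<close>

locale universal_machine_output = universal_machine +
  fixes x0 :: nat
begin

definition A0 :: "nat \<Rightarrow> nat set" where "A0 t = {i. i < t \<and> out t i = Suc x0}"

definition "\<alpha> t = sum weight (A0 t)"
definition "x = infsum weight (\<Union>t. A0 t)"

lemma finite_A0 [simp]: "finite (A0 t)"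
  unfolding A0_def by simp

lemma A0_mono: "r \<le> t \<Longrightarrow> A0 r \<subseteq> A0 t"
  unfolding A0_def using out_mono[of r _ t] by auto

lemma A0_halting: "(\<Union>t. A0 t) \<subseteq> halting"
proof
  fix i assume "i \<in> (\<Union>t. A0 t)"
  then obtain t where "out t i = Suc x0" by (auto simp: A0_def)
  then have "out t i \<noteq> 0" by simp
  then show "i \<in> halting" unfolding halting_def by blast
qed

lemma \<alpha>_tendsto: "\<alpha> \<longlonglongrightarrow> x"
  unfolding \<alpha>_def[abs_def] x_def
  by (intro sum_tendsto_infsum weight_summable A0_halting finite_A0 A0_mono)

lemma incseq_\<alpha>: "incseq \<alpha>"
  unfolding \<alpha>_def by (intro incseq_SucI sum_mono2 A0_mono) (auto intro: less_imp_le[OF weight_pos])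

lemma computable_\<alpha>: "computable_real \<alpha>"
proof -
  have "\<alpha> = (\<lambda>t. \<Sum>i<t. if out t i = Suc x0 then weight i else 0)"
    unfolding \<alpha>_def[abs_def] A0_def by (simp add: sum.If_cases Int_def)
  then show ?thesis
    by (simp only:) (intro computable_real_intros computable_intros computable_out computable_weight)
qed

lemma coded_strings_eq:
  assumes "prefix (replicate e True @ False # \<tau>) (replicate e' True @ False # \<tau>')"
  shows "e = e' \<and> prefix \<tau> \<tau>'"
  using assms
proof (induction e arbitrary: e')
  case 0
  then show ?case by (cases e') auto
next
  case (Suc e)
  then show ?case by (cases e') auto
qed

text \<open>The machine reads its own index e (followed by a terminating bit), so that it can delay its
  outputs until U, which simulates it, has verifiably not yet produced them: no recursion theorem is needed.\<close>
lemma complete_aux: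
  assumes comp: "computable_real \<theta>" and mono: "incseq \<theta>" and nonneg: "0 \<le> \<theta> 0" and le1: "\<And>t. \<theta> t \<le> 1"
  obtains c where "0 < c" "\<And>r t. r \<le> t \<Longrightarrow> c * (\<theta> t - \<theta> r) \<le> x - \<alpha> r"
proof -
  obtain P Q E where PQE: "computable P" "computable Q" "computable E" "\<And>t. \<theta> t = (real (P t) - real (Q t)) / 2 ^ E t"
    using computable_realE[OF comp] by blast
  \<comment> \<open>In units of 2^-(L t) both \<open>\<theta> t\<close> and
    \<open>\<theta> (Suc t)\<close> are integers, so the interval between them is cut exactly into
    cylinders of length \<open>L t\<close>.\<close>
  define L where "L t = E t + E (Suc t)" for t
  have \<theta>_mono: "r \<le> t \<Longrightarrow> \<theta> r \<le> \<theta> t" for r t using mono by (rule incseqD)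
  have \<theta>_nonneg: "0 \<le> \<theta> t" for t using nonneg \<theta>_mono[of 0 t] by simp
  define Za where "Za t = (P t - Q t) * 2 ^ E (Suc t)" for t
  define Zb where "Zb t = (P (Suc t) - Q (Suc t)) * 2 ^ E t" for t
  have QP: "Q t \<le> P t" for t
  proof -
    have "0 \<le> \<theta> t * 2 ^ E t" using \<theta>_nonneg[of t] by simp
    also have "\<dots> = real (P t) - real (Q t)" unfolding PQE(4) by simp
    finally show ?thesis by simp
  qed
  have Za: "\<theta> t * 2 ^ L t = real (Za t)" and Zb: "\<theta> (Suc t) * 2 ^ L t = real (Zb t)" for t
    using QP[of t] QP[of "Suc t"] by (simp_all add: PQE(4) L_def Za_def Zb_def power_add of_nat_diff)
  have Zle: "Za t \<le> Zb t" "Zb t \<le> 2 ^ L t" for t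
  proof -
    have "\<theta> t * 2 ^ L t \<le> \<theta> (Suc t) * 2 ^ L t" by (intro mult_right_mono \<theta>_mono) auto
    then show "Za t \<le> Zb t" unfolding Za Zb by simp
    have "\<theta> (Suc t) * 2 ^ L t \<le> 1 * 2 ^ L t" by (intro mult_right_mono le1) auto
    then have "real (Zb t) \<le> real (2 ^ L t)" unfolding Zb by simp
    then show "Zb t \<le> 2 ^ L t" by (simp only: of_nat_le_iff)
  qed
  \<comment> \<open>\<open>code e j\<close> codes 1^e 0 followed by the string of \<open>j\<close>.
    The \<open>z e i\<close> below prepends \<open>s e\<close> to input \<open>i\<close>, giving the
    program with which \<open>U\<close> simulates machine \<open>e\<close> on
    \<open>i\<close>.\<close>
  define code where "code e j = 2 * (2 ^ e - 1) + 2 ^ e * (2 * j + 1)" for e j :: nat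
  have code: "str_dec (code e j) = replicate e True @ False # str_dec j" for e j
  proof -
    have "code e j = str_code (replicate e True @ False # str_dec j)"
      by (simp add: code_def str_code_append str_code_replicate_True)
    then show ?thesis by simp
  qed
  define sc where "sc e = str_code (s e)" for e
  define z where "z e i = sc e + 2 ^ len (sc e) * i" for e i
  have z: "str_dec (z e i) = s e @ str_dec i" for e i
  proof -
    have "z e i = str_code (s e @ str_dec i)"
      by (simp add: z_def sc_def str_code_append)
    then show ?thesis by simp
  qed
  define ok where "ok t j \<longleftrightarrow> len j = L t \<and> \<theta> t \<le> lo j \<and> lo j < \<theta> (Suc t)" for t j
  \<comment> \<open>Input \<open>code e j\<close> is answered if \<open>j\<close> is a cell of the
    step from \<open>\<theta> t\<close> to \<open>\<theta> (Suc t)\<close> and \<open>U\<close> is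
    silent at stage \<open>t\<close> on the program that simulates machine \<open>e\<close> on this
    very input.\<close>
  define R where "R i t \<longleftrightarrow> (\<exists>e<Suc i. \<exists>j<Suc i. i = code e j \<and> ok t j \<and> out t (z e i) = 0)" for i t
  have sc: "computable (\<lambda>x. sc (F x))" if "computable F" for F
    using s that unfolding sc_def by (rule computable_compose)
  have "decidable (\<lambda>p. R (pfst p) (psnd p))"
    unfolding R_def ok_def code_def z_def L_def
    by (intro computable_intros computable_out sc computable_len computable_lo computable_real_intros
        computable_real_compose[OF comp] computable_compose[OF PQE(3)])
  then obtain g where g: "\<And>n y. eval g [n] y \<longleftrightarrow> (\<exists>t. R n t) \<and> y = x0"
    using eval_semidecidable[of R x0] by blast
  define M :: machine where "M \<rho> = (if \<exists>t. R (str_code \<rho>) t then Some (str_dec x0) else None)" for \<rho>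
  have code_inj: "code e j = code e' j' \<longleftrightarrow> e = e' \<and> j = j'" for e j e' j'
  proof
    assume "code e j = code e' j'"
    then have *: "replicate e True @ False # str_dec j = replicate e' True @ False # str_dec j'"
      unfolding code[symmetric] by simp
    then have "e = e'" using coded_strings_eq[of e "str_dec j" e' "str_dec j'"] by simp
    then show "e = e' \<and> j = j'" using * by simp
  qed auto
  have code_ge: "e < Suc (code e j)" "j < Suc (code e j)" for e j
  proof -
    have "e < 2 ^ e" "(1::nat) \<le> 2 ^ e" by simp_all
    then have "e \<le> 2 * (2 ^ e - 1)" by linarith
    then show "e < Suc (code e j)" unfolding code_def by linarith
    have "1 * (2 * j + 1) \<le> 2 ^ e * (2 * j + 1)" by (intro mult_right_mono) auto
    then have "2 * j + 1 \<le> code e j" unfolding code_def mult_1 by (rule trans_le_add2)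
    then show "j < Suc (code e j)" by linarith
  qed
  have R_code: "R (code e j) t \<longleftrightarrow> ok t j \<and> out t (z e (code e j)) = 0" for e j t
    unfolding R_def code_inj using code_ge(1)[of e j] code_ge(2)[of j e] by auto
  have ok_upper: "lo j + (1/2) ^ len j \<le> \<theta> (Suc t)" if "ok t j" for t j
  proof -
    have "lo j * 2 ^ L t \<in> real ` {..<2 ^ L t}"
      using dyadic_lo_upto[of "L t"] that unfolding ok_def len_def lo_def bij_betw_def by blast
    then obtain n where n: "lo j * 2 ^ L t = real n" by auto
    have "lo j * 2 ^ L t < \<theta> (Suc t) * 2 ^ L t" using that unfolding ok_def by simp
    then have "n < Zb t" unfolding n Zb by simp
    then have "lo j * 2 ^ L t + 1 \<le> \<theta> (Suc t) * 2 ^ L t" unfolding n Zb by simp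
    then show ?thesis using that unfolding ok_def by (simp add: field_simps power_divide)
  qed
  \<comment> \<open>The intervals from \<open>\<theta> t\<close> to \<open>\<theta> (Suc t)\<close>
    are disjoint, so any point of a cell determines its stage. Both prefix-freeness and freshness
    rest on this.\<close>
  have ok_unique: "t = t'" if "ok t j" "\<theta> t' \<le> r" "r < \<theta> (Suc t')" "lo j \<le> r" "r < lo j + (1/2) ^ len j" for t t' j r
  proof -
    have "\<theta> t \<le> r" "r < \<theta> (Suc t)" using that ok_upper[OF that(1)] by (auto simp: ok_def)
    then have "\<not> Suc t \<le> t'" "\<not> Suc t' \<le> t"
      using that(2,3) \<theta>_mono[of "Suc t" t'] \<theta>_mono[of "Suc t'" t] by linarith+
    then show ?thesis by simp
  qed
  have "prefix_free_machine M"
    unfolding prefix_free_machine_def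
  proof (intro conjI allI impI)
    show "partial_computable_str M"
      unfolding partial_computable_str_def
      by (intro exI[of _ g] allI) (auto simp: M_def g)
  next
    fix \<rho> \<rho>' assume dom: "\<rho> \<in> dom M" "\<rho>' \<in> dom M" and pre: "prefix \<rho> \<rho>'"
    obtain e j t where 1: "str_code \<rho> = code e j" "ok t j"
      using dom(1) by (auto simp: M_def R_def dom_def split: if_splits)
    obtain e' j' t' where 2: "str_code \<rho>' = code e' j'" "ok t' j'"
      using dom(2) by (auto simp: M_def R_def dom_def split: if_splits)
    have \<rho>: "\<rho> = replicate e True @ False # str_dec j" "\<rho>' = replicate e' True @ False # str_dec j'"
      using 1(1) 2(1) code by (metis str_dec_code)+
    then have e: "e = e'" "prefix (str_dec j) (str_dec j')" 
      using coded_strings_eq[of e "str_dec j" e' "str_dec j'"] pre unfolding \<rho> by auto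
    then obtain \<tau> where \<tau>: "str_dec j' = str_dec j @ \<tau>" by (auto simp: prefix_def)
    have lo: "lo j' = lo j + (1/2) ^ len j * dyadic_lo \<tau>"
      by (simp add: lo_def \<tau> dyadic_lo_append len_def)
    have "0 < (1/2::real) ^ length \<tau>" by simp
    then have "0 \<le> dyadic_lo \<tau>" "dyadic_lo \<tau> < 1"
      using dyadic_lo_nonneg dyadic_lo_less[of \<tau>] by (auto simp del: zero_less_power)
    then have "lo j \<le> lo j'" "lo j' < lo j + (1/2) ^ len j" unfolding lo by auto
    then have "t = t'" using 1(2) 2(2) by (intro ok_unique[of t j t' "lo j'"]) (auto simp: ok_def)
    then have "length (str_dec j) = length (str_dec j')" using 1(2) 2(2) by (auto simp: ok_def len_def)
    then show "\<rho> = \<rho>'" using \<rho> e \<tau> by simp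
  qed
  \<comment> \<open>On inputs carrying this \<open>e\<close>, the silence tested in \<open>R\<close>
    is that of the simulation of \<open>M\<close> itself.\<close>
  then obtain e where e: "V e = M" using V unfolding effective_list_def by blast
  define \<zeta> where "\<zeta> j = z e (code e j)" for j
  have U\<zeta>: "U (str_dec (\<zeta> j)) = M (str_dec (code e j))" for j
    by (simp add: \<zeta>_def z U e)
  \<comment> \<open>Had \<open>U\<close> answered by stage \<open>t\<close>, then \<open>M\<close>
    would halt on this input, because \<open>U\<close> was silent at a stage of the cell; that stage
    can only be \<open>t\<close>. So \<open>U\<close> is silent at \<open>t\<close>, and for this
    reason it answers later.\<close>
  have fresh: "out t (\<zeta> j) = 0 \<and> (\<exists>t'. out t' (\<zeta> j) = Suc x0)" if "ok t j" for t j
  proof -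
    have "out t (\<zeta> j) = 0"
    proof (rule ccontr)
      assume "out t (\<zeta> j) \<noteq> 0"
      then have "M (str_dec (code e j)) \<noteq> None" using out_dom U\<zeta> by fastforce
      then obtain t' where t': "ok t' j" "out t' (\<zeta> j) = 0"
        by (auto simp: M_def R_code \<zeta>_def split: if_splits)
      then have "t = t'" using that by (intro ok_unique[of t j t' "lo j"]) (auto simp: ok_def)
      then show False using t' \<open>out t (\<zeta> j) \<noteq> 0\<close> by simp
    qed
    moreover from this have "R (code e j) t" using that by (simp add: R_code \<zeta>_def)
    then have "U (str_dec (\<zeta> j)) = Some (str_dec x0)" unfolding U\<zeta> M_def by auto
    ultimately show ?thesis unfolding U_iff_out by simp
  qed
  \<comment> \<open>The price of simulation: the prefix \<open>s e\<close> and the e + 1 bits that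
    announce \<open>e\<close>.\<close>
  define c where "c = (1/2::real) ^ (len (sc e) + Suc e)"
  have \<zeta>_inj: "\<zeta> j = \<zeta> j' \<longleftrightarrow> j = j'" for j j'
    unfolding \<zeta>_def z_def by (simp add: code_inj)
  have weight_\<zeta>: "weight (\<zeta> j) = c * (1/2) ^ len j" for j
    by (simp add: weight_def len_def \<zeta>_def z code c_def power_add sc_def)
  define J where "J t = {j. ok t j}" for t
  have J: "finite (J t)" "real (card (J t)) = (\<theta> (Suc t) - \<theta> t) * 2 ^ L t" for t
  proof -
    have "ok t j \<longleftrightarrow> len j = L t \<and> real (Za t) \<le> lo j * 2 ^ L t \<and> lo j * 2 ^ L t < real (Zb t)" for j
      unfolding Za[symmetric] Zb[symmetric] ok_def by simp
    then have "J t = {j. len j = L t \<and> real (Za t) \<le> lo j * 2 ^ L t \<and> lo j * 2 ^ L t < real (Zb t)}"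
      unfolding J_def by (intro Collect_cong)
    then show "finite (J t)" "real (card (J t)) = (\<theta> (Suc t) - \<theta> t) * 2 ^ L t"
      using card_dyadic_interval[OF Zle[of t]] Zle[of t] by (simp_all add: left_diff_distrib Za Zb of_nat_diff)
  qed
  have J_sum: "sum weight (\<zeta> ` J t) = c * (\<theta> (Suc t) - \<theta> t)" for t
  proof -
    have "sum weight (\<zeta> ` J t) = (\<Sum>j\<in>J t. c * (1/2) ^ L t)"
      by (subst sum.reindex) (auto simp: inj_on_def \<zeta>_inj weight_\<zeta> J_def ok_def)
    also have "\<dots> = c * (\<theta> (Suc t) - \<theta> t)" by (simp add: J(2) power_divide)
    finally show ?thesis .
  qed
  \<comment> \<open>Cells of stages from \<open>r\<close> on belong to distinct programs that
    \<open>A0 r\<close> does not contain yet, so their weight is still missing from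
    \<open>\<alpha> r\<close>.\<close>
  have "c * (\<theta> t - \<theta> r) \<le> x - \<alpha> r" if "r \<le> t" for r t
  proof -
    let ?S = "A0 r \<union> (\<Union>t'\<in>{r..<t}. \<zeta> ` J t')"
    have disj: "A0 r \<inter> (\<Union>t'\<in>{r..<t}. \<zeta> ` J t') = {}"
    proof (rule ccontr)
      assume "\<not> ?thesis"
      then obtain t' j where *: "\<zeta> j \<in> A0 r" "r \<le> t'" "ok t' j" by (auto simp: J_def)
      then have "out t' (\<zeta> j) \<noteq> 0" using out_mono[of r "\<zeta> j" t'] by (simp add: A0_def)
      then show False using fresh[OF *(3)] by simp
    qed
    have "c * (\<theta> t - \<theta> r) = (\<Sum>t'\<in>{r..<t}. c * (\<theta> (Suc t') - \<theta> t'))"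
      using sum_Suc_diff'[OF that, of \<theta>] by (simp add: sum_distrib_left[symmetric])
    also have "\<dots> = (\<Sum>t'\<in>{r..<t}. sum weight (\<zeta> ` J t'))" by (simp add: J_sum)
    also have "\<dots> = sum weight (\<Union>t'\<in>{r..<t}. \<zeta> ` J t')"
    proof (rule sum.UNION_disjoint[symmetric])
      show "\<forall>i\<in>{r..<t}. \<forall>j\<in>{r..<t}. i \<noteq> j \<longrightarrow> \<zeta> ` J i \<inter> \<zeta> ` J j = {}"
      proof (intro ballI impI, rule ccontr)
        fix t1 t2 assume "t1 \<noteq> t2" "\<zeta> ` J t1 \<inter> \<zeta> ` J t2 \<noteq> {}"
        then obtain j where "ok t1 j" "ok t2 j" by (auto simp: \<zeta>_inj J_def)
        then show False using ok_unique[of t1 j t2 "lo j"] \<open>t1 \<noteq> t2\<close> by (auto simp: ok_def)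
      qed
    qed (use J in auto)
    finally have "\<alpha> r + c * (\<theta> t - \<theta> r) = sum weight ?S"
      unfolding \<alpha>_def using disj J by (simp add: sum.union_disjoint)
    also have "\<dots> \<le> x"
      unfolding x_def
    proof (rule finite_sum_le_infsum[OF weight_summable[OF A0_halting]])
      show "?S \<subseteq> (\<Union>t. A0 t)"
      proof (intro Un_least UN_least subsetI)
        fix t' i assume "i \<in> \<zeta> ` J t'"
        then obtain t2 where "out t2 i = Suc x0" using fresh by (auto simp: J_def)
        then have "i \<in> A0 (max t2 (Suc i))" using out_mono[of t2 i "max t2 (Suc i)"] by (simp add: A0_def)
        then show "i \<in> (\<Union>t. A0 t)" by blast
      qed auto
    qed (use J in \<open>auto intro: less_imp_le[OF weight_pos]\<close>)
    finally show ?thesis by simp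
  qed
  moreover have "0 < c" by (simp add: c_def)
  ultimately show ?thesis by (rule that[rotated])
qed

sublocale solovay_complete \<alpha> x
proof
  show "computable_real \<alpha>" "incseq \<alpha>" "\<alpha> \<longlonglongrightarrow> x"
    by (rule computable_\<alpha> incseq_\<alpha> \<alpha>_tendsto)+
  fix \<theta> :: "nat \<Rightarrow> real" and K :: nat
  assume \<theta>: "computable_real \<theta>" "incseq \<theta>" "\<theta> 0 = 0" "\<And>t. \<theta> t \<le> real K"
  \<comment> \<open>Scaling by 2^-K brings \<theta> into [0, 1], where its increments correspond to
    cylinders.\<close>
  have K: "real K < 2 ^ K" by (rule of_nat_less_two_power)
  have "computable_real (\<lambda>t. \<theta> t * (1/2) ^ K)"
    by (intro computable_real_intros computable_intros \<theta>)
  moreover have "incseq (\<lambda>t. \<theta> t * (1/2) ^ K)"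
    using \<theta>(2) by (auto simp: incseq_def intro!: mult_right_mono)
  moreover have "\<theta> t * (1/2) ^ K \<le> 1" for t
    using order_trans[OF \<theta>(4)[of t] less_imp_le[OF K]] by (simp add: field_simps power_divide)
  ultimately obtain c where c: "0 < c" "\<And>r t. r \<le> t \<Longrightarrow> c * (\<theta> t * (1/2) ^ K - \<theta> r * (1/2) ^ K) \<le> x - \<alpha> r"
    using complete_aux[of "\<lambda>t. \<theta> t * (1/2) ^ K"] \<theta>(3) by auto
  show "\<exists>c>0. \<forall>r t. r \<le> t \<longrightarrow> c * (\<theta> t - \<theta> r) \<le> x - \<alpha> r"
    by (rule exI[of _ "c * (1/2) ^ K"]) (use c in \<open>auto simp: algebra_simps\<close>)
qed

end

section \<open>The probability of a co-c.e. set of outputs\<close>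

locale universal_machine_Pi01 = universal_machine_output +
  fixes X :: "bool list set" and g :: recf
  assumes x0: "str_dec x0 \<in> X"
    and g: "\<And>\<sigma>. \<sigma> \<notin> X \<longleftrightarrow> (\<exists>y. eval g [str_code \<sigma>] y)"
begin

definition gone :: "nat \<Rightarrow> nat \<Rightarrow> bool" where "gone t y \<longleftrightarrow> opt_code (appr g t [y]) \<noteq> 0"

lemma gone_mono: "gone t y \<Longrightarrow> t \<le> t' \<Longrightarrow> gone t' y"
  unfolding gone_def using appr_mono[of g t "[y]" _ t'] by (cases "appr g t [y]") auto

lemma gone_iff: "(\<exists>t. gone t y) \<longleftrightarrow> str_dec y \<notin> X"
proof -
  have "gone t y \<longleftrightarrow> (\<exists>z. appr g t [y] = Some z)" for t
    unfolding gone_def by (cases "appr g t [y]") auto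
  moreover have "(\<exists>z. eval g [y] z) \<longleftrightarrow> (\<exists>z t. appr g t [y] = Some z)"
    by (intro ex_cong1 eval_iff_appr)
  ultimately show ?thesis unfolding g by auto
qed

text \<open>Programs with output \<open>x0\<close> are left to \<alpha>; as that string belongs to
  \<open>X\<close>, they are never removed.\<close>

definition A1 :: "nat \<Rightarrow> nat set" where "A1 t = {i. i < t \<and> out t i \<noteq> 0 \<and> out t i \<noteq> Suc x0}"
definition B1 :: "nat \<Rightarrow> nat set" where "B1 t = {i \<in> A1 t. gone t (out t i - 1)}"

lemma A1_mono: "r \<le> t \<Longrightarrow> A1 r \<subseteq> A1 t"
  unfolding A1_def using out_mono[of r _ t] by auto

lemma B1_mono: "r \<le> t \<Longrightarrow> B1 r \<subseteq> B1 t"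
  unfolding B1_def using A1_mono[of r t] out_mono[of r _ t] by (auto simp: A1_def intro: gone_mono)

lemma finite_A1 [simp]: "finite (A1 t)" and finite_B1 [simp]: "finite (B1 t)"
  unfolding B1_def A1_def by simp_all

lemma A1_halting: "(\<Union>t. A1 t) \<subseteq> halting"
  by (auto simp: A1_def halting_def)

lemma B1_A1: "(\<Union>t. B1 t) \<subseteq> (\<Union>t. A1 t)"
  by (auto simp: B1_def)

definition "a1 = infsum weight (\<Union>t. A1 t)"
definition "b1 = infsum weight (\<Union>t. B1 t)"

lemma lim_A1: "(\<lambda>t. sum weight (A1 t)) \<longlonglongrightarrow> a1"
  unfolding a1_def by (intro sum_tendsto_infsum weight_summable A1_halting finite_A1 A1_mono)

lemma lim_B1: "(\<lambda>t. sum weight (B1 t)) \<longlonglongrightarrow> b1"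
  unfolding b1_def using A1_halting B1_A1
  by (intro sum_tendsto_infsum weight_summable finite_B1 B1_mono) auto

lemma computable_A1: "computable_real (\<lambda>t. sum weight (A1 t))"
proof -
  have "(\<lambda>t. sum weight (A1 t)) = (\<lambda>t. \<Sum>i<t. if out t i \<noteq> 0 \<and> out t i \<noteq> Suc x0 then weight i else 0)"
    by (simp add: A1_def sum.If_cases Int_def)
  then show ?thesis
    by (simp only:) (intro computable_real_intros computable_intros computable_out computable_weight)
qed

lemma computable_B1: "computable_real (\<lambda>t. sum weight (B1 t))"
proof -
  have "(\<lambda>t. sum weight (B1 t)) =
    (\<lambda>t. \<Sum>i<t. if (out t i \<noteq> 0 \<and> out t i \<noteq> Suc x0) \<and> opt_code (appr g t [out t i - 1]) \<noteq> 0 then weight i else 0)"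
    by (simp add: B1_def A1_def gone_def sum.If_cases Int_def conj_assoc)
  then show ?thesis
    by (simp only:) (intro computable_real_intros computable_intros computable_out computable_weight computable_appr1)
qed

lemma game: "item_game weight A1 B1"
proof
  show "sum weight (A1 t) \<le> 1" for t
    using A1_halting by (intro weight_sum_le) auto
qed (auto simp: weight_ge A1_mono B1_mono B1_def A1_def dest: subsetD[OF A1_mono] subsetD[OF B1_mono])

lemma Omega_eq: "Omega U X = x + (a1 - b1)"
proof -
  have "Omega U X = infsum (\<lambda>\<sigma>. (1/2) ^ length \<sigma>) (str_dec ` {i. \<exists>y. str_dec y \<in> X \<and> (\<exists>t. out t i = Suc y)})"
  proof -
    have "{\<sigma>. \<exists>\<tau>\<in>X. U \<sigma> = Some \<tau>} = str_dec ` {i. \<exists>y. str_dec y \<in> X \<and> (\<exists>t. out t i = Suc y)}"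
    proof (intro equalityI subsetI)
      fix \<sigma> assume "\<sigma> \<in> {\<sigma>. \<exists>\<tau>\<in>X. U \<sigma> = Some \<tau>}"
      then obtain \<tau> where "\<tau> \<in> X" "U \<sigma> = Some \<tau>" by blast
      then have "str_code \<sigma> \<in> {i. \<exists>y. str_dec y \<in> X \<and> (\<exists>t. out t i = Suc y)}"
        using U_iff_out[of "str_code \<sigma>" "str_code \<tau>"] by (intro CollectI exI[of _ "str_code \<tau>"]) simp
      from imageI[OF this, of str_dec]
      show "\<sigma> \<in> str_dec ` {i. \<exists>y. str_dec y \<in> X \<and> (\<exists>t. out t i = Suc y)}"
        by (simp only: str_dec_code)
    qed (auto simp: U_iff_out[symmetric])
    then show ?thesis unfolding Omega_def by simp
  qed
  also have "\<dots> = infsum weight {i. \<exists>y. str_dec y \<in> X \<and> (\<exists>t. out t i = Suc y)}"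
    by (subst infsum_reindex) (auto simp: inj_on_def o_def weight_def[abs_def] len_def)
  also have "{i. \<exists>y. str_dec y \<in> X \<and> (\<exists>t. out t i = Suc y)} = (\<Union>t. A0 t) \<union> ((\<Union>t. A1 t) - (\<Union>t. B1 t))"
    (is "?L = ?R")
  proof (intro equalityI subsetI)
    fix i assume "i \<in> ?L"
    then obtain y t where y: "str_dec y \<in> X" "out t i = Suc y" by blast
    define t' where "t' = max t (Suc i)"
    have t': "out t' i = Suc y" "i < t'" using y out_mono[of t i t'] by (auto simp: t'_def)
    have "i \<notin> B1 r" for r
    proof
      assume "i \<in> B1 r"
      then have "gone r (out r i - 1)" "out r i \<noteq> 0" by (auto simp: B1_def A1_def)
      moreover from this have "out r i = Suc y" using out_unique[OF y(2)] by (metis not0_implies_Suc)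
      ultimately show False using gone_iff[of y] y(1) by auto
    qed
    then show "i \<in> ?R" using t' by (cases "y = x0") (auto simp: A0_def A1_def)
  next
    fix i assume i: "i \<in> ?R"
    then consider t where "i \<in> A0 t" | t where "i \<in> A1 t" "\<And>r. i \<notin> B1 r" by blast
    then show "i \<in> ?L"
    proof cases
      case 1
      then show ?thesis using x0 by (auto simp: A0_def)
    next
      case 2
      then obtain y where y: "out t i = Suc y"
        unfolding A1_def by (cases "out t i") auto
      have "\<not> gone r y" for r
      proof
        assume "gone r y"
        then have "gone (max r t) y" by (rule gone_mono) simp
        moreover have "out (max r t) i = Suc y" using out_mono[of t i "max r t"] y by simp
        moreover have "i \<in> A1 (max r t)" using 2(1) A1_mono[of t "max r t"] by auto
        ultimately show False using 2(2)[of "max r t"] by (simp add: B1_def)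
      qed
      then have "str_dec y \<in> X" using gone_iff by blast
      then show ?thesis using y by blast
    qed
  qed
  also have "infsum weight \<dots> = x + infsum weight ((\<Union>t. A1 t) - (\<Union>t. B1 t))"
    unfolding x_def
  proof (rule infsum_Un_disjoint)
    show "(\<Union>t. A0 t) \<inter> ((\<Union>t. A1 t) - (\<Union>t. B1 t)) = {}"
    proof -
      have False if i: "i \<in> A0 r" "i \<in> A1 t" for i r t
      proof -
        obtain y where "out t i = Suc y" "y \<noteq> x0"
          using i(2) unfolding A1_def by (cases "out t i") auto
        then show False using i(1) out_unique[of r i x0 t y] by (auto simp: A0_def)
      qed
      then show ?thesis by blast
    qed
  qed (use A0_halting A1_halting in \<open>auto intro!: weight_summable\<close>)
  also have "infsum weight ((\<Union>t. A1 t) - (\<Union>t. B1 t)) = a1 - b1"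
  proof -
    have "infsum weight ((\<Union>t. B1 t) \<union> ((\<Union>t. A1 t) - (\<Union>t. B1 t))) = b1 + infsum weight ((\<Union>t. A1 t) - (\<Union>t. B1 t))"
      unfolding b1_def using order_trans[OF B1_A1 A1_halting] A1_halting
      by (intro infsum_Un_disjoint weight_summable) auto
    moreover have "(\<Union>t. B1 t) \<union> ((\<Union>t. A1 t) - (\<Union>t. B1 t)) = (\<Union>t. A1 t)" using B1_A1 by blast
    ultimately show ?thesis by (simp add: a1_def)
  qed
  finally show ?thesis .
qed

lemma Omega_left_ce_random: "left_ce (Omega U X) \<and> martin_loef_random (Omega U X)"
proof -
  define \<gamma> where "\<gamma> t = \<alpha> t + (sum weight (A1 t) - sum weight (B1 t))" for t
  define y where "y = Omega U X"
  have lim: "\<gamma> \<longlonglongrightarrow> y"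
    unfolding \<gamma>_def[abs_def] y_def Omega_eq by (intro tendsto_intros \<alpha>_tendsto lim_A1 lim_B1)
  have comp: "computable_real \<gamma>"
    unfolding \<gamma>_def[abs_def] by (intro computable_real_intros computable_\<alpha> computable_A1 computable_B1)
  obtain n0 where n0: "\<And>t. n0 \<le> t \<Longrightarrow> - (x - \<alpha> t) / 2 \<le> (a1 - b1) - (sum weight (A1 t) - sum weight (B1 t))"
    using item_game_derivative[OF game computable_A1 computable_B1 lim_A1 lim_B1]
    unfolding eventually_sequentially by blast
  \<comment> \<open>\<alpha> contributes all of \<open>x - \<alpha> t\<close>, and the difference of
    \<open>A1\<close> and \<open>B1\<close> takes back at most half of it.\<close>
  have half: "1/2 * (x - \<alpha> t) \<le> y - \<gamma> t" if "n0 \<le> t" for t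
    using n0[OF that] by (simp add: \<gamma>_def y_def Omega_eq)
  \<comment> \<open>Negated, since record chains follow minima: \<open>q\<close> is the running
    maximum of \<gamma> from \<open>n0\<close> on, and constantly \<open>\<gamma> n0\<close>
    before.\<close>
  define P where "P N u v \<longleftrightarrow> - \<gamma> v < - \<gamma> u" for N u v :: nat
  define q where "q t = \<gamma> (chain P n0 t)" for t
  have q_ge: "\<gamma> t \<le> q t" if "n0 \<le> t" for t
    using chain_record[of P n0 "\<lambda>t. - \<gamma> t" t t] that by (simp add: P_def q_def)
  have q_half: "1/2 * (x - \<alpha> t) \<le> y - q t" if "n0 \<le> t" for t
  proof -
    note b = chain_bounds[OF that, of P]
    \<comment> \<open>The maximum was attained at an earlier stage, where \<alpha> had at least as
      far to go.\<close>
    have "1/2 * (x - \<alpha> t) \<le> 1/2 * (x - \<alpha> (chain P n0 t))"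
      using incseqD[OF incseq_\<alpha> b(2)] by simp
    also have "\<dots> \<le> y - q t" unfolding q_def by (rule half[OF b(1)])
    finally show ?thesis .
  qed
  have q_le: "q t \<le> y" if "n0 \<le> t" for t
    using q_half[OF that] \<alpha>_le[of t] by simp
  have comp_q: "computable_real q"
    unfolding q_def[abs_def] P_def
    by (intro computable_real_compose[OF comp] computable_chain computable_real_intros computable_intros)
  have inc_q: "incseq q"
    by (rule incseq_SucI) (auto simp: q_def P_def)
  have lim_q: "q \<longlonglongrightarrow> y"
  proof (rule tendsto_sandwich[OF _ _ lim tendsto_const])
    show "\<forall>\<^sub>F t in sequentially. \<gamma> t \<le> q t" "\<forall>\<^sub>F t in sequentially. q t \<le> y"
      using q_ge q_le unfolding eventually_sequentially by blast+
  qed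
  have "0 \<le> y" unfolding y_def Omega_def by (intro infsum_nonneg) simp
  then have "martin_loef_random y"
    using random_above[OF comp_q inc_q lim_q _ _ q_half] by simp
  moreover have "left_ce y" using comp_q inc_q lim_q by (rule left_ceI)
  ultimately show ?thesis by (simp add: y_def)
qed

end

theorem theorem1p3:
  fixes V :: "nat \<Rightarrow> machine" and U :: machine and X :: "bool list set"
  assumes "effective_list V"
    and "universal_wrt V U"
    and "X \<noteq> {}"
    and "Pi01_str_set X"
  shows "left_ce (Omega U X) \<and> martin_loef_random (Omega U X)"
proof -
  obtain s where s: "computable_str_seq s" "\<And>e \<tau>. U (s e @ \<tau>) = V e \<tau>" and pf: "prefix_free_machine U"
    using assms(2) unfolding universal_wrt_def by blast
  obtain f where f: "\<And>\<sigma> \<tau>. U \<sigma> = Some \<tau> \<longleftrightarrow> eval f [str_code \<sigma>] (str_code \<tau>)"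
    using pf unfolding prefix_free_machine_def partial_computable_str_def by blast
  obtain g where g: "\<And>\<sigma>. \<sigma> \<notin> X \<longleftrightarrow> (\<exists>y. eval g [str_code \<sigma>] y)"
    using assms(4) unfolding Pi01_str_set_def ce_str_set_def by auto
  obtain x0 where "x0 \<in> X" using assms(3) by blast
  moreover have "computable (\<lambda>e. str_code (s e))"
    using s(1) unfolding computable_str_seq_def computable_def .
  ultimately interpret universal_machine_Pi01 V U s f "str_code x0" X g
    using assms(1) pf f s(2) g by unfold_locales auto
  show ?thesis by (rule Omega_left_ce_random)
qed

end
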